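(* With $I,\varphi,\chi$ as defined in the context, the following hold. 1. The function $\varphi$ is convex jointly in $m$ and $\psi$. 2. The function $\chi$ is convex and continuous jointly in $(\rho_{\rm mi},\rho_{\rm ma})\in[0,\infty)^2$. In particular, $\rho\mapsto\chi(\rho,0)$ is convex. 3. For any $m$, the function $\varphi(m,\cdot)$ is non-decreasing in $\psi$ with respect to the stochastic ordering $\le_{\rm st}$. 4. The function $\chi$ is non-decreasing in $\rho_{\rm ma}$. 5. For any $m\in[0,\infty)^{\mathbb N}$ and any $P\in\mathcal M_1^{(\mathrm s)}(\Omega)$ satisfying $P(N_0^{(\delta_k)})=m_k$ for all $k\in\mathbb N$, we have $I(P)=H(m|q)+I_m(P)$. In particular, $I(\mathbb P^m)=H(m|q)$ for any $m\in[0,\infty)^{\mathbb N}$. 6. $\chi(0,0)=\chi^{(v=0)}(0,0)=\sum_k q_k$ and $\partial_{\rho_{\rm mi}}\chi(0,0)=-\infty$ (right derivative). 7. For all $\rho\in[0,\infty)$, $$\chi^{(v=0)}(\rho,0)+\bar v\rho^2\le\chi(\rho,0)\le\chi^{(v=0)}(\rho,0)+\bar v(\rho^2+\rho),$$ where the first inequality is asserted under the assumption $2v(0)\ge\bar v$.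
   Context: Setting. $\mathbb N=\{1,2,\dots\}$, $\mathbb N_0=\mathbb N\cup\{0\}$, $d\in\mathbb N$. For every $k\in\mathbb N$ a deterministic mark $G_k\subset\mathbb Z^d$ is fixed with $|G_k|=k$ and $([-L_k,L_k]^d\cap\mathbb Z^d)\subset G_k\subset([-L_k-1,L_k+1]^d\cap\mathbb Z^d)$ for some $L_k\in\mathbb N_0$. $\Omega$ is the set of configurations $\omega=\sum_{k\in\mathbb N}\sum_{x\in\mathbb Z^d}\xi^{(k)}(x)\delta_{(x,G_k)}$ with $\xi^{(k)}(x)\in\mathbb N_0$ (the number of points at $x$ carrying the mark $G_k$), with the $\sigma$-algebra generated by the evaluations $\xi^{(k)}(x)$. Counting: $N_\Lambda^{(\delta_k)}(\omega)=\sum_{x\in\Lambda}\xi^{(k)}(x)$, $N_\Lambda^{(\ell)}=\sum_{k}k N_\Lambda^{(\delta_k)}$; for $\Lambda=\{0\}$ write $N_0^{(\cdot)}$. Interaction: $v\colon\mathbb Z^d\to[0,\infty)$ with $v(x)=v(-x)$ and finite support; $\bar v=\sum_{i\in\mathbb Z^d}v(i)$; $T_{x,y}(G,G')=\sum_{i\in G}\sum_{j\in G'}v(x+i-y-j)$; $\Phi_{\Lambda,\Lambda'}(\omega)=\sum_{x\in\Lambda,y\in\Lambda'}\sum_{k,l\in\mathbb N}\xi^{(k)}(x)\xi^{(l)}(y)T_{x,y}(G_k,G_l)$, and $\Phi_{0,\mathbb Z^d}=\Phi_{\{0\},\mathbb Z^d}$. Reference measure: $q=(q_k)_{k\in\mathbb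 N}$ is a summable sequence of positive numbers; under $\mathbb P$ the variables $\xi^{(k)}(x)$ are independent and $\xi^{(k)}(x)$ is Poisson distributed with parameter $q_k$. For $m\in[0,\infty)^{\mathbb N}$, $\mathbb P^m$ is the same process with $q$ replaced by $m$. For $Q\subset\mathbb Z^d$, $P_Q$ is the law under $P$ of the restriction of $\omega$ to points in $Q$ (with their full marks). $\mathcal M_1(\mathbb N_0)$ is the set of probability measures on $\mathbb N_0$ and $\mathcal M_1^{(\mathrm s)}(\Omega)$ the set of shift-invariant probability measures on $\Omega$; $P(f)=\int f\,\mathrm dP$. The entropy density is $I(P)=\lim_{Q\uparrow\mathbb Z^d}\frac1{|Q|}H(P_Q|\mathbb P_Q)\in[0,\infty]$, the limit along centred boxes with diverging radius ($H$ relative entropy), and $I_m$ is defined in the same way with $\mathbb P^m$ in place of $\mathbb P$. For sequences, $H(m|q)=\sum_{k\in\mathbb N}\big(q_k-m_k+m_k\log\frac{m_k}{q_k}\big)$ with $0\log0=0$. For $m\in[0,\infty)^{\mathbb N}$, $\psi\in\mathcal M_1(\mathbb N_0)$, $$\varphi(m,\psi)=\inf\Big\{\sum_{a\in\mathbb N_0}\psi(a)\big[I(P_a)+P_a(\Phi_{0,\mathbb Z^d})+2\bar v aP_a(N_0^{(\ell)})+\bar v a^2\big]\colon P_0,P_1,\dots\in\mathcal M_1^{(\mathrm s)}(\Omega),\ \sum_{a}\psi(a)P_a(N_0^{(\delta_k)})=m_k\ \forall k\in\mathbb N\Big\}\in[0,\infty]$$ (summands with $\psi(a)=0$ are $0$),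 and for $\rho_{\rm mi},\rho_{\rm ma}\ge0$, $\chi(\rho_{\rm mi},\rho_{\rm ma})=\inf\{\varphi(m,\psi)\colon\sum_k km_k=\rho_{\rm mi},\ \sum_a a\psi(a)=\rho_{\rm ma}\}$. $\chi^{(v=0)}$ denotes $\chi$ for the model with $v$ replaced by $0$ (non-interacting model). Stochastic ordering on $\mathcal M_1(\mathbb N_0)$: $\psi\le_{\rm st}\psi'$ iff $\psi([a,\infty))\le\psi'([a,\infty))$ for all $a\in\mathbb N_0$. *)

theory Defs
  imports "HOL-Probability.Probability"
begin

text \<open>
  The lattice of dimension \<open>d = CARD('d)\<close> is the type \<open>int^'d\<close>. Mark sizes range over \<open>{1..}\<close>;
  the value at 0 of a family indexed by mark sizes is never used.
  A configuration is the family of its multiplicities: \<open>\<omega> (k, x)\<close> is the number of points at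
  the site x that carry the mark \<open>G k\<close>.
\<close>

definition lattice_box :: "nat \<Rightarrow> (int^'d::finite) set" where
  "lattice_box n = {x. \<forall>i. \<bar>x $ i\<bar> \<le> int n}"

type_synonym 'd config = "nat \<times> (int^'d) \<Rightarrow> nat"

definition config_space :: "(int^'d::finite) set \<Rightarrow> 'd config measure" where
  "config_space Q = (\<Pi>\<^sub>M kx\<in>{1..} \<times> Q. count_space UNIV)"

definition shift :: "int^'d::finite \<Rightarrow> 'd config \<Rightarrow> 'd config" where
  "shift z \<omega> = (\<lambda>(k, x). \<omega> (k, x + z))"

definition shift_invariant :: "'d::finite config measure set" where
  "shift_invariant = {P. prob_space P \<and> sets P = sets (config_space UNIV) \<and>
     (\<forall>z. distr P (config_space UNIV) (shift z) = P)}"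

definition restrict_law :: "(int^'d::finite) set \<Rightarrow> 'd config measure \<Rightarrow> 'd config measure" where
  "restrict_law Q P = distr P (config_space Q) (\<lambda>\<omega>. restrict \<omega> ({1..} \<times> Q))"

definition N_mark :: "(int^'d::finite) set \<Rightarrow> nat \<Rightarrow> 'd config \<Rightarrow> ennreal" where
  "N_mark \<Lambda> k \<omega> = (\<Sum>\<^sub>\<infinity>x\<in>\<Lambda>. of_nat (\<omega> (k, x)))"

definition N_particles :: "(int^'d::finite) set \<Rightarrow> 'd config \<Rightarrow> ennreal" where
  "N_particles \<Lambda> \<omega> = (\<Sum>\<^sub>\<infinity>k\<in>{1..}. of_nat k * N_mark \<Lambda> k \<omega>)"

definition vbar :: "(int^'d::finite \<Rightarrow> real) \<Rightarrow> real" where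
  "vbar v = (\<Sum>i | v i \<noteq> 0. v i)"

definition mark_interaction ::
  "(int^'d::finite \<Rightarrow> real) \<Rightarrow> int^'d \<Rightarrow> int^'d \<Rightarrow> (int^'d) set \<Rightarrow> (int^'d) set \<Rightarrow> real" where
  "mark_interaction v x y A B = (\<Sum>i\<in>A. \<Sum>j\<in>B. v (x + i - y - j))"

definition Phi ::
  "(nat \<Rightarrow> (int^'d::finite) set) \<Rightarrow> (int^'d \<Rightarrow> real) \<Rightarrow> (int^'d) set \<Rightarrow> (int^'d) set
    \<Rightarrow> 'd config \<Rightarrow> ennreal" where
  "Phi G v \<Lambda> \<Lambda>' \<omega> = (\<Sum>\<^sub>\<infinity>(x, y)\<in>\<Lambda> \<times> \<Lambda>'. \<Sum>\<^sub>\<infinity>(k, l)\<in>{1..} \<times> {1..}.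
     of_nat (\<omega> (k, x)) * of_nat (\<omega> (l, y)) * ennreal (mark_interaction v x y (G k) (G l)))"

text \<open>The library's \<open>poisson_pmf\<close> is only specified for positive rates.\<close>

definition poisson_law :: "real \<Rightarrow> nat pmf" where
  "poisson_law r = (if r = 0 then return_pmf 0 else poisson_pmf r)"

definition poisson_process :: "(nat \<Rightarrow> real) \<Rightarrow> 'd::finite config measure" where
  "poisson_process m = (\<Pi>\<^sub>M (k, x)\<in>{1..} \<times> UNIV. measure_pmf (poisson_law (m k)))"

text \<open>
  \<open>H(P | R)\<close>. The negative part of the logarithmic density is always P-integrable, so
  non-integrability means that the integral is infinite; the library's \<open>KL_divergence\<close> is a
  Bochner integral and would be 0 there. Its second argument is the reference measure.
\<close>

definition rel_entropy :: "'a measure \<Rightarrow> 'a measure \<Rightarrow> ennreal" where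
  "rel_entropy P R =
     (if absolutely_continuous R P \<and> integrable P (entropy_density (exp 1) R P)
      then ennreal (KL_divergence (exp 1) R P) else \<infinity>)"

text \<open>\<open>I\<^sub>m\<close>; the entropy density I of the model is the case \<open>m = q\<close>.\<close>

definition specific_entropy :: "(nat \<Rightarrow> real) \<Rightarrow> 'd::finite config measure \<Rightarrow> ennreal" where
  "specific_entropy m P = lim (\<lambda>n.
     rel_entropy (restrict_law (lattice_box n) P) (restrict_law (lattice_box n) (poisson_process m))
       / of_nat (card (lattice_box n :: (int^'d) set)))"

text \<open>The summands are nonnegative; \<open>ln 0 = 0\<close>, so \<open>0 log 0 = 0\<close> holds.\<close>

definition seq_entropy :: "(nat \<Rightarrow> real) \<Rightarrow> (nat \<Rightarrow> real) \<Rightarrow> ennreal" where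
  "seq_entropy m q = (\<Sum>\<^sub>\<infinity>k\<in>{1..}. ennreal (q k - m k + m k * ln (m k / q k)))"

text \<open>
  Below, \<open>0 * \<infinity> = 0\<close> in \<open>ennreal\<close> implements the convention that summands with
  \<open>\<psi>(a) = 0\<close> vanish.
\<close>

definition varphi ::
  "(nat \<Rightarrow> (int^'d::finite) set) \<Rightarrow> (int^'d \<Rightarrow> real) \<Rightarrow> (nat \<Rightarrow> real)
    \<Rightarrow> (nat \<Rightarrow> real) \<Rightarrow> nat pmf \<Rightarrow> ennreal" where
  "varphi G v q m \<psi> = Inf {\<Sum>a. ennreal (pmf \<psi> a) *
       (specific_entropy q (P a) + (\<integral>\<^sup>+\<omega>. Phi G v {0} UNIV \<omega> \<partial>P a)
        + 2 * ennreal (vbar v) * of_nat a * (\<integral>\<^sup>+\<omega>. N_particles {0} \<omega> \<partial>P a)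
        + ennreal (vbar v) * of_nat a ^ 2) | P.
     range P \<subseteq> shift_invariant \<and>
     (\<forall>k\<ge>1. (\<Sum>a. ennreal (pmf \<psi> a) * (\<integral>\<^sup>+\<omega>. N_mark {0} k \<omega> \<partial>P a)) = ennreal (m k))}"

definition chi ::
  "(nat \<Rightarrow> (int^'d::finite) set) \<Rightarrow> (int^'d \<Rightarrow> real) \<Rightarrow> (nat \<Rightarrow> real)
    \<Rightarrow> real \<Rightarrow> real \<Rightarrow> ennreal" where
  "chi G v q \<rho>mi \<rho>ma = Inf {varphi G v q m \<psi> | m \<psi>. (\<forall>k\<ge>1. 0 \<le> m k) \<and>
     ((\<lambda>k. real k * m k) has_sum \<rho>mi) {1..} \<and> ((\<lambda>a. real a * pmf \<psi> a) has_sum \<rho>ma) UNIV}"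

definition stoch_le :: "nat pmf \<Rightarrow> nat pmf \<Rightarrow> bool" (infix \<open>\<le>\<^sub>s\<^sub>t\<close> 50) where
  "\<psi> \<le>\<^sub>s\<^sub>t \<psi>' \<longleftrightarrow> (\<forall>a. measure_pmf.prob \<psi> {a..} \<le> measure_pmf.prob \<psi>' {a..})"

end

theory Submission
  imports Defs "HOL-Real_Asymp.Real_Asymp"
begin

text \<open>
  Relative entropy is handled through the Donsker--Varadhan formula: it is the supremum of the
  functionals \<open>P f - ln (R (exp f))\<close> over bounded f, each affine in P. Hence it is convex under mixtures,
  decreases under measurable maps, is superadditive over components that are independent under R,
  and on a product space it is the supremum over finitely many coordinates. Superadditivity and
  tiling by cubes turn the entropy density into a supremum over boxes; for finitely many coordinates
  the Poisson laws have an explicit mutual density, which gives \<open>I = H(m | q) + I\<^sub>m\<close> in the limit.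

  A competitor for \<open>\<phi>\<close> indexed by the values of a randomised variable can be averaged down to one
  indexed by a. A mixture gives joint convexity, and the monotone coupling of \<open>\<psi> \<le> \<psi>'\<close> gives monotonicity.
  \<open>\<chi>\<close> is convex and monotone in \<open>\<rho>\<^sub>m\<^sub>a\<close>, so joint continuity reduces to continuity in each variable, where
  only lower semicontinuity at \<open>\<rho>\<^sub>m\<^sub>i = 0\<close> needs an entropy bound. Poisson competitors give the upper
  bounds. For the lower bound let \<open>\<eta>\<close> be the occupation field of the particles, with mean \<open>\<rho>\<close>: by translation invariance
  \<open>P \<Phi> = (\<Sum>z. v z * E (\<eta> 0 * \<eta> z))\<close>, and \<open>E (\<eta> 0 * \<eta> z) + E (\<eta> 0 * \<eta> 0) \<ge> 2 * \<rho>\<^sup>2\<close>.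
\<close>

subsection \<open>Relative entropy and the Donsker--Varadhan formula\<close>

text \<open>Duality replaces conditional laws: the structural properties of entropy are checked on
  one bounded test function at a time and survive the supremum, infinite values included. The
  exception is the identity with \<open>H(m | q)\<close>, where a density is indispensable. Over
  infinitely many mark sizes two Poisson laws can be mutually singular, and a rate
  \<open>m k = 0\<close> allows a density in one direction only. On finitely many coordinates the
  logarithm of the density is affine in the counts, so its mean depends on P through the intensities
  alone; both remaining terms grow with the coordinate set and can be taken to the supremum
  separately. The same identity bounds \<phi> from below: the intensities of the single laws
  \<open>P a\<close> are uncontrolled, but their \<psi>-average has intensity m, so by convexity the
  mean entropy is at least \<open>H(m | q)\<close>. Convexity makes \<chi> upper semicontinuous
  along each axis at the boundary but does not exclude that its boundary values lie too high. In
  \<open>\<rho>\<^sub>m\<^sub>a\<close> monotonicity excludes this; in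
  \<open>\<rho>\<^sub>m\<^sub>i\<close> it is excluded by an estimate of the entropy lost when all
  mass is removed, uniform over profiles of a given mass.\<close>

definition bounded_meas :: "'a measure \<Rightarrow> ('a \<Rightarrow> real) set" where
  "bounded_meas M = {f. f \<in> borel_measurable M \<and> (\<exists>B. \<forall>x\<in>space M. \<bar>f x\<bar> \<le> B)}"

lemma bounded_meas_measurable: "f \<in> bounded_meas M \<Longrightarrow> f \<in> borel_measurable M"
  by (simp add: bounded_meas_def)

lemma bounded_meas_cong: "sets M = sets N \<Longrightarrow> bounded_meas M = bounded_meas N"
  unfolding bounded_meas_def using sets_eq_imp_space_eq[of M N] by (auto cong: measurable_cong_sets)

lemma bounded_measE:
  assumes "f \<in> bounded_meas M"
  obtains B where "B > 0" "\<And>x. x \<in> space M \<Longrightarrow> \<bar>f x\<bar> \<le> B"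
proof -
  from assms obtain B where "\<forall>x\<in>space M. \<bar>f x\<bar> \<le> B" by (auto simp: bounded_meas_def)
  then show ?thesis by (intro that[of "max B 1"]) (auto simp: le_max_iff_disj)
qed

lemma (in finite_measure) integrable_bounded_meas:
  assumes "f \<in> bounded_meas M"
  shows "integrable M f"
proof -
  obtain B where B: "\<And>x. x \<in> space M \<Longrightarrow> \<bar>f x\<bar> \<le> B" using bounded_measE[OF assms] by blast
  show ?thesis
    using B by (intro integrable_const_bound[of _ B]) (auto intro!: AE_I2 bounded_meas_measurable assms)
qed

lemma bounded_meas_exp: "f \<in> bounded_meas M \<Longrightarrow> (\<lambda>x. exp (f x)) \<in> bounded_meas M"
proof -
  assume f: "f \<in> bounded_meas M"
  obtain B where B: "\<And>x. x \<in> space M \<Longrightarrow> \<bar>f x\<bar> \<le> B" using bounded_measE[OF f] by blast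
  have "\<forall>x\<in>space M. \<bar>exp (f x)\<bar> \<le> exp B" using B by (auto simp: abs_le_iff)
  then show ?thesis using f unfolding bounded_meas_def by (auto intro!: exI[of _ "exp B"])
qed

lemma bounded_meas_add:
  assumes f: "f \<in> bounded_meas M" and g: "g \<in> bounded_meas M"
  shows "(\<lambda>x. f x + g x) \<in> bounded_meas M"
proof -
  obtain B where B: "\<And>x. x \<in> space M \<Longrightarrow> \<bar>f x\<bar> \<le> B" using bounded_measE[OF f] by blast
  obtain C where C: "\<And>x. x \<in> space M \<Longrightarrow> \<bar>g x\<bar> \<le> C" using bounded_measE[OF g] by blast
  have "\<forall>x\<in>space M. \<bar>f x + g x\<bar> \<le> B + C" using B C by (meson abs_triangle_ineq add_mono order_trans)
  then show ?thesis using f g unfolding bounded_meas_def by (auto intro!: exI[of _ "B + C"])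
qed

lemma bounded_meas_cmult:
  assumes f: "f \<in> bounded_meas M"
  shows "(\<lambda>x. c * f x) \<in> bounded_meas M"
proof -
  obtain B where B: "\<And>x. x \<in> space M \<Longrightarrow> \<bar>f x\<bar> \<le> B" using bounded_measE[OF f] by blast
  have "\<forall>x\<in>space M. \<bar>c * f x\<bar> \<le> \<bar>c\<bar> * B" using B by (auto simp: abs_mult mult_left_mono)
  then show ?thesis using f unfolding bounded_meas_def by (auto intro!: exI[of _ "\<bar>c\<bar> * B"])
qed

lemma bounded_meas_const: "(\<lambda>x. c) \<in> bounded_meas M"
  unfolding bounded_meas_def by auto

lemma bounded_meas_indicator: "A \<in> sets M \<Longrightarrow> indicator A \<in> bounded_meas M"
  unfolding bounded_meas_def by (auto intro!: exI[of _ 1] split: split_indicator)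

lemma bounded_meas_compose:
  assumes "f \<in> bounded_meas N" "T \<in> measurable M N"
  shows "(\<lambda>x. f (T x)) \<in> bounded_meas M"
  using assms unfolding bounded_meas_def by (auto dest: measurable_space)

definition dv :: "'a measure \<Rightarrow> 'a measure \<Rightarrow> ('a \<Rightarrow> real) \<Rightarrow> real" where
  "dv P R f = (\<integral>x. f x \<partial>P) - ln (\<integral>x. exp (f x) \<partial>R)"

lemma (in prob_space) integral_exp_pos:
  assumes "f \<in> bounded_meas M"
  shows "0 < (\<integral>x. exp (f x) \<partial>M)"
proof -
  obtain B where B: "\<And>x. x \<in> space M \<Longrightarrow> \<bar>f x\<bar> \<le> B" using bounded_measE[OF assms] by blast
  have "exp (- B) = (\<integral>x. exp (- B) \<partial>M)" by (simp add: prob_space)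
  also have "\<dots> \<le> (\<integral>x. exp (f x) \<partial>M)"
    using B by (intro integral_mono integrable_bounded_meas bounded_meas_exp assms bounded_meas_const)
       (auto simp: abs_le_iff, smt)
  finally show ?thesis by (meson exp_gt_zero less_le_trans)
qed

lemma dv_distr:
  assumes "T \<in> measurable P N" "T \<in> measurable R N" "f \<in> bounded_meas N"
  shows "dv (distr P N T) (distr R N T) f = dv P R (\<lambda>x. f (T x))"
  using assms bounded_meas_measurable[OF assms(3)] unfolding dv_def by (simp add: integral_distr)

text \<open>Collects what makes the real-valued version of \<open>RN_deriv\<close> a usable density:
  it represents P, and it is strictly positive P-almost everywhere, so that its logarithm is
  meaningful under P.\<close>

lemma rel_entropy_facts:
  assumes P: "prob_space P" and R: "prob_space R" and S: "sets P = sets R"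
    and ac: "absolutely_continuous R P"
  shows "density R (RN_deriv R P) = P" 
    and "AE x in P. 0 < enn2real (RN_deriv R P x)"
    and "AE x in R. RN_deriv R P x < top"
    and "P = density R (\<lambda>x. ennreal (enn2real (RN_deriv R P x)))"
proof -
  interpret P: prob_space P by fact
  interpret R: prob_space R by fact
  show 1: "density R (RN_deriv R P) = P"
    by (rule R.density_RN_deriv[OF ac S])
  show 2: "AE x in R. RN_deriv R P x < top"
    using R.RN_deriv_finite[OF P.sigma_finite_measure_axioms ac S] by (auto simp: top.not_eq_extremum)
  have "P = density R (RN_deriv R P)" using 1 by simp
  also have "\<dots> = density R (\<lambda>x. ennreal (enn2real (RN_deriv R P x)))"
    using 2 by (intro density_cong) (auto elim!: eventually_mono)
  finally show 3: "P = density R (\<lambda>x. ennreal (enn2real (RN_deriv R P x)))" .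
  define D where "D x = enn2real (RN_deriv R P x)" for x
  have "AE x in density R (\<lambda>x. ennreal (D x)). 0 < D x"
    by (subst AE_density) (auto simp: D_def)
  then have "AE x in P. 0 < D x" by (subst 3[folded D_def])
  then show "AE x in P. 0 < enn2real (RN_deriv R P x)" by (simp add: D_def)
qed

text \<open>Gibbs' inequality: with D the density of P and c the log-integral of
  \<open>exp f\<close>, integrate \<open>ln g <= g - 1\<close> under P for
  \<open>g = exp (f - c) / D\<close>.\<close>

lemma ln_integral_le_KL:
  assumes P: "prob_space P" and R: "prob_space R" and S: "sets P = sets R"
    and ac: "absolutely_continuous R P" and int: "integrable P (entropy_density (exp 1) R P)"
    and f: "f \<in> bounded_meas R"
  shows "dv P R f \<le> KL_divergence (exp 1) R P"
proof -
  interpret P: prob_space P by fact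
  interpret R: prob_space R by fact
  define D where "D x = enn2real (RN_deriv R P x)" for x
  have D[measurable]: "D \<in> borel_measurable R" by (simp add: D_def[abs_def])
  have D0: "\<And>x. 0 \<le> D x" by (simp add: D_def)
  note facts = rel_entropy_facts[OF P R S ac, folded D_def]
  have fP: "f \<in> bounded_meas P" using f bounded_meas_cong[OF S] by simp
  note [measurable] = bounded_meas_measurable[OF f]
  define c where "c = ln (\<integral>x. exp (f x) \<partial>R)"
  have ec: "exp c = (\<integral>x. exp (f x) \<partial>R)" using R.integral_exp_pos[OF f] by (simp add: c_def)
  have ed: "entropy_density (exp 1) R P = (\<lambda>x. ln (D x))"
    by (auto simp: entropy_density_def D_def log_def)
  have iR: "integrable R (\<lambda>x. exp (f x - c))"
    using R.integrable_bounded_meas[OF bounded_meas_exp[OF f]] by (simp add: exp_diff)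
  have intR: "(\<integral>x. exp (f x - c) \<partial>R) = 1" using R.integral_exp_pos[OF f] by (simp add: exp_diff ec)
  \<comment> \<open>Since division by zero yields 0, \<open>D x * g x\<close> is
    \<open>exp (f x - c)\<close> where D is positive and 0 elsewhere. Hence the P-integral of g is
    at most 1; it can be smaller when P does not charge all of R.\<close>
  define g where "g x = exp (f x - c) / D x" for x
  have [measurable]: "g \<in> borel_measurable R" by (simp add: g_def[abs_def])
  have [measurable]: "g \<in> borel_measurable P" using S by (simp cong: measurable_cong_sets)
  have Dg: "\<And>x. \<bar>D x * g x\<bar> \<le> exp (f x - c)"
    by (auto simp: g_def D0)
  have iDg: "integrable R (\<lambda>x. D x * g x)"
    by (rule Bochner_Integration.integrable_bound[OF iR]) (use Dg in auto)
  have ig: "integrable P g" 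
    by (subst facts(4)) (use iDg in \<open>simp add: integrable_density D0\<close>)
  have "(\<integral>x. g x \<partial>P) = (\<integral>x. D x * g x \<partial>R)"
    by (subst facts(4)) (simp add: integral_density D0)
  also have "\<dots> \<le> 1"
    using Dg by (subst intR[symmetric], intro integral_mono iDg iR) (auto simp: abs_le_iff)
  finally have g1: "(\<integral>x. g x \<partial>P) \<le> 1" .
  have i1: "integrable P f" by (rule P.integrable_bounded_meas[OF fP])
  have i2: "integrable P (\<lambda>x. ln (D x))" using int ed by simp
  have "(\<integral>x. f x - c - ln (D x) \<partial>P) \<le> (\<integral>x. g x - 1 \<partial>P)"
  proof (rule integral_mono_AE)
    show "AE x in P. f x - c - ln (D x) \<le> g x - 1"
      using facts(2)
    proof eventually_elim
      case (elim x)
      then have "g x > 0" by (simp add: g_def)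
      then have "ln (g x) \<le> g x - 1" using ln_le_minus_one by blast
      moreover have "ln (g x) = f x - c - ln (D x)" using elim by (simp add: g_def ln_div)
      ultimately show ?case by simp
    qed
  qed (use i1 i2 ig in auto)
  also have "\<dots> \<le> 0" using g1 ig by (simp add: P.prob_space)
  finally have "(\<integral>x. f x \<partial>P) - c - (\<integral>x. ln (D x) \<partial>P) \<le> 0"
    using i1 i2 by (simp add: P.prob_space)
  then show ?thesis unfolding dv_def KL_divergence_def ed c_def by simp
qed

lemma KL_nonneg':
  assumes P: "prob_space P" and R: "prob_space R" and S: "sets P = sets R"
    and ac: "absolutely_continuous R P" and int: "integrable P (entropy_density (exp 1) R P)"
  shows "0 \<le> KL_divergence (exp 1) R P"
  using ln_integral_le_KL[OF assms bounded_meas_const[of 0]] prob_space.prob_space[OF R]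
  by (simp add: dv_def)

lemma dv_le_rel_entropy:
  assumes "prob_space P" "prob_space R" "sets P = sets R" "f \<in> bounded_meas R"
  shows "ennreal (dv P R f) \<le> rel_entropy P R"
  using ln_integral_le_KL[OF assms(1-3) _ _ assms(4)] by (auto simp: rel_entropy_def intro!: ennreal_leI)

text \<open>The converse half of the duality. A uniform bound on \<open>dv\<close> has to produce
  absolute continuity and integrability of the log-density before the value can be bounded: large
  multiples of indicators of R-null sets give the former, truncations of the log-density the
  latter.\<close>

lemma rel_entropy_le:
  assumes P: "prob_space P" and R: "prob_space R" and S: "sets P = sets R"
    and le: "\<And>f. f \<in> bounded_meas R \<Longrightarrow> dv P R f \<le> c"
  shows "rel_entropy P R \<le> ennreal c"
proof -
  interpret P: prob_space P by fact
  interpret R: prob_space R by fact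
  have ac: "absolutely_continuous R P"
    unfolding absolutely_continuous_def
  proof
    fix A assume A: "A \<in> null_sets R"
    then have As: "A \<in> sets R" by auto
    \<comment> \<open>On the R-null set A the exponential costs nothing, so \<open>dv\<close> equals
      \<open>t * measure P A\<close> for every t. A set of positive P-mass would make this
      unbounded; \<open>t = (|c| + 1) / measure P A\<close> is then already too large.\<close>
    have "t * measure P A \<le> c" for t :: real
    proof -
      have "AE x in R. exp (t * indicator A x) = 1"
        using AE_not_in[OF A] by eventually_elim auto
      then have "(\<integral>x. exp (t * indicator A x) \<partial>R) = (\<integral>x. 1 \<partial>R)"
        using As by (intro integral_cong_AE) auto
      then have "dv P R (\<lambda>x. t * indicator A x) = t * measure P A"
        unfolding dv_def using As S sets_eq_imp_space_eq[OF S] sets.sets_into_space[OF As]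
        by (simp add: R.prob_space Int_absorb2)
      moreover have "dv P R (\<lambda>x. t * indicator A x) \<le> c"
        by (intro le bounded_meas_cmult bounded_meas_indicator As)
      ultimately show ?thesis by simp
    qed
    from this[of "(\<bar>c\<bar> + 1) / measure P A"] have "measure P A = 0"
      by (cases "measure P A = 0") auto
    then show "A \<in> null_sets P" using As S by (auto simp: P.emeasure_eq_measure)
  qed
  define D where "D x = enn2real (RN_deriv R P x)" for x
  have D[measurable]: "D \<in> borel_measurable R" by (simp add: D_def[abs_def])
  have DP[measurable]: "D \<in> borel_measurable P" using S by (simp cong: measurable_cong_sets)
  have D0: "\<And>x. 0 \<le> D x" by (simp add: D_def)
  note facts = rel_entropy_facts[OF P R S ac, folded D_def]
  have ed: "entropy_density (exp 1) R P = (\<lambda>x. ln (D x))"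
    by (auto simp: entropy_density_def D_def log_def)
  have intD: "integrable R D" "(\<integral>x. D x \<partial>R) = 1"
  proof -
    have "emeasure P (space R) = emeasure (density R (\<lambda>x. ennreal (D x))) (space R)"
      using facts(4) by simp
    then have "(\<integral>\<^sup>+x. ennreal (D x) \<partial>R) = emeasure P (space P)"
      by (subst (asm) emeasure_density) (auto simp: sets_eq_imp_space_eq[OF S] cong: nn_integral_cong)
    also have "\<dots> = ennreal 1" by (simp add: P.emeasure_space_1)
    finally show "integrable R D" "(\<integral>x. D x \<partial>R) = 1"
      using D0 by (auto intro!: integrableI_nn_integral_finite[of _ _ 1] simp: integral_eq_nn_integral)
  qed
  \<comment> \<open>The log-density truncated to \<open>[-n, n]\<close>. Points with D = 0 get the
    value \<open>-n\<close> explicitly because \<open>ln 0 = 0\<close> would count them as density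
    1. The truncation gives \<open>exp (f n) <= D + exp (-n)\<close>, so the logarithmic term of
    \<open>dv\<close> is at most \<open>exp (-n)\<close>.\<close>
  define f where "f n x = (if D x = 0 then - real n else max (- real n) (min (real n) (ln (D x))))" for n x
  have fmeas[measurable]: "f n \<in> borel_measurable R" for n unfolding f_def[abs_def] by measurable
  have fmeasP[measurable]: "f n \<in> borel_measurable P" for n using S by (simp cong: measurable_cong_sets)
  have fb: "f n \<in> bounded_meas R" for n
    unfolding bounded_meas_def by (auto intro!: exI[of _ "real n"] simp: f_def)
  then have fbP: "f n \<in> bounded_meas P" for n using bounded_meas_cong[OF S] by simp
  have ef: "exp (f n x) \<le> D x + exp (- real n)" for n x
  proof (cases "D x = 0")
    case False
    then have "D x > 0" using D0[of x] by simp
    then have "D x = exp (ln (D x))" by simp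
    then have "exp (f n x) \<le> max (exp (- real n)) (D x)"
      using False unfolding f_def by (smt (verit) exp_le_cancel_iff)
    then show ?thesis using D0[of x] by (smt (verit) exp_gt_zero)
  qed (simp add: f_def)
  have le1: "(\<integral>x. f n x \<partial>P) \<le> c + exp (- real n)" for n
  proof -
    have "(\<integral>x. exp (f n x) \<partial>R) \<le> (\<integral>x. D x + exp (- real n) \<partial>R)"
      using intD ef R.integrable_bounded_meas[OF bounded_meas_exp[OF fb]] by (intro integral_mono) auto
    also have "\<dots> = 1 + exp (- real n)" using intD by (simp add: R.prob_space)
    finally have "ln (\<integral>x. exp (f n x) \<partial>R) \<le> exp (- real n)"
      using R.integral_exp_pos[OF fb[of n]] ln_le_minus_one[of "\<integral>x. exp (f n x) \<partial>R"] by linarith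
    then show ?thesis using le[OF fb[of n]] unfolding dv_def by linarith
  qed
  define L where "L x = ln (D x)" for x
  have [measurable]: "L \<in> borel_measurable R" "L \<in> borel_measurable P" by (auto simp: L_def[abs_def])
  \<comment> \<open>The elementary bound \<open>x ln x >= -1\<close>: the negative part of the
    log-density is always P-integrable, with integral at least -1.\<close>
  have xlnx: "- 1 \<le> D x * min 0 (L x)" for x
  proof (cases "D x = 0")
    case False
    then have "D x > 0" using D0[of x] by simp
    then have "ln (1 / D x) \<le> 1 / D x - 1" by (intro ln_le_minus_one) simp
    then have "- L x \<le> 1 / D x - 1" using \<open>D x > 0\<close> by (simp add: L_def ln_div)
    then have "D x * (- L x) \<le> D x * (1 / D x)" using \<open>D x > 0\<close> by (intro mult_left_mono) auto
    then show ?thesis using \<open>D x > 0\<close> D0[of x] by (auto simp: min_def)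
  qed simp
  have neg: "integrable P (\<lambda>x. min 0 (L x))"
    by (subst facts(4), subst integrable_density)
       (use xlnx D0 in \<open>auto simp: mult_nonneg_nonpos intro!: R.integrable_const_bound[of _ 1]\<close>)
  have neg1: "- 1 \<le> (\<integral>x. min 0 (L x) \<partial>P)"
  proof -
    have "(\<integral>x. min 0 (L x) \<partial>P) = (\<integral>x. D x * min 0 (L x) \<partial>R)"
      by (subst facts(4), subst integral_density) (use D0 in auto)
    moreover have "(\<integral>x. - 1 \<partial>R) \<le> (\<integral>x. D x * min 0 (L x) \<partial>R)"
      using xlnx D0 by (intro integral_mono) (auto simp: mult_nonneg_nonpos intro!: R.integrable_const_bound[of _ 1])
    ultimately show ?thesis by (simp add: R.prob_space)
  qed
  have fL: "AE x in P. f n x = max (- real n) (min (real n) (L x))" for n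
    using facts(2) by eventually_elim (auto simp: f_def L_def)
  \<comment> \<open>In \<open>c + 2\<close>, one unit bounds the error \<open>exp (-n)\<close> and
    the other the integral of the negative part.\<close>
  have pos_n: "(\<integral>\<^sup>+x. ennreal (min (real n) (L x)) \<partial>P) \<le> ennreal (c + 2)" for n
  proof -
    have i: "integrable P (\<lambda>x. max 0 (min (real n) (L x)))"
      by (intro P.integrable_const_bound[of _ "real n"]) auto
    have "(\<integral>x. max 0 (min (real n) (L x)) + min 0 (L x) \<partial>P) \<le> (\<integral>x. f n x \<partial>P)"
    proof (rule integral_mono_AE)
      show "AE x in P. max 0 (min (real n) (L x)) + min 0 (L x) \<le> f n x"
        using fL[of n] by eventually_elim auto
    qed (use i neg P.integrable_bounded_meas[OF fbP] in auto)
    also have "\<dots> \<le> c + 1" using le1[of n] by (smt (verit) exp_le_one_iff of_nat_0_le_iff)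
    finally have "(\<integral>x. max 0 (min (real n) (L x)) \<partial>P) \<le> c + 2"
      using i neg neg1 by simp
    then have "ennreal (\<integral>x. max 0 (min (real n) (L x)) \<partial>P) \<le> ennreal (c + 2)" by (rule ennreal_leI)
    also have "ennreal (\<integral>x. max 0 (min (real n) (L x)) \<partial>P) = (\<integral>\<^sup>+x. ennreal (max 0 (min (real n) (L x))) \<partial>P)"
      by (rule nn_integral_eq_integral[symmetric]) (use i in auto)
    finally show ?thesis by (simp add: max_def ennreal_neg if_distrib cong: if_cong)
       (smt (verit, best) ennreal_neg nn_integral_cong)
  qed
  have "(\<integral>\<^sup>+x. ennreal (L x) \<partial>P) = (\<integral>\<^sup>+x. (SUP n. ennreal (min (real n) (L x))) \<partial>P)"
  proof (rule nn_integral_cong)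
    fix x
    obtain n where "L x \<le> real n" using real_arch_simple by blast
    then have "ennreal (L x) \<le> ennreal (min (real n) (L x))" by (simp add: min_def)
    then have "ennreal (L x) \<le> (SUP n. ennreal (min (real n) (L x)))" by (rule SUP_upper2[rotated]) simp
    moreover have "(SUP n. ennreal (min (real n) (L x))) \<le> ennreal (L x)"
      by (intro SUP_least ennreal_leI) simp
    ultimately show "ennreal (L x) = (SUP n. ennreal (min (real n) (L x)))" by simp
  qed
  also have "\<dots> = (SUP n. \<integral>\<^sup>+x. ennreal (min (real n) (L x)) \<partial>P)"
    by (rule nn_integral_monotone_convergence_SUP)
       (auto simp: incseq_def le_fun_def intro!: ennreal_leI)
  also have "\<dots> \<le> ennreal (c + 2)" by (intro SUP_least pos_n)
  finally have "(\<integral>\<^sup>+x. ennreal (L x) \<partial>P) < \<infinity>" by (simp add: le_less_trans)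
  moreover have "(\<integral>\<^sup>+x. ennreal (- L x) \<partial>P) < \<infinity>"
  proof -
    have "(\<integral>\<^sup>+x. ennreal (- L x) \<partial>P) \<le> (\<integral>\<^sup>+x. ennreal (- min 0 (L x)) \<partial>P)"
      by (intro nn_integral_mono ennreal_leI) simp
    also have "\<dots> = ennreal (\<integral>x. - min 0 (L x) \<partial>P)"
      by (rule nn_integral_eq_integral) (use neg in auto)
    finally show ?thesis by (simp add: le_less_trans)
  qed
  ultimately have iL: "integrable P L" unfolding real_integrable_def by auto
  have "(\<lambda>n. \<integral>x. f n x \<partial>P) \<longlonglongrightarrow> (\<integral>x. L x \<partial>P)"
  proof (rule integral_dominated_convergence[where w="\<lambda>x. \<bar>L x\<bar>"])
    show "AE x in P. (\<lambda>n. f n x) \<longlonglongrightarrow> L x"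
    proof -
      have "AE x in P. \<forall>n. f n x = max (- real n) (min (real n) (L x))"
        using fL by (simp add: AE_all_countable)
      then show ?thesis
      proof eventually_elim
        case (elim x)
        obtain N where N: "\<bar>L x\<bar> \<le> real N" using real_arch_simple by blast
        have "eventually (\<lambda>n. f n x = L x) sequentially"
          using eventually_ge_at_top[of N]
        proof eventually_elim
          case (elim n)
          then have "real N \<le> real n" by simp
          then show ?case using N \<open>\<forall>n. f n x = _ n\<close> by auto
        qed
        then show ?case by (rule tendsto_eventually)
      qed
    qed
    show "AE x in P. norm (f n x) \<le> \<bar>L x\<bar>" for n using fL[of n] by eventually_elim auto
  qed (use iL in auto)
  then have "(\<integral>x. L x \<partial>P) \<le> c + 0"
  proof (rule LIMSEQ_le)
    show "(\<lambda>n. c + exp (- real n)) \<longlonglongrightarrow> c + 0" by real_asymp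
  qed (use le1 in auto)
  then have "KL_divergence (exp 1) R P \<le> c" unfolding KL_divergence_def ed L_def by simp
  moreover have "integrable P (entropy_density (exp 1) R P)" using iL unfolding ed L_def .
  ultimately show ?thesis using ac by (auto simp: rel_entropy_def intro!: ennreal_leI)
qed

text \<open>Truncating negative values of \<open>dv\<close> by \<open>ennreal\<close> does no harm,
  since the supremum is in any case at least the value 0 of the zero function.\<close>

lemma rel_entropy_eq_SUP:
  assumes "prob_space P" "prob_space R" "sets P = sets R"
  shows "rel_entropy P R = (SUP f\<in>bounded_meas R. ennreal (dv P R f))" (is "_ = ?S")
proof (rule antisym)
  show "?S \<le> rel_entropy P R" by (intro SUP_least dv_le_rel_entropy assms)
  show "rel_entropy P R \<le> ?S"
  proof (cases "?S = \<infinity>")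
    case False
    have "dv P R f \<le> enn2real ?S" if "f \<in> bounded_meas R" for f
    proof -
      have "ennreal (dv P R f) \<le> ?S" using that by (rule SUP_upper)
      then have "enn2real (ennreal (dv P R f)) \<le> enn2real ?S" using False by (intro enn2real_mono) (simp_all only: top.not_eq_extremum infinity_ennreal_def not_False_eq_True)
      then show ?thesis by (smt (verit) enn2real_ennreal enn2real_nonneg)
    qed
    then have "rel_entropy P R \<le> ennreal (enn2real ?S)" by (intro rel_entropy_le assms)
    then show ?thesis using False by (simp only: ennreal_enn2real_if infinity_ennreal_def if_False)
  qed (simp only: infinity_ennreal_def top_greatest)
qed

lemma rel_entropy_distr_le:
  assumes P: "prob_space P" and R: "prob_space R" and S: "sets P = sets R" and T: "T \<in> measurable R N"
  shows "rel_entropy (distr P N T) (distr R N T) \<le> rel_entropy P R"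
proof -
  have TP: "T \<in> measurable P N" using T S by (simp cong: measurable_cong_sets)
  have "rel_entropy (distr P N T) (distr R N T) = (SUP f\<in>bounded_meas N. ennreal (dv (distr P N T) (distr R N T) f))"
    using prob_space.prob_space_distr[OF P TP] prob_space.prob_space_distr[OF R T]
    by (subst rel_entropy_eq_SUP) (auto intro!: arg_cong[where f=Sup] simp: bounded_meas_cong[of "distr R N T" N])
  also have "\<dots> \<le> rel_entropy P R"
    by (intro SUP_least) (simp add: dv_distr[OF TP T] dv_le_rel_entropy[OF P R S] bounded_meas_compose[OF _ T])
  finally show ?thesis .
qed

text \<open>By duality this is Jensen's inequality for the exponential, in the form
  \<open>exp (f - c) >= 1 + f - c\<close> with c the mean of f.\<close>

lemma rel_entropy_self: "prob_space P \<Longrightarrow> rel_entropy P P = 0"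
proof -
  assume P: "prob_space P"
  interpret prob_space P by fact
  have "dv P P f \<le> 0" if f: "f \<in> bounded_meas P" for f
  proof -
    let ?c = "\<integral>x. f x \<partial>P"
    have "(\<integral>x. f x - ?c + 1 \<partial>P) \<le> (\<integral>x. exp (f x - ?c) \<partial>P)"
      using integrable_bounded_meas[OF f] integrable_bounded_meas[OF bounded_meas_exp[OF f]]
      by (intro integral_mono) (auto simp: exp_diff, metis add.commute exp_diff exp_ge_add_one_self)
    then have "1 \<le> (\<integral>x. exp (f x) \<partial>P) / exp ?c"
      using integrable_bounded_meas[OF f] by (simp add: prob_space exp_diff)
    then have "exp ?c \<le> (\<integral>x. exp (f x) \<partial>P)" by (simp add: field_simps)
    then have "?c \<le> ln (\<integral>x. exp (f x) \<partial>P)" using integral_exp_pos[OF f] by (simp add: ln_ge_iff)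
    then show ?thesis by (simp add: dv_def)
  qed
  then have "rel_entropy P P \<le> ennreal 0" using P by (intro rel_entropy_le) auto
  then show ?thesis by simp
qed

lemma ennreal_SUP_add_le:
  fixes f :: "'a \<Rightarrow> ennreal" and g :: "'b \<Rightarrow> ennreal"
  assumes "A \<noteq> {}" "B \<noteq> {}" "\<And>a b. a \<in> A \<Longrightarrow> b \<in> B \<Longrightarrow> f a + g b \<le> c"
  shows "(SUP a\<in>A. f a) + (SUP b\<in>B. g b) \<le> c"
proof -
  have "(SUP a\<in>A. f a) + (SUP b\<in>B. g b) = (SUP b\<in>B. (SUP a\<in>A. f a) + g b)"
    using assms(2) by (rule ennreal_SUP_add_right)
  also have "\<dots> = (SUP b\<in>B. SUP a\<in>A. f a + g b)"
    using assms(1) by (simp add: ennreal_SUP_add_left)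
  also have "\<dots> \<le> c" by (intro SUP_least assms(3))
  finally show ?thesis .
qed

text \<open>Test functions of the form \<open>f (X x) + g (Y x)\<close> suffice: independence under
  R splits the logarithm of the exponential integral, while the P-integral is additive whatever the
  dependence of X and Y under P.\<close>

lemma rel_entropy_indep_add_le:
  assumes P: "prob_space P" and R: "prob_space R" and S: "sets P = sets R"
    and ind: "prob_space.indep_var R N1 X N2 Y"
  shows "rel_entropy (distr P N1 X) (distr R N1 X) + rel_entropy (distr P N2 Y) (distr R N2 Y) \<le> rel_entropy P R"
proof -
  interpret P: prob_space P by fact
  interpret R: prob_space R by fact
  have X: "X \<in> measurable R N1" and Y: "Y \<in> measurable R N2"
    using R.indep_var_rv1[OF ind] R.indep_var_rv2[OF ind] by auto
  have XP: "X \<in> measurable P N1" and YP: "Y \<in> measurable P N2"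
    using X Y S by (simp_all cong: measurable_cong_sets)
  have add: "dv (distr P N1 X) (distr R N1 X) f + dv (distr P N2 Y) (distr R N2 Y) g = dv P R (\<lambda>x. f (X x) + g (Y x))"
    if f: "f \<in> bounded_meas N1" and g: "g \<in> bounded_meas N2" for f g
  proof -
    have fX: "(\<lambda>x. f (X x)) \<in> bounded_meas R" "(\<lambda>x. f (X x)) \<in> bounded_meas P"
      using bounded_meas_compose[OF f] X XP by auto
    have gY: "(\<lambda>x. g (Y x)) \<in> bounded_meas R" "(\<lambda>x. g (Y x)) \<in> bounded_meas P"
      using bounded_meas_compose[OF g] Y YP by auto
    have "R.indep_var borel ((\<lambda>x. exp (f x)) \<circ> X) borel ((\<lambda>x. exp (g x)) \<circ> Y)"
      by (rule R.indep_var_compose[OF ind])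
         (auto intro!: bounded_meas_measurable bounded_meas_exp f g)
    then have "(\<integral>x. exp (f (X x)) * exp (g (Y x)) \<partial>R) = (\<integral>x. exp (f (X x)) \<partial>R) * (\<integral>x. exp (g (Y x)) \<partial>R)"
      using R.integrable_bounded_meas[OF bounded_meas_exp[OF fX(1)]]
        R.integrable_bounded_meas[OF bounded_meas_exp[OF gY(1)]]
      by (subst R.indep_var_lebesgue_integral[symmetric]) (auto simp: comp_def)
    then have "ln (\<integral>x. exp (f (X x) + g (Y x)) \<partial>R) = ln (\<integral>x. exp (f (X x)) \<partial>R) + ln (\<integral>x. exp (g (Y x)) \<partial>R)"
      using R.integral_exp_pos[OF fX(1)] R.integral_exp_pos[OF gY(1)] by (simp add: exp_add ln_mult)
    then show ?thesis
      using P.integrable_bounded_meas[OF fX(2)] P.integrable_bounded_meas[OF gY(2)]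
      by (simp add: dv_distr[OF XP X f] dv_distr[OF YP Y g]) (simp add: dv_def)
  qed
  have zero: "dv (distr P N1 X) (distr R N1 X) (\<lambda>_. 0) = 0" "dv (distr P N2 Y) (distr R N2 Y) (\<lambda>_. 0) = 0"
    by (simp_all add: dv_distr[OF XP X bounded_meas_const] dv_distr[OF YP Y bounded_meas_const])
       (simp_all add: dv_def R.prob_space)
  have "ennreal (dv (distr P N1 X) (distr R N1 X) f) + ennreal (dv (distr P N2 Y) (distr R N2 Y) g) \<le> rel_entropy P R"
    if f: "f \<in> bounded_meas N1" and g: "g \<in> bounded_meas N2" for f g
  proof -
    \<comment> \<open>\<open>ennreal\<close> is additive only on nonnegative reals, so a test
      function with negative \<open>dv\<close> is replaced by 0, which leaves its
      \<open>ennreal\<close> value unchanged.\<close>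
    define f' where "f' = (if dv (distr P N1 X) (distr R N1 X) f < 0 then (\<lambda>_. 0) else f)"
    define g' where "g' = (if dv (distr P N2 Y) (distr R N2 Y) g < 0 then (\<lambda>_. 0) else g)"
    have f': "f' \<in> bounded_meas N1" "ennreal (dv (distr P N1 X) (distr R N1 X) f') = ennreal (dv (distr P N1 X) (distr R N1 X) f)"
       "dv (distr P N1 X) (distr R N1 X) f' \<ge> 0"
      using f by (auto simp: f'_def bounded_meas_const zero ennreal_neg)
    have g': "g' \<in> bounded_meas N2" "ennreal (dv (distr P N2 Y) (distr R N2 Y) g') = ennreal (dv (distr P N2 Y) (distr R N2 Y) g)"
       "dv (distr P N2 Y) (distr R N2 Y) g' \<ge> 0"
      using g by (auto simp: g'_def bounded_meas_const zero ennreal_neg)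
    have "ennreal (dv (distr P N1 X) (distr R N1 X) f') + ennreal (dv (distr P N2 Y) (distr R N2 Y) g')
       = ennreal (dv P R (\<lambda>x. f' (X x) + g' (Y x)))"
      using f'(3) g'(3) by (simp add: add[OF f'(1) g'(1), symmetric])
    also have "\<dots> \<le> rel_entropy P R"
      by (intro dv_le_rel_entropy P R S bounded_meas_add bounded_meas_compose[OF f'(1)] bounded_meas_compose[OF g'(1)] X Y)
    finally show ?thesis by (simp add: f' g')
  qed
  moreover have "bounded_meas N1 \<noteq> {}" "bounded_meas N2 \<noteq> {}" using bounded_meas_const by blast+
  moreover have "rel_entropy (distr P N1 X) (distr R N1 X) = (SUP f\<in>bounded_meas N1. ennreal (dv (distr P N1 X) (distr R N1 X) f))"
    using rel_entropy_eq_SUP[OF P.prob_space_distr[OF XP] R.prob_space_distr[OF X]] bounded_meas_cong[of "distr R N1 X" N1] by simp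
  moreover have "rel_entropy (distr P N2 Y) (distr R N2 Y) = (SUP f\<in>bounded_meas N2. ennreal (dv (distr P N2 Y) (distr R N2 Y) f))"
    using rel_entropy_eq_SUP[OF P.prob_space_distr[OF YP] R.prob_space_distr[OF Y]] bounded_meas_cong[of "distr R N2 Y" N2] by simp
  ultimately show ?thesis by (simp add: ennreal_SUP_add_le)
qed

section \<open>Mixtures of laws over a discrete parameter\<close>

lemma pmf_kernel:
  assumes "\<And>c. prob_space (K c)" "\<And>c. sets (K c) = sets R"
  shows "K \<in> measurable (measure_pmf \<mu>) (subprob_algebra R)"
    and "prob_space (measure_pmf \<mu> \<bind> K)"
    and "sets (measure_pmf \<mu> \<bind> K) = sets R"
proof -
  have "K \<in> measurable (measure_pmf \<mu>) (prob_algebra R)"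
    using assms by (auto simp: space_prob_algebra)
  then show 1: "K \<in> measurable (measure_pmf \<mu>) (subprob_algebra R)"
    by (rule measurable_prob_algebraD)
  show "prob_space (measure_pmf \<mu> \<bind> K)"
    using \<open>K \<in> measurable (measure_pmf \<mu>) (prob_algebra R)\<close>
    by (intro measure_pmf.prob_space_bind[OF _ 1]) (auto simp: assms)
  show "sets (measure_pmf \<mu> \<bind> K) = sets R"
    by (rule sets_bind) (auto simp: assms)
qed

text \<open>For fixed f, \<open>dv\<close> is affine in its first argument, because the logarithmic
  term depends on R only; the value at the mixture is thus the average of the values at the
  components. Positive parts are taken before moving to \<open>ennreal\<close>.\<close>

lemma rel_entropy_bind_le:
  fixes \<mu> :: "'c pmf"
  assumes K: "\<And>c. prob_space (K c)" "\<And>c. sets (K c) = sets R" and R: "prob_space R"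
  shows "rel_entropy (measure_pmf \<mu> \<bind> K) R \<le> (\<integral>\<^sup>+c. rel_entropy (K c) R \<partial>measure_pmf \<mu>)"
proof -
  note kernel = pmf_kernel[OF K, where \<mu>=\<mu>]
  have "ennreal (dv (measure_pmf \<mu> \<bind> K) R f) \<le> (\<integral>\<^sup>+c. rel_entropy (K c) R \<partial>measure_pmf \<mu>)"
    if f: "f \<in> bounded_meas R" for f
  proof -
    obtain B where B: "\<And>x. x \<in> space R \<Longrightarrow> \<bar>f x\<bar> \<le> B" using bounded_measE[OF f] by blast
    have fK: "f \<in> bounded_meas (K c)" for c using f bounded_meas_cong[OF K(2)] by simp
    have bd: "\<bar>\<integral>x. f x \<partial>K c\<bar> \<le> B" for c
    proof -
      interpret K: prob_space "K c" by (rule K)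
      have "\<bar>\<integral>x. f x \<partial>K c\<bar> \<le> (\<integral>x. \<bar>f x\<bar> \<partial>K c)" by (rule integral_abs_bound)
      also have "\<dots> \<le> (\<integral>x. B \<partial>K c)"
        using B K.integrable_bounded_meas[OF fK] sets_eq_imp_space_eq[OF K(2)]
        by (intro integral_mono) auto
      finally show ?thesis by (simp add: K.prob_space)
    qed
    define l where "l = ln (\<integral>x. exp (f x) \<partial>R)"
    have bdv: "\<bar>dv (K c) R f\<bar> \<le> B + \<bar>l\<bar>" for c
      using bd[of c] unfolding dv_def l_def[symmetric] by linarith
    have bdv': "norm (max 0 (dv (K c) R f)) \<le> B + \<bar>l\<bar>" for c
      using bdv[of c] by (auto simp: max_def)
    have "(\<integral>x. f x \<partial>(measure_pmf \<mu> \<bind> K)) = (\<integral>c. (\<integral>x. f x \<partial>K c) \<partial>measure_pmf \<mu>)"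
      by (rule integral_bind[where K=R and B=B and B'=1])
         (use kernel B f K in \<open>auto simp: prob_space.emeasure_space_1 measure_pmf.finite_measure_axioms bounded_meas_measurable\<close>)
    then have "dv (measure_pmf \<mu> \<bind> K) R f = (\<integral>c. dv (K c) R f \<partial>measure_pmf \<mu>)"
      using bd unfolding dv_def
      by (subst Bochner_Integration.integral_diff)
         (auto intro!: measure_pmf.integrable_const_bound[of _ B])
    also have "\<dots> \<le> (\<integral>c. max 0 (dv (K c) R f) \<partial>measure_pmf \<mu>)"
      using bdv bdv' by (intro integral_mono measure_pmf.integrable_const_bound[of _ "B + \<bar>l\<bar>"]) auto
    finally have "ennreal (dv (measure_pmf \<mu> \<bind> K) R f) \<le> ennreal (\<integral>c. max 0 (dv (K c) R f) \<partial>measure_pmf \<mu>)"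
      by (rule ennreal_leI)
    also have "\<dots> = (\<integral>\<^sup>+c. ennreal (max 0 (dv (K c) R f)) \<partial>measure_pmf \<mu>)"
      using bdv' by (intro nn_integral_eq_integral[symmetric] measure_pmf.integrable_const_bound[of _ "B + \<bar>l\<bar>"]) auto
    also have "\<dots> \<le> (\<integral>\<^sup>+c. rel_entropy (K c) R \<partial>measure_pmf \<mu>)"
    proof (rule nn_integral_mono)
      fix c
      show "ennreal (max 0 (dv (K c) R f)) \<le> rel_entropy (K c) R"
        using dv_le_rel_entropy[OF K(1) R K(2) f, of c] by (simp add: max_def)
    qed
    finally show ?thesis .
  qed
  then show ?thesis
    by (subst rel_entropy_eq_SUP[OF kernel(2) R kernel(3)]) (rule SUP_least)
qed


subsection \<open>Approximation by cylinder functions\<close>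

lemma abs_exp_diff_le: "\<bar>exp a - exp b\<bar> \<le> exp B * \<bar>a - b\<bar>" if "\<bar>a\<bar> \<le> B" "\<bar>b\<bar> \<le> B" for a b B :: real
proof -
  have *: "exp u - exp w \<le> exp B * (u - w)" if "u \<le> B" "w \<le> u" for u w :: real
  proof -
    have "1 - exp (w - u) \<le> u - w" using exp_ge_add_one_self[of "w - u"] by linarith
    then have "exp u * (1 - exp (w - u)) \<le> exp B * (u - w)"
      using that by (intro mult_mono) auto
    then show ?thesis by (simp add: right_diff_distrib exp_diff)
  qed
  have "a \<le> B" "b \<le> B" using that by auto
  then show ?thesis using *[of a b] *[of b a] by (cases "a \<le> b") (auto simp: abs_if)
qed

text \<open>Two arbitrary laws on the same product sigma-algebra; later these are the marginal of a
  configuration law and a Poisson product.\<close>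

locale product_pair =
  fixes P R :: "('i \<Rightarrow> 'a) measure" and I :: "'i set" and M :: "'i \<Rightarrow> 'a measure"
  assumes prob: "prob_space P" "prob_space R"
    and sets_product: "sets P = sets (PiM I M)" "sets R = sets (PiM I M)"
begin

sublocale P: prob_space P by (rule prob)
sublocale R: prob_space R by (rule prob)

lemma sets_eq: "sets P = sets R"
  by (simp add: sets_product)

lemma space_eq: "space P = space R"
  by (rule sets_eq_imp_space_eq[OF sets_eq])

lemma bounded_meas_eq: "bounded_meas P = bounded_meas R" "bounded_meas (PiM I M) = bounded_meas R"
  by (rule bounded_meas_cong, simp add: sets_product)+

lemma integrable_bounded:
  assumes "f \<in> bounded_meas R"
  shows "integrable P f" "integrable R f"
  using assms P.integrable_bounded_meas R.integrable_bounded_meas bounded_meas_eq by auto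

lemma bounded_meas_abs_diff:
  assumes "f \<in> bounded_meas R" "g \<in> bounded_meas R"
  shows "(\<lambda>x. \<bar>f x - g x\<bar>) \<in> bounded_meas R"
proof -
  have "(\<lambda>x. f x + (-1) * g x) \<in> bounded_meas R" using assms by (intro bounded_meas_add bounded_meas_cmult)
  then show ?thesis by (auto simp: bounded_meas_def)
qed

text \<open>Approximation is required under both laws at once, because \<open>dv P R f\<close>
  integrates f against P and \<open>exp f\<close> against R.\<close>

definition l1 :: "(('i \<Rightarrow> 'a) \<Rightarrow> real) \<Rightarrow> (('i \<Rightarrow> 'a) \<Rightarrow> real) \<Rightarrow> real" where
  "l1 f g = (\<integral>x. \<bar>f x - g x\<bar> \<partial>P) + (\<integral>x. \<bar>f x - g x\<bar> \<partial>R)"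

lemma l1_le:
  assumes "f \<in> bounded_meas R" "g \<in> bounded_meas R" "h \<in> bounded_meas R"
    and "\<And>x. x \<in> space R \<Longrightarrow> \<bar>f x - g x\<bar> \<le> h x"
  shows "l1 f g \<le> (\<integral>x. h x \<partial>P) + (\<integral>x. h x \<partial>R)"
  unfolding l1_def using assms
  by (intro add_mono integral_mono integrable_bounded bounded_meas_abs_diff) (auto simp: space_eq)

lemma l1_add:
  assumes f: "f1 \<in> bounded_meas R" "f2 \<in> bounded_meas R" and g: "g1 \<in> bounded_meas R" "g2 \<in> bounded_meas R"
  shows "l1 (\<lambda>x. f1 x + f2 x) (\<lambda>x. g1 x + g2 x) \<le> l1 f1 g1 + l1 f2 g2"
proof -
  note b = bounded_meas_abs_diff[OF f(1) g(1)] bounded_meas_abs_diff[OF f(2) g(2)]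
  show ?thesis
    using l1_le[OF bounded_meas_add[OF f] bounded_meas_add[OF g] bounded_meas_add[OF b]]
      integrable_bounded[OF b(1)] integrable_bounded[OF b(2)]
    by (simp add: l1_def abs_diff_triangle_ineq)
qed

lemma l1_triangle:
  assumes f: "f \<in> bounded_meas R" and g: "g \<in> bounded_meas R" and h: "h \<in> bounded_meas R"
  shows "l1 f h \<le> l1 f g + l1 g h"
proof -
  note b = bounded_meas_abs_diff[OF f g] bounded_meas_abs_diff[OF g h]
  show ?thesis
    using l1_le[OF f h bounded_meas_add[OF b]] integrable_bounded[OF b(1)] integrable_bounded[OF b(2)]
    by (simp add: l1_def dist_real_def[symmetric] dist_triangle)
qed

lemma l1_cmult: "l1 (\<lambda>x. c * f x) (\<lambda>x. c * g x) = \<bar>c\<bar> * l1 f g"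
proof -
  have "\<bar>c * f x - c * g x\<bar> = \<bar>c\<bar> * \<bar>f x - g x\<bar>" for x by (simp add: abs_mult[symmetric] algebra_simps)
  then show ?thesis by (simp add: l1_def distrib_left)
qed

definition cylinders :: "(('i \<Rightarrow> 'a) \<Rightarrow> real) set" where
  "cylinders = {\<lambda>x. g (restrict x J) | J g. finite J \<and> J \<subseteq> I \<and> g \<in> bounded_meas (PiM J M)}"

lemma cylindersI: "finite J \<Longrightarrow> J \<subseteq> I \<Longrightarrow> g \<in> bounded_meas (PiM J M) \<Longrightarrow> (\<lambda>x. g (restrict x J)) \<in> cylinders"
  by (auto simp: cylinders_def)

lemma cylinders_bounded: "h \<in> cylinders \<Longrightarrow> h \<in> bounded_meas R"
  unfolding cylinders_def bounded_meas_eq(2)[symmetric]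
  by (auto intro!: bounded_meas_compose[OF _ measurable_restrict_subset])

lemma cylinders_const: "(\<lambda>_. c) \<in> cylinders"
  unfolding cylinders_def by (force intro: bounded_meas_const)

lemma cylinders_cmult: "h \<in> cylinders \<Longrightarrow> (\<lambda>x. c * h x) \<in> cylinders"
  unfolding cylinders_def by (force intro: bounded_meas_cmult)

lemma cylinders_add:
  assumes "h1 \<in> cylinders" "h2 \<in> cylinders"
  shows "(\<lambda>x. h1 x + h2 x) \<in> cylinders"
proof -
  obtain J1 g1 where 1: "h1 = (\<lambda>x. g1 (restrict x J1))" "finite J1" "J1 \<subseteq> I" "g1 \<in> bounded_meas (PiM J1 M)"
    using assms(1) unfolding cylinders_def by blast
  obtain J2 g2 where 2: "h2 = (\<lambda>x. g2 (restrict x J2))" "finite J2" "J2 \<subseteq> I" "g2 \<in> bounded_meas (PiM J2 M)"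
    using assms(2) unfolding cylinders_def by blast
  let ?g = "\<lambda>x. g1 (restrict x J1) + g2 (restrict x J2)"
  have g: "?g \<in> bounded_meas (PiM (J1 \<union> J2) M)"
    by (intro bounded_meas_add bounded_meas_compose[OF 1(4)] bounded_meas_compose[OF 2(4)] measurable_restrict_subset) auto
  have "(\<lambda>x. ?g (restrict x (J1 \<union> J2))) \<in> cylinders" by (rule cylindersI[OF _ _ g]) (use 1 2 in auto)
  then show ?thesis by (simp add: 1 2 Un_Int_eq)
qed

definition cyl_approx :: "(('i \<Rightarrow> 'a) \<Rightarrow> real) \<Rightarrow> bool" where
  "cyl_approx f \<longleftrightarrow> f \<in> bounded_meas R \<and> (\<forall>e>0. \<exists>h\<in>cylinders. l1 f h < e)"

lemma cyl_approx_bounded: "cyl_approx f \<Longrightarrow> f \<in> bounded_meas R"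
  by (simp add: cyl_approx_def)

lemma cylinders_approx: "h \<in> cylinders \<Longrightarrow> cyl_approx h"
  unfolding cyl_approx_def l1_def using cylinders_bounded by (auto intro!: bexI[of _ h])

lemma cyl_approx_add:
  assumes f: "cyl_approx f1" "cyl_approx f2"
  shows "cyl_approx (\<lambda>x. f1 x + f2 x)"
  unfolding cyl_approx_def
proof (intro conjI allI impI)
  note b = cyl_approx_bounded[OF f(1)] cyl_approx_bounded[OF f(2)]
  show "(\<lambda>x. f1 x + f2 x) \<in> bounded_meas R" by (intro bounded_meas_add b)
  fix e :: real assume "e > 0"
  then have e: "e / 2 > 0" by simp
  obtain h1 where h1: "h1 \<in> cylinders" "l1 f1 h1 < e / 2" using f(1) e unfolding cyl_approx_def by blast
  obtain h2 where h2: "h2 \<in> cylinders" "l1 f2 h2 < e / 2" using f(2) e unfolding cyl_approx_def by blast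
  show "\<exists>h\<in>cylinders. l1 (\<lambda>x. f1 x + f2 x) h < e"
    using l1_add[OF b cylinders_bounded[OF h1(1)] cylinders_bounded[OF h2(1)]] h1 h2
    by (intro bexI[OF _ cylinders_add[OF h1(1) h2(1)]]) auto
qed

lemma cyl_approx_cmult:
  assumes f: "cyl_approx f"
  shows "cyl_approx (\<lambda>x. c * f x)"
  unfolding cyl_approx_def
proof (intro conjI allI impI)
  show "(\<lambda>x. c * f x) \<in> bounded_meas R" by (intro bounded_meas_cmult cyl_approx_bounded f)
  fix e :: real assume "e > 0"
  then have "e / (\<bar>c\<bar> + 1) > 0" by simp
  then obtain h where h: "h \<in> cylinders" "l1 f h < e / (\<bar>c\<bar> + 1)" using f unfolding cyl_approx_def by blast
  have "\<bar>c\<bar> * l1 f h \<le> (\<bar>c\<bar> + 1) * l1 f h" by (intro mult_right_mono) (auto simp: l1_def)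
  also have "\<dots> < e" using h(2) by (simp add: field_simps)
  finally show "\<exists>h\<in>cylinders. l1 (\<lambda>x. c * f x) h < e"
    by (intro bexI[OF _ cylinders_cmult[OF h(1), of c]]) (simp add: l1_cmult)
qed

lemma cyl_approx_sum: "finite A \<Longrightarrow> (\<And>a. a \<in> A \<Longrightarrow> cyl_approx (f a)) \<Longrightarrow> cyl_approx (\<lambda>x. \<Sum>a\<in>A. f a x)"
  by (induction A rule: finite_induct) (auto intro: cyl_approx_add cylinders_approx cylinders_const)

lemma cyl_approx_limit:
  assumes f: "f \<in> bounded_meas R" and lim: "\<And>e. e > 0 \<Longrightarrow> \<exists>h. cyl_approx h \<and> l1 f h < e"
  shows "cyl_approx f"
  unfolding cyl_approx_def
proof (intro conjI f allI impI)
  fix e :: real assume "e > 0"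
  then have e: "e / 2 > 0" by simp
  obtain h where h: "cyl_approx h" "l1 f h < e / 2" using lim[OF e] by blast
  then obtain h' where h': "h' \<in> cylinders" "l1 h h' < e / 2" using e unfolding cyl_approx_def by blast
  show "\<exists>h\<in>cylinders. l1 f h < e"
    using l1_triangle[OF f cyl_approx_bounded[OF h(1)] cylinders_bounded[OF h'(1)]] h(2) h'(2)
    by (intro bexI[OF _ h'(1)]) simp
qed

lemma cyl_approx_cong:
  assumes "cyl_approx g" "f \<in> bounded_meas R" "\<And>x. x \<in> space R \<Longrightarrow> f x = g x"
  shows "cyl_approx f"
proof (rule cyl_approx_limit[OF assms(2)])
  fix e :: real assume "e > 0"
  then show "\<exists>h. cyl_approx h \<and> l1 f h < e"
    using assms l1_le[OF assms(2) cyl_approx_bounded[OF assms(1)] bounded_meas_const[of 0]] by (intro exI[of _ g]) auto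
qed

text \<open>Dynkin's theorem: finite-dimensional rectangles are cylinder events and form an
  intersection-stable generator. For a countable disjoint union the partial sums of indicators
  converge in both laws by sigma-additivity.\<close>

lemma cyl_approx_indicator:
  assumes A: "A \<in> sets R"
  shows "cyl_approx (indicator A)"
proof -
  define \<Omega> where "\<Omega> = (\<Pi>\<^sub>E i\<in>I. space (M i))"
  have sR: "sets R = sigma_sets \<Omega> (prod_algebra I M)" by (simp add: sets_product sets_PiM \<Omega>_def)
  have spR: "space R = \<Omega>" using sets_eq_imp_space_eq[OF sets_product(2)] by (simp add: space_PiM \<Omega>_def)
  have "A \<in> sigma_sets \<Omega> (prod_algebra I M)" using A by (simp add: sR)
  with prod_algebra_sets_into_space[of I M, folded \<Omega>_def] show ?thesis
  proof (induction rule: sigma_sets_induct_disjoint[OF Int_stable_prod_algebra, consumes 2, case_names basic empty compl union])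
    case (basic A)
    then have As: "A \<in> sets R" by (auto simp: sR)
    from basic obtain J E where J: "A = prod_emb I M J (\<Pi>\<^sub>E j\<in>J. E j)" "finite J" "J \<subseteq> I"
       "\<And>i. i \<in> J \<Longrightarrow> E i \<in> sets (M i)" by (metis prod_algebraE)
    have "indicator (\<Pi>\<^sub>E j\<in>J. E j) \<in> bounded_meas (PiM J M)"
      using J by (intro bounded_meas_indicator sets_PiM_I_finite)
    then have "(\<lambda>x. indicator (\<Pi>\<^sub>E j\<in>J. E j) (restrict x J)) \<in> cylinders" unfolding cylinders_def using J by blast
    then show ?case
      by (rule cyl_approx_cong[OF cylinders_approx bounded_meas_indicator[OF As]])
         (auto simp: J(1) prod_emb_def spR \<Omega>_def split: split_indicator)
  next
    case empty
    then show ?case using cylinders_approx[OF cylinders_const[of 0]] by (simp add: indicator_def)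
  next
    case (compl A)
    then have "A \<in> sets R" by (simp add: sR)
    then have "\<Omega> - A \<in> sets R" using spR by auto
    show ?case
      by (rule cyl_approx_cong[OF cyl_approx_add[OF cylinders_approx[OF cylinders_const[of 1]] cyl_approx_cmult[OF compl(2), of "-1"]]
            bounded_meas_indicator[OF \<open>\<Omega> - A \<in> sets R\<close>]])
         (auto simp: spR split: split_indicator)
  next
    case (union A)
    then have As: "A i \<in> sets R" for i by (auto simp: sR)
    then have U: "(\<Union>i. A i) \<in> sets R" by auto
    let ?d = "\<lambda>Q n. measure Q (\<Union>i. A i) - (\<Sum>i<n. measure Q (A i))"
    have Q: "(\<integral>x. \<bar>indicator (\<Union>i. A i) x - (\<Sum>i<n. indicator (A i) x)\<bar> \<partial>Q) = ?d Q n" "?d Q \<longlonglongrightarrow> 0"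
      if Q: "prob_space Q" "sets Q = sets R" for Q n
    proof -
      interpret Q: prob_space Q by fact
      have AsQ: "A i \<in> sets Q" "(\<Union>i. A i) \<in> sets Q" for i using As Q by auto
      have "(\<Sum>i<n. indicator (A i) x) \<le> (indicator (\<Union>i. A i) x :: real)" for x
      proof -
        have "(\<Sum>i<n. indicator (A i) x :: real) = indicator (\<Union>i<n. A i) x"
          using union(1) by (subst indicator_UN_disjoint) (auto simp: disjoint_family_on_def)
        also have "\<dots> \<le> indicator (\<Union>i. A i) x" by (auto split: split_indicator)
        finally show ?thesis .
      qed
      then have "(\<integral>x. \<bar>indicator (\<Union>i. A i) x - (\<Sum>i<n. indicator (A i) x)\<bar> \<partial>Q)
          = (\<integral>x. indicator (\<Union>i. A i) x - (\<Sum>i<n. indicator (A i) x :: real) \<partial>Q)"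
        by (intro Bochner_Integration.integral_cong) auto
      also have "\<dots> = (\<integral>x. indicator (\<Union>i. A i) x \<partial>Q) - (\<Sum>i<n. (\<integral>x. indicator (A i) x \<partial>Q))"
        using AsQ Q.emeasure_finite
        by (subst Bochner_Integration.integral_diff; (subst Bochner_Integration.integral_sum)?)
           (auto intro!: Bochner_Integration.integrable_sum simp: Q.integrable_bounded_meas bounded_meas_indicator less_top)
      finally show "(\<integral>x. \<bar>indicator (\<Union>i. A i) x - (\<Sum>i<n. indicator (A i) x)\<bar> \<partial>Q) = ?d Q n"
        using AsQ by (simp add: sets.sets_into_space Int_absorb2)
      have "(\<lambda>i. measure Q (A i)) sums measure Q (\<Union>i. A i)"
        using AsQ union(1) by (intro Q.finite_measure_UNION) auto
      then show "?d Q \<longlonglongrightarrow> 0" unfolding sums_def by (auto intro!: tendsto_eq_intros)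
    qed
    show ?case
    proof (rule cyl_approx_limit[OF bounded_meas_indicator[OF U]])
      fix e :: real assume "e > 0"
      have "(\<lambda>n. ?d P n + ?d R n) \<longlonglongrightarrow> 0"
        using tendsto_add[OF Q(2)[OF prob(1) sets_eq] Q(2)[OF prob(2) refl]] by simp
      then obtain n where "?d P n + ?d R n < e"
        using order_tendstoD(2)[OF _ \<open>e > 0\<close>] by (fastforce simp: eventually_sequentially)
      moreover have "cyl_approx (\<lambda>x. \<Sum>i<n. indicator (A i) x)"
        by (intro cyl_approx_sum union(3)) simp
      ultimately show "\<exists>h. cyl_approx h \<and> l1 (indicator (\<Union>i. A i)) h < e"
        using Q(1)[OF prob(1) sets_eq, of n] Q(1)[OF prob(2) refl, of n] unfolding l1_def
        by (intro exI[of _ "\<lambda>x. \<Sum>i<n. indicator (A i) x"]) simp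
    qed
  qed
qed

text \<open>Rounding f down to the grid of mesh \<open>1 / N\<close> gives a finite combination of
  indicators at uniform distance at most \<open>1 / N\<close>.\<close>

lemma cyl_approx_bounded_meas:
  assumes f: "f \<in> bounded_meas R"
  shows "cyl_approx f"
proof (rule cyl_approx_limit[OF f])
  fix e :: real assume e: "e > 0"
  obtain B where B: "\<And>x. x \<in> space R \<Longrightarrow> \<bar>f x\<bar> \<le> B" using bounded_measE[OF f] by blast
  \<comment> \<open>Half of e, because the uniform error is counted once under P and once under
    R.\<close>
  obtain n :: nat where n: "1 / real (Suc n) < e / 2" using nat_approx_posE[of "e / 2"] e by auto
  define N where "N = real (Suc n)"
  have N: "N > 0" "1 / N < e / 2" using n by (auto simp: N_def)
  define k where "k x = \<lfloor>N * f x\<rfloor>" for x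
  define K where "K = \<lceil>N * B\<rceil> + 1"
  define A where "A j = {x \<in> space R. k x = j}" for j
  note [measurable] = bounded_meas_measurable[OF f]
  have A: "A j \<in> sets R" for j unfolding A_def k_def by measurable
  define h where "h x = (\<Sum>j\<in>{-K..K}. (of_int j / N) * indicator (A j) x)" for x
  have kK: "k x \<in> {-K..K}" if "x \<in> space R" for x
  proof -
    have "\<bar>N * f x\<bar> \<le> N * B" using B[OF that] N by (simp add: abs_mult)
    then show ?thesis unfolding k_def K_def by (simp add: abs_le_iff) linarith
  qed
  have hx: "h x = of_int (k x) / N" if "x \<in> space R" for x
  proof -
    have "h x = (\<Sum>j\<in>{-K..K}. if j = k x then of_int j / N else 0)"
      unfolding h_def using that by (intro sum.cong) (auto simp: A_def)
    then show ?thesis using kK[OF that] by simp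
  qed
  have d: "\<bar>f x - h x\<bar> \<le> 1 / N" if "x \<in> space R" for x
  proof -
    have "\<bar>N * f x - of_int (k x)\<bar> \<le> 1" unfolding k_def by linarith
    then have "\<bar>N * (f x - h x)\<bar> \<le> 1" using hx[OF that] N by (simp add: algebra_simps)
    then have "\<bar>f x - h x\<bar> * N \<le> 1" using N by (simp add: abs_mult mult.commute)
    then show ?thesis using N by (simp add: pos_le_divide_eq)
  qed
  have h: "cyl_approx h"
    unfolding h_def[abs_def]
    by (intro cyl_approx_sum finite_atLeastAtMost_int cyl_approx_cmult cyl_approx_indicator A)
  have "l1 f h \<le> (\<integral>x. 1 / N \<partial>P) + (\<integral>x. 1 / N \<partial>R)"
    by (rule l1_le[OF f cyl_approx_bounded[OF h] bounded_meas_const d])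
  then show "\<exists>h. cyl_approx h \<and> l1 f h < e"
    using h N by (intro exI[of _ h]) (simp add: P.prob_space R.prob_space)
qed

text \<open>\<open>dv\<close> is continuous along L1-approximations that stay uniformly bounded: the
  exponential is Lipschitz on a bounded interval, so convergence of the functions carries over to
  their exponentials.\<close>

lemma dv_le_of_cylinders:
  assumes f: "f \<in> bounded_meas R" and le: "\<And>h. h \<in> cylinders \<Longrightarrow> dv P R h \<le> c"
  shows "dv P R f \<le> c"
proof -
  obtain B where B: "B > 0" "\<And>x. x \<in> space R \<Longrightarrow> \<bar>f x\<bar> \<le> B" using bounded_measE[OF f] by blast
  have "\<forall>n. \<exists>h\<in>cylinders. (\<forall>x. \<bar>h x\<bar> \<le> B) \<and> l1 f h < 1 / Suc n"
  proof
    fix n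
    have "1 / real (Suc n) > 0" by simp
    then obtain h where h: "h \<in> cylinders" "l1 f h < 1 / Suc n"
      using cyl_approx_bounded_meas[OF f] unfolding cyl_approx_def by meson
    then obtain J g where g: "h = (\<lambda>x. g (restrict x J))" "finite J" "J \<subseteq> I" "g \<in> bounded_meas (PiM J M)"
      unfolding cylinders_def by blast
    \<comment> \<open>Clipping to the range of f preserves the cylinder property and cannot increase
      the distance to f, whose values lie in \<open>[-B, B]\<close> already.\<close>
    define h' where "h' x = max (- B) (min B (h x))" for x
    have "(\<lambda>x. max (- B) (min B (g x))) \<in> bounded_meas (PiM J M)"
      using bounded_meas_measurable[OF g(4)] B(1) by (auto simp: bounded_meas_def intro!: exI[of _ B])
    from cylindersI[OF g(2,3) this] have h': "h' \<in> cylinders" by (simp add: h'_def[abs_def] g(1))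
    have "l1 f h' \<le> l1 f h"
      using B(2) l1_le[OF f cylinders_bounded[OF h'] bounded_meas_abs_diff[OF f cylinders_bounded[OF h(1)]]]
      unfolding h'_def l1_def[of f h] by fastforce
    moreover have "\<forall>x. \<bar>h' x\<bar> \<le> B" using B(1) by (auto simp: h'_def abs_le_iff)
    ultimately show "\<exists>h\<in>cylinders. (\<forall>x. \<bar>h x\<bar> \<le> B) \<and> l1 f h < 1 / Suc n"
      using h' h(2) by (intro bexI[of _ h']) auto
  qed
  then obtain h where h: "\<And>n. h n \<in> cylinders" "\<And>n x. \<bar>h n x\<bar> \<le> B" "\<And>n. l1 f (h n) < 1 / Suc n"
    by metis
  note hb = cylinders_bounded[OF h(1)]
  have L: "(\<integral>x. \<bar>f x - h n x\<bar> \<partial>P) \<le> 1 / Suc n" "(\<integral>x. \<bar>f x - h n x\<bar> \<partial>R) \<le> 1 / Suc n" for n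
  proof -
    have "0 \<le> (\<integral>x. \<bar>f x - h n x\<bar> \<partial>Q)" for Q by simp
    then show "(\<integral>x. \<bar>f x - h n x\<bar> \<partial>P) \<le> 1 / Suc n" "(\<integral>x. \<bar>f x - h n x\<bar> \<partial>R) \<le> 1 / Suc n"
      using h(3)[of n] unfolding l1_def by (smt (verit))+
  qed
  have lim0: "(\<lambda>n. K * (1 / real (Suc n))) \<longlonglongrightarrow> 0" for K by real_asymp
  have "\<forall>n. norm ((\<integral>x. h n x \<partial>P) - (\<integral>x. f x \<partial>P)) \<le> 1 * (1 / Suc n)"
  proof
    fix n
    have "\<bar>(\<integral>x. h n x \<partial>P) - (\<integral>x. f x \<partial>P)\<bar> = \<bar>\<integral>x. f x - h n x \<partial>P\<bar>"
      using integrable_bounded[OF f] integrable_bounded[OF hb] by (simp add: abs_minus_commute)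
    also have "\<dots> \<le> (\<integral>x. \<bar>f x - h n x\<bar> \<partial>P)" by (rule integral_abs_bound)
    finally show "norm ((\<integral>x. h n x \<partial>P) - (\<integral>x. f x \<partial>P)) \<le> 1 * (1 / Suc n)" using L(1)[of n] by simp
  qed
  then have 1: "(\<lambda>n. \<integral>x. h n x \<partial>P) \<longlonglongrightarrow> (\<integral>x. f x \<partial>P)"
    by (rule LIM_zero_cancel[OF Lim_null_comparison[OF always_eventually lim0]])
  have "\<forall>n. norm ((\<integral>x. exp (h n x) \<partial>R) - (\<integral>x. exp (f x) \<partial>R)) \<le> exp B * (1 / Suc n)"
  proof
    fix n
    note e = bounded_meas_exp[OF f] bounded_meas_exp[OF hb[of n]]
    have "\<bar>(\<integral>x. exp (h n x) \<partial>R) - (\<integral>x. exp (f x) \<partial>R)\<bar> = \<bar>\<integral>x. exp (f x) - exp (h n x) \<partial>R\<bar>"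
      using integrable_bounded[OF e(1)] integrable_bounded[OF e(2)] by (simp add: abs_minus_commute)
    also have "\<dots> \<le> (\<integral>x. \<bar>exp (f x) - exp (h n x)\<bar> \<partial>R)" by (rule integral_abs_bound)
    also have "\<dots> \<le> (\<integral>x. exp B * \<bar>f x - h n x\<bar> \<partial>R)"
      using abs_exp_diff_le B(2) h(2)
      by (intro integral_mono integrable_bounded bounded_meas_cmult bounded_meas_abs_diff e f hb) auto
    also have "\<dots> \<le> exp B * (1 / Suc n)"
      using mult_left_mono[OF L(2)[of n], of "exp B"] by simp
    finally show "norm ((\<integral>x. exp (h n x) \<partial>R) - (\<integral>x. exp (f x) \<partial>R)) \<le> exp B * (1 / Suc n)" by simp
  qed
  then have 2: "(\<lambda>n. \<integral>x. exp (h n x) \<partial>R) \<longlonglongrightarrow> (\<integral>x. exp (f x) \<partial>R)"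
    by (rule LIM_zero_cancel[OF Lim_null_comparison[OF always_eventually lim0]])
  have "(\<lambda>n. dv P R (h n)) \<longlonglongrightarrow> dv P R f"
    unfolding dv_def using R.integral_exp_pos[OF f] by (intro tendsto_diff tendsto_ln 1 2) auto
  then show ?thesis by (rule LIMSEQ_le_const2) (use h(1) le in auto)
qed

text \<open>A cylinder function over J has the same \<open>dv\<close> as its base function under the
  J-marginals, so testing with cylinders only sees finite-dimensional entropies. The other direction
  is monotonicity under restriction.\<close>

lemma rel_entropy_eq_SUP_finite:
  "rel_entropy P R = (SUP J\<in>{J. finite J \<and> J \<subseteq> I}.
     rel_entropy (distr P (PiM J M) (\<lambda>x. restrict x J)) (distr R (PiM J M) (\<lambda>x. restrict x J)))" (is "_ = (SUP J\<in>?F. ?h J)")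
proof (rule antisym)
  have m: "(\<lambda>x. restrict x J) \<in> measurable P (PiM J M)" "(\<lambda>x. restrict x J) \<in> measurable R (PiM J M)" if "J \<subseteq> I" for J
    using measurable_restrict_subset[OF that, of M] measurable_cong_sets[OF sets_product(1) refl] measurable_cong_sets[OF sets_product(2) refl] by auto
  show "(SUP J\<in>?F. ?h J) \<le> rel_entropy P R"
    by (rule SUP_least, rule rel_entropy_distr_le[OF prob sets_eq]) (simp add: m)
  show "rel_entropy P R \<le> (SUP J\<in>?F. ?h J)" (is "_ \<le> ?S")
  proof (cases "?S = \<infinity>")
    case False
    have "dv P R f \<le> enn2real ?S" if f: "f \<in> bounded_meas R" for f
    proof (rule dv_le_of_cylinders[OF f])
      fix h assume "h \<in> cylinders"
      then obtain J g where J: "h = (\<lambda>x. g (restrict x J))" "finite J" "J \<subseteq> I" "g \<in> bounded_meas (PiM J M)"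
        unfolding cylinders_def by blast
      have "ennreal (dv P R h) = ennreal (dv (distr P (PiM J M) (\<lambda>x. restrict x J)) (distr R (PiM J M) (\<lambda>x. restrict x J)) g)"
        by (simp only: J(1) dv_distr[OF m[OF J(3)] J(4)])
      also have "\<dots> \<le> ?h J"
        using J(4) bounded_meas_cong[of "distr R (PiM J M) (\<lambda>x. restrict x J)" "PiM J M"]
        by (intro dv_le_rel_entropy P.prob_space_distr R.prob_space_distr m[OF J(3)]) simp_all
      also have "\<dots> \<le> ?S" by (rule SUP_upper) (simp add: J)
      finally have "enn2real (ennreal (dv P R h)) \<le> enn2real ?S"
        using False by (intro enn2real_mono) (simp_all only: top.not_eq_extremum infinity_ennreal_def not_False_eq_True)
      then show "dv P R h \<le> enn2real ?S"
        by (smt (verit) enn2real_ennreal enn2real_nonneg)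
    qed
    then have "rel_entropy P R \<le> ennreal (enn2real ?S)" by (intro rel_entropy_le prob sets_eq)
    then show ?thesis using False by (simp only: ennreal_enn2real_if infinity_ennreal_def if_False)
  qed (simp only: infinity_ennreal_def top_greatest)
qed

end

subsection \<open>The entropy density as a supremum over boxes\<close>

abbreviation cnt :: "'i \<Rightarrow> nat measure" where "cnt \<equiv> \<lambda>_. count_space UNIV"

abbreviation sites :: "(int^'d::finite) set \<Rightarrow> (nat \<times> (int^'d)) set" where "sites Q \<equiv> {1..} \<times> Q"

definition marg :: "'i set \<Rightarrow> ('i \<Rightarrow> nat) measure \<Rightarrow> ('i \<Rightarrow> nat) measure" where
  "marg J P = distr P (PiM J cnt) (\<lambda>\<omega>. restrict \<omega> J)"

text \<open>J is any set of pairs, not only the coordinates of a spatial region: densities are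
  computed on finite J, whereas a box carries infinitely many mark sizes.\<close>

definition pois_on :: "(nat \<Rightarrow> real) \<Rightarrow> (nat \<times> 'b) set \<Rightarrow> (nat \<times> 'b \<Rightarrow> nat) measure" where
  "pois_on m J = PiM J (\<lambda>kx. measure_pmf (poisson_law (m (fst kx))))"

definition ent :: "(nat \<Rightarrow> real) \<Rightarrow> (nat \<times> 'b) set \<Rightarrow> (nat \<times> 'b \<Rightarrow> nat) measure \<Rightarrow> ennreal" where
  "ent m J P = rel_entropy (marg J P) (pois_on m J)"

text \<open>The laws without shift invariance. Monotonicity, superadditivity and convexity of
  \<open>ent\<close> live at this level; invariance enters only with translations.\<close>

definition config_laws :: "'d::finite config measure set" where
  "config_laws = {P. prob_space P \<and> sets P = sets (PiM (sites UNIV) cnt)}"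

lemma config_space_eq: "config_space Q = PiM (sites Q) cnt"
  by (simp add: config_space_def)

lemma poisson_process_eq: "poisson_process m = pois_on m (sites UNIV)"
  by (simp add: poisson_process_def pois_on_def case_prod_unfold)

lemma restrict_law_eq: "restrict_law Q P = marg (sites Q) P"
  by (simp add: restrict_law_def marg_def config_space_eq)

lemma sets_pois_on: "sets (pois_on m J) = sets (PiM J cnt)"
  unfolding pois_on_def by (rule sets_PiM_cong) auto

lemma prob_pois_on: "prob_space (pois_on m J)"
  unfolding pois_on_def by (intro prob_space_PiM measure_pmf.prob_space_axioms)

lemma sets_marg [simp]: "sets (marg J P) = sets (PiM J cnt)"
  by (simp add: marg_def)

lemma measurable_restrict_law: "sets P = sets (PiM K cnt) \<Longrightarrow> J \<subseteq> K \<Longrightarrow> (\<lambda>\<omega>. restrict \<omega> J) \<in> measurable P (PiM J cnt)"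
  using measurable_restrict_subset[of J K cnt] measurable_cong_sets[of P "PiM K cnt" "PiM J cnt" "PiM J cnt"] by auto

lemma prob_marg: "prob_space P \<Longrightarrow> sets P = sets (PiM K cnt) \<Longrightarrow> J \<subseteq> K \<Longrightarrow> prob_space (marg J P)"
  unfolding marg_def by (intro prob_space.prob_space_distr measurable_restrict_law)

lemma marg_marg:
  assumes "sets P = sets (PiM L cnt)" "J \<subseteq> K" "K \<subseteq> L"
  shows "marg J (marg K P) = marg J P"
proof -
  have "marg J (marg K P) = distr P (PiM J cnt) ((\<lambda>\<omega>. restrict \<omega> J) \<circ> (\<lambda>\<omega>. restrict \<omega> K))"
    unfolding marg_def using assms by (intro distr_distr measurable_restrict_subset measurable_restrict_law)
  also have "(\<lambda>\<omega>. restrict \<omega> J) \<circ> (\<lambda>\<omega>. restrict \<omega> K) = (\<lambda>\<omega>::'a \<Rightarrow> nat. restrict \<omega> J)"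
    using Int_absorb1[OF assms(2)] by (simp only: comp_def restrict_restrict)
  finally show ?thesis unfolding marg_def .
qed

lemma marg_pois_on:
  assumes "J \<subseteq> K"
  shows "marg J (pois_on m K) = pois_on m J"
proof -
  have "marg J (pois_on m K) = distr (pois_on m K) (pois_on m J) (\<lambda>\<omega>. \<lambda>i\<in>J. \<omega> i)"
    unfolding marg_def by (rule distr_cong) (auto simp: sets_pois_on)
  also have "\<dots> = pois_on m J"
    unfolding pois_on_def
    using assms distr_PiM_reindex[of K "\<lambda>kx. measure_pmf (poisson_law (m (fst kx)))" "\<lambda>x. x" J]
    by (auto simp: measure_pmf.prob_space_axioms)
  finally show ?thesis .
qed

lemma ent_restrict_law:
  "rel_entropy (restrict_law Q P) (restrict_law Q (poisson_process m)) = ent m (sites Q) P"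
  by (simp add: ent_def restrict_law_eq poisson_process_eq marg_pois_on Sigma_mono)

lemma config_lawsD: "P \<in> config_laws \<Longrightarrow> prob_space P" "P \<in> config_laws \<Longrightarrow> sets P = sets (PiM (sites UNIV) cnt)"
  by (auto simp: config_laws_def)

lemma ent_mono:
  assumes P: "P \<in> config_laws" and J: "J \<subseteq> K" "K \<subseteq> sites UNIV"
  shows "ent m J P \<le> ent m K P"
proof -
  have "ent m J P = rel_entropy (marg J (marg K P)) (marg J (pois_on m K))"
    using J by (simp add: ent_def marg_pois_on marg_marg[OF config_lawsD(2)[OF P]])
  also have "\<dots> \<le> ent m K P"
    unfolding marg_def[of J] ent_def
    using J by (intro rel_entropy_distr_le prob_marg[OF config_lawsD[OF P]] prob_pois_on measurable_restrict_law[OF sets_pois_on])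
      (auto simp: sets_pois_on)
  finally show ?thesis .
qed

lemma ent_eq_SUP:
  assumes P: "P \<in> config_laws" and K: "K \<subseteq> sites UNIV"
  shows "ent m K P = (SUP J\<in>{J. finite J \<and> J \<subseteq> K}. ent m J P)"
proof -
  interpret product_pair "marg K P" "pois_on m K" K cnt
    by (rule product_pair.intro) (rule prob_marg[OF config_lawsD[OF P] K] prob_pois_on sets_marg sets_pois_on)+
  have "ent m K P = (SUP J\<in>{J. finite J \<and> J \<subseteq> K}. rel_entropy (marg J (marg K P)) (marg J (pois_on m K)))"
    unfolding ent_def marg_def[of _ "marg K P"] marg_def[of _ "pois_on m K"] by (rule rel_entropy_eq_SUP_finite)
  also have "\<dots> = (SUP J\<in>{J. finite J \<and> J \<subseteq> K}. ent m J P)"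
    using K by (intro SUP_cong refl) (simp add: ent_def marg_pois_on marg_marg[OF config_lawsD(2)[OF P]])
  finally show ?thesis .
qed

lemma (in prob_space) indep_vars_empty: "indep_vars M' X {}"
  by (simp add: indep_vars_def indep_sets_def)

lemma indep_vars_pois_on:
  "prob_space.indep_vars (pois_on m K) (\<lambda>kx. measure_pmf (poisson_law (m (fst kx)))) (\<lambda>i \<omega>. \<omega> i) K"
proof -
  interpret prob_space "pois_on m K" by (rule prob_pois_on)
  let ?M = "\<lambda>kx. measure_pmf (poisson_law (m (fst kx)))"
  show ?thesis
  proof (cases "K = {}")
    case True
    then show ?thesis using indep_vars_empty by simp
  next
    case False
    have rv: "random_variable (?M i) (\<lambda>\<omega>. \<omega> i)" if "i \<in> K" for i
      unfolding pois_on_def using that by (rule measurable_component_singleton)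
    have "distr (pois_on m K) (PiM K ?M) (\<lambda>x. \<lambda>i\<in>K. x i) = distr (pois_on m K) (pois_on m K) (\<lambda>x. x)"
      by (rule distr_cong) (auto simp: pois_on_def space_PiM)
    also have "\<dots> = PiM K ?M" by (simp add: pois_on_def)
    also have "\<dots> = PiM K (\<lambda>i. distr (pois_on m K) (?M i) (\<lambda>\<omega>. \<omega> i))"
      unfolding pois_on_def
      by (intro PiM_cong refl distr_PiM_component[symmetric] measure_pmf.prob_space_axioms)
    finally show ?thesis
      using indep_vars_iff_distr_eq_PiM'[OF False rv] by simp
  qed
qed

lemma ent_add_le:
  assumes P: "P \<in> config_laws" and J: "J1 \<inter> J2 = {}" "J1 \<subseteq> sites UNIV" "J2 \<subseteq> sites UNIV"
  shows "ent m J1 P + ent m J2 P \<le> ent m (J1 \<union> J2) P"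
proof -
  let ?K = "J1 \<union> J2" and ?M = "\<lambda>kx. measure_pmf (poisson_law (m (fst kx)))"
  have K: "?K \<subseteq> sites UNIV" using J by auto
  have ind: "prob_space.indep_var (pois_on m ?K) (PiM J1 ?M) (\<lambda>\<omega>. restrict \<omega> J1) (PiM J2 ?M) (\<lambda>\<omega>. restrict \<omega> J2)"
    using prob_space.indep_var_restrict[OF prob_pois_on indep_vars_pois_on J(1), of ?K m] by auto
  have d: "distr Q (PiM J ?M) (\<lambda>\<omega>. restrict \<omega> J) = marg J Q" for Q J
    unfolding marg_def by (rule distr_cong) (auto intro!: sets_PiM_cong)
  have "ent m J P = rel_entropy (marg J (marg ?K P)) (marg J (pois_on m ?K))" if "J \<subseteq> ?K" for J
    using that K by (simp add: ent_def marg_pois_on marg_marg[OF config_lawsD(2)[OF P]])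
  then have "ent m J1 P + ent m J2 P
      = rel_entropy (marg J1 (marg ?K P)) (marg J1 (pois_on m ?K)) + rel_entropy (marg J2 (marg ?K P)) (marg J2 (pois_on m ?K))"
    by simp
  also have "\<dots> \<le> ent m ?K P"
    unfolding ent_def d[symmetric]
    using K by (intro rel_entropy_indep_add_le[OF _ _ _ ind] prob_pois_on) (auto simp: d sets_pois_on prob_marg[OF config_lawsD[OF P]])
  finally show ?thesis .
qed

lemma config_laws_bind:
  assumes "\<And>c. K c \<in> config_laws"
  shows "measure_pmf \<mu> \<bind> K \<in> config_laws"
  using pmf_kernel[of K "PiM (sites UNIV) cnt" \<mu>] config_lawsD[OF assms] by (auto simp: config_laws_def)

lemma ent_bind_le:
  fixes K :: "'c \<Rightarrow> 'd::finite config measure"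
  assumes K: "\<And>c. K c \<in> config_laws" and J: "J \<subseteq> sites UNIV"
  shows "ent m J (measure_pmf \<mu> \<bind> K) \<le> (\<integral>\<^sup>+c. ent m J (K c) \<partial>measure_pmf \<mu>)"
proof -
  have "marg J (measure_pmf \<mu> \<bind> K) = measure_pmf \<mu> \<bind> (\<lambda>c. marg J (K c))"
    unfolding marg_def
    using config_lawsD[OF K] J by (intro distr_bind[where K="PiM (sites UNIV) cnt"] pmf_kernel(1) measurable_restrict_subset) auto
  moreover have "rel_entropy (measure_pmf \<mu> \<bind> (\<lambda>c. marg J (K c))) (pois_on m J) \<le> (\<integral>\<^sup>+c. rel_entropy (marg J (K c)) (pois_on m J) \<partial>measure_pmf \<mu>)"
    using J by (intro rel_entropy_bind_le prob_pois_on prob_marg[OF config_lawsD[OF K]]) (auto simp: sets_pois_on)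
  ultimately show ?thesis by (simp add: ent_def)
qed

section \<open>Translations and tilings by boxes\<close>

lemma shift_invariant_config_laws: "shift_invariant \<subseteq> config_laws"
  by (auto simp: shift_invariant_def config_laws_def config_space_eq)

lemma measurable_shift: "shift z \<in> measurable (PiM (sites UNIV) cnt) (PiM (sites UNIV) cnt)"
proof (rule measurable_PiM_single')
  fix i :: "nat \<times> (int^'a)" assume i: "i \<in> sites UNIV"
  then have "(\<lambda>\<omega>. \<omega> (fst i, snd i + z)) \<in> measurable (PiM (sites UNIV) cnt) (count_space UNIV)"
    by (intro measurable_component_singleton) auto
  then show "(\<lambda>\<omega>. shift z \<omega> i) \<in> measurable (PiM (sites UNIV) cnt) (count_space UNIV)"
    by (simp add: shift_def case_prod_unfold)
qed (auto simp: shift_def space_PiM PiE_def extensional_def)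

text \<open>Relative entropy decreases along the relabelling map T that moves the shifted region
  back onto Q: T carries the Poisson marginal to the Poisson marginal because the rates do not
  depend on the site, and the P-marginal to the P-marginal by shift invariance.\<close>

lemma ent_translate:
  fixes P :: "'d::finite config measure"
  assumes P: "P \<in> shift_invariant"
  shows "ent m (sites Q) P \<le> ent m (sites ((\<lambda>x. x + z) ` Q)) P"
proof -
  let ?Q = "(\<lambda>x. x + z) ` Q"
  let ?M = "\<lambda>kx. measure_pmf (poisson_law (m (fst kx)))"
  have Pc: "P \<in> config_laws" using P shift_invariant_config_laws by auto
  note sP = config_lawsD(2)[OF Pc]
  have sh: "shift z \<in> measurable P (PiM (sites UNIV) cnt)"
    using measurable_shift by (simp only: measurable_cong_sets[OF sP refl])
  define f :: "nat \<times> (int^'d) \<Rightarrow> _" where "f = (\<lambda>(k, x). (k, x + z))"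
  define T where "T \<omega> = (\<lambda>i\<in>sites Q. \<omega> (f i))" for \<omega> :: "'d config"
  have fin: "f i \<in> sites ?Q" if "i \<in> sites Q" for i using that by (auto simp: f_def)
  have T: "T \<in> measurable (PiM (sites ?Q) cnt) (PiM (sites Q) cnt)"
    unfolding T_def by (intro measurable_restrict measurable_component_singleton fin)
  have "distr (pois_on m (sites ?Q)) (PiM (sites Q) cnt) T
     = distr (PiM (sites ?Q) ?M) (PiM (sites Q) (\<lambda>i. ?M (f i))) (\<lambda>\<omega>. \<lambda>n\<in>sites Q. \<omega> (f n))"
    unfolding pois_on_def by (rule distr_cong) (auto intro!: sets_PiM_cong simp: T_def)
  also have "\<dots> = PiM (sites Q) (\<lambda>i. ?M (f i))"
    by (rule distr_PiM_reindex) (auto simp: measure_pmf.prob_space_axioms fin inj_on_def f_def)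
  also have "\<dots> = pois_on m (sites Q)"
    unfolding pois_on_def by (rule PiM_cong) (auto simp: f_def)
  finally have 1: "distr (pois_on m (sites ?Q)) (PiM (sites Q) cnt) T = pois_on m (sites Q)" .
  have "distr (marg (sites ?Q) P) (PiM (sites Q) cnt) T = distr P (PiM (sites Q) cnt) (T \<circ> (\<lambda>\<omega>. restrict \<omega> (sites ?Q)))"
    unfolding marg_def by (intro distr_distr T measurable_restrict_law[OF sP]) auto
  also have "\<dots> = distr P (PiM (sites Q) cnt) ((\<lambda>\<omega>. restrict \<omega> (sites Q)) \<circ> shift z)"
    by (rule distr_cong) (auto simp: T_def f_def shift_def fun_eq_iff)
  also have "\<dots> = marg (sites Q) (distr P (PiM (sites UNIV) cnt) (shift z))"
    unfolding marg_def by (rule distr_distr[symmetric], rule measurable_restrict_subset, blast, rule sh)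
  also have "\<dots> = marg (sites Q) P" using P by (simp add: shift_invariant_def config_space_eq)
  finally have 2: "distr (marg (sites ?Q) P) (PiM (sites Q) cnt) T = marg (sites Q) P" .
  have "rel_entropy (distr (marg (sites ?Q) P) (PiM (sites Q) cnt) T) (distr (pois_on m (sites ?Q)) (PiM (sites Q) cnt) T)
      \<le> rel_entropy (marg (sites ?Q) P) (pois_on m (sites ?Q))"
    using T by (intro rel_entropy_distr_le prob_pois_on prob_marg[OF config_lawsD[OF Pc]])
      (auto simp: sets_pois_on measurable_cong_sets[OF sets_pois_on refl])
  then show ?thesis by (simp only: 1 2 ent_def)
qed

lemma card_vec_Pi:
  assumes "finite A"
  shows "finite {z :: 'a ^ 'd::finite. \<forall>i. z $ i \<in> A}" "card {z :: 'a ^ 'd. \<forall>i. z $ i \<in> A} = card A ^ CARD('d)"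
proof -
  have b: "bij_betw vec_nth {z :: 'a ^ 'd. \<forall>i. z $ i \<in> A} (\<Pi>\<^sub>E i\<in>UNIV. A)"
    by (rule bij_betwI[where g=vec_lambda]) (auto simp: PiE_def)
  show "card {z :: 'a ^ 'd. \<forall>i. z $ i \<in> A} = card A ^ CARD('d)"
    using bij_betw_same_card[OF b] by (simp add: card_PiE)
  show "finite {z :: 'a ^ 'd. \<forall>i. z $ i \<in> A}"
    using bij_betw_finite[OF b] assms by (simp add: finite_PiE)
qed

lemma lattice_box_eq: "lattice_box n = {z. \<forall>i. z $ i \<in> {- int n..int n}}"
  by (auto simp: lattice_box_def abs_le_iff minus_le_iff)

lemma finite_lattice_box: "finite (lattice_box n)"
  and card_lattice_box: "card (lattice_box n :: (int^'d::finite) set) = (2 * n + 1) ^ CARD('d)"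
proof -
  show "finite (lattice_box n)"
    unfolding lattice_box_eq by (rule card_vec_Pi(1)) simp
  have "card {- int n..int n} = 2 * n + 1" by simp
  then show "card (lattice_box n :: (int^'d) set) = (2 * n + 1) ^ CARD('d)"
    unfolding lattice_box_eq by (subst card_vec_Pi(2)) simp_all
qed

text \<open>Disjoint translates occupy disjoint coordinate sets, so superadditivity adds their
  entropies, each of which is at least that of Q by translation.\<close>

lemma ent_tiles:
  fixes P :: "'d::finite config measure"
  assumes P: "P \<in> shift_invariant" and C: "finite C" and dis: "disjoint_family_on (\<lambda>z. (\<lambda>x. x + z) ` Q) C"
  shows "of_nat (card C) * ent m (sites Q) P \<le> ent m (sites (\<Union>z\<in>C. (\<lambda>x. x + z) ` Q)) P"
  using C dis
proof (induction C)
  case (insert z C)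
  have Pc: "P \<in> config_laws" using P shift_invariant_config_laws by auto
  let ?A = "(\<lambda>x. x + z) ` Q" and ?B = "\<Union>z\<in>C. (\<lambda>x. x + z) ` Q"
  have "?A \<inter> (\<lambda>x. x + z') ` Q = {}" if "z' \<in> C" for z'
    using insert.prems insert.hyps that by (intro disjoint_family_onD[OF insert.prems]) auto
  then have "?A \<inter> ?B = {}" by blast
  have "of_nat (card (insert z C)) * ent m (sites Q) P = ent m (sites Q) P + of_nat (card C) * ent m (sites Q) P"
    using insert by (simp add: distrib_right)
  also have "\<dots> \<le> ent m (sites ?A) P + ent m (sites ?B) P"
    using insert by (intro add_mono ent_translate[OF P] insert.IH) (auto simp: disjoint_family_on_def)
  also have "\<dots> \<le> ent m (sites ?A \<union> sites ?B) P"
    using \<open>?A \<inter> ?B = {}\<close> by (intro ent_add_le[OF Pc]) auto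
  also have "sites ?A \<union> sites ?B = sites (\<Union>z\<in>insert z C. (\<lambda>x. x + z) ` Q)" by auto
  finally show ?case .
qed simp

text \<open>Along each axis, \<open>K = (2n+1) div (2r+1)\<close> intervals of length
  \<open>2r+1\<close> fit side by side into an interval of length \<open>2n+1\<close>; the products
  of these intervals are the tiles.\<close>

lemma ent_box_le:
  fixes P :: "'d::finite config measure"
  assumes P: "P \<in> shift_invariant"
  shows "of_nat (((2 * n + 1) div (2 * r + 1)) ^ CARD('d)) * ent m (sites (lattice_box r)) P \<le> ent m (sites (lattice_box n)) P"
proof -
  define w where "w = 2 * int r + 1"
  define K where "K = (2 * n + 1) div (2 * r + 1)"
  \<comment> \<open>Centres of the intervals on one axis, packed from the left end: the first centre
    is \<open>-n + r\<close> and neighbours are w apart.\<close>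
  define A where "A = (\<lambda>j. - int n + int r + w * int j) ` {..<K}"
  define C where "C = {z :: int^'d. \<forall>i. z $ i \<in> A}"
  have Kw: "w * int K \<le> 2 * int n + 1"
  proof -
    have "(2 * r + 1) * K \<le> 2 * n + 1" unfolding K_def by (rule times_div_less_eq_dividend)
    then have "int ((2 * r + 1) * K) \<le> int (2 * n + 1)" by (simp only: zle_int)
    then show ?thesis by (simp add: w_def algebra_simps)
  qed
  have w: "w > 0" by (simp add: w_def)
  have "card A = K" unfolding A_def using w by (subst card_image) (auto simp: inj_on_def)
  have C: "finite C" "card C = K ^ CARD('d)"
    using card_vec_Pi[of A, where 'd='d] \<open>card A = K\<close> by (auto simp: C_def A_def)
  \<comment> \<open>Centres differ by a multiple of w in each coordinate, whereas two points of a
    box of radius r differ by at most \<open>2r = w - 1\<close>.\<close>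
  have dj: "z = z'" if z: "z \<in> C" "z' \<in> C" and x: "x \<in> lattice_box r" "y \<in> lattice_box r" "x + z = y + z'" for x y z z' :: "int^'d"
  proof (rule vec_eq_iff[THEN iffD2], rule allI)
    fix i
    obtain j where j: "z $ i = - int n + int r + w * int j" using z(1) by (auto simp: C_def A_def)
    obtain j' where j': "z' $ i = - int n + int r + w * int j'" using z(2) by (auto simp: C_def A_def)
    have "x $ i + z $ i = y $ i + z' $ i" using x(3) by (metis vector_add_component)
    then have "w * (int j - int j') = y $ i - x $ i" by (simp add: j j' algebra_simps)
    moreover have "\<bar>x $ i\<bar> \<le> int r" "\<bar>y $ i\<bar> \<le> int r" using x(1,2) by (auto simp: lattice_box_def)
    then have "\<bar>y $ i - x $ i\<bar> \<le> 2 * int r" by linarith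
    ultimately have "\<bar>w * (int j - int j')\<bar> < w" by (simp add: w_def)
    then have "w * \<bar>int j - int j'\<bar> < w * 1" using w by (simp add: abs_mult)
    then have "\<bar>int j - int j'\<bar> < 1" using w by (simp only: mult_less_cancel_left_pos)
    then have "j = j'" by simp
    then show "z $ i = z' $ i" by (simp add: j j')
  qed
  have sub: "(\<Union>z\<in>C. (\<lambda>x. x + z) ` lattice_box r) \<subseteq> lattice_box n"
  proof safe
    fix z x :: "int^'d" assume z: "z \<in> C" and x: "x \<in> lattice_box r"
    show "x + z \<in> lattice_box n"
      unfolding lattice_box_def
    proof (safe)
      fix i
      obtain j where j: "z $ i = - int n + int r + w * int j" "j < K" using z by (auto simp: C_def A_def)
      have "\<bar>x $ i\<bar> \<le> int r" using x by (simp add: lattice_box_def)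
      moreover have "w * int j \<le> w * (int K - 1)" using j w by (intro mult_left_mono) auto
      then have "w * int j \<le> w * int K - w" by (simp add: algebra_simps)
      moreover have "0 \<le> w * int j" using w by simp
      ultimately have "- int n \<le> x $ i + z $ i" "x $ i + z $ i \<le> int n"
        unfolding j(1) using Kw w_def by linarith+
      then show "\<bar>(x + z) $ i\<bar> \<le> int n" by (simp add: abs_le_iff)
    qed
  qed
  have "of_nat (card C) * ent m (sites (lattice_box r)) P \<le> ent m (sites (\<Union>z\<in>C. (\<lambda>x. x + z) ` lattice_box r)) P"
  proof (rule ent_tiles[OF P C(1)], unfold disjoint_family_on_def, intro ballI impI)
    fix z z' assume z: "z \<in> C" "z' \<in> C" "z \<noteq> z'"
    show "(\<lambda>x. x + z) ` lattice_box r \<inter> (\<lambda>x. x + z') ` lattice_box r = {}"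
      using dj[OF z(1,2)] z(3) by blast
  qed
  also have "\<dots> \<le> ent m (sites (lattice_box n)) P"
    using sub by (intro ent_mono subsetD[OF shift_invariant_config_laws P]) auto
  finally show ?thesis by (simp add: C K_def)
qed

definition box_ent :: "(nat \<Rightarrow> real) \<Rightarrow> 'd::finite config measure \<Rightarrow> nat \<Rightarrow> ennreal" where
  "box_ent m P n = ent m (sites (lattice_box n)) P / of_nat (card (lattice_box n :: (int^'d) set))"

text \<open>The volume fraction covered by the tiles is \<open>(K w / u) ^ d\<close>. The strip left
  uncovered on an axis has length \<open>u mod w\<close>, hence at most \<open>2r\<close>, which
  gives the stated factor; it tends to 1 for fixed r.\<close>

lemma box_ent_ge:
  fixes P :: "'d::finite config measure"
  assumes P: "P \<in> shift_invariant" and rn: "r \<le> n"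
  shows "box_ent m P r * ennreal (((2 * real n + 1 - 2 * real r) / (2 * real n + 1)) ^ CARD('d)) \<le> box_ent m P n"
proof -
  define D where "D = CARD('d)"
  define K where "K = (2 * n + 1) div (2 * r + 1)"
  define w where "w = 2 * r + 1"
  define u where "u = 2 * n + 1"
  define h where "h = ent m (sites (lattice_box r)) P"
  have wu: "w > 0" "u > 0" by (auto simp: w_def u_def)
  have "u = K * w + u mod w" by (simp only: K_def u_def w_def div_mult_mod_eq)
  moreover have "u mod w \<le> 2 * r" using wu(1) mod_less_divisor[of w u] unfolding w_def by simp
  ultimately have "u \<le> K * w + 2 * r" by simp
  then have "real u \<le> real (K * w + 2 * r)" by (simp only: of_nat_le_iff)
  then have Kw: "2 * real n + 1 - 2 * real r \<le> real K * real w" by (simp add: u_def)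
  have "((2 * real n + 1 - 2 * real r) / (2 * real n + 1)) ^ D \<le> (real K * real w / real u) ^ D"
    using rn Kw by (intro power_mono) (auto simp: u_def divide_right_mono add.commute)
  also have "\<dots> = real (K ^ D * w ^ D) / real (u ^ D)" by (simp add: power_divide power_mult_distrib)
  finally have "ennreal (((2 * real n + 1 - 2 * real r) / (2 * real n + 1)) ^ D) \<le> ennreal (real (K ^ D * w ^ D) / real (u ^ D))"
    by (rule ennreal_leI)
  also have "\<dots> = of_nat (K ^ D * w ^ D) / of_nat (u ^ D)"
    using wu by (subst divide_ennreal[symmetric]) (auto simp: ennreal_of_nat_eq_real_of_nat)
  finally have le: "ennreal (((2 * real n + 1 - 2 * real r) / (2 * real n + 1)) ^ D) \<le> of_nat (K ^ D * w ^ D) / of_nat (u ^ D)" .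
  have "box_ent m P r * ennreal (((2 * real n + 1 - 2 * real r) / (2 * real n + 1)) ^ D)
      \<le> (h / of_nat (w ^ D)) * (of_nat (K ^ D * w ^ D) / of_nat (u ^ D))"
    unfolding box_ent_def h_def[symmetric] by (intro mult_mono le) (auto simp: card_lattice_box w_def D_def)
  also have "\<dots> = (of_nat (K ^ D) * h) * (of_nat (w ^ D) / of_nat (w ^ D)) / of_nat (u ^ D)"
    by (simp add: divide_ennreal_def mult_ac)
  also have "of_nat (w ^ D) / of_nat (w ^ D) = (1 :: ennreal)"
    using wu by (intro ennreal_divide_self) (auto simp: of_nat_less_top simp flip: of_nat_power)
  also have "of_nat (K ^ D) * h * 1 / of_nat (u ^ D) \<le> box_ent m P n"
    unfolding box_ent_def
    using ent_box_le[OF P, of n r m] by (auto simp: h_def K_def D_def u_def card_lattice_box intro!: divide_right_mono_ennreal)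
  finally show ?thesis by (simp add: D_def)
qed

text \<open>A Fekete argument: a box r that nearly attains the supremum forces all large boxes to
  come almost as close, by the tiling bound.\<close>

lemma box_ent_tendsto:
  fixes P :: "'d::finite config measure"
  assumes P: "P \<in> shift_invariant"
  shows "box_ent m P \<longlonglongrightarrow> (SUP n. box_ent m P n)"
proof (rule order_tendstoI)
  fix y assume "y < (SUP n. box_ent m P n)"
  then obtain r where r: "y < box_ent m P r" by (auto simp: less_SUP_iff)
  let ?f = "\<lambda>n. ((2 * real n + 1 - 2 * real r) / (2 * real n + 1)) ^ CARD('d)"
  have "(\<lambda>n. (2 * real n + 1 - 2 * real r) / (2 * real n + 1)) \<longlonglongrightarrow> 1" by real_asymp
  then have "?f \<longlonglongrightarrow> 1 ^ CARD('d)" by (rule tendsto_power)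
  then have "(\<lambda>n. ennreal (?f n)) \<longlonglongrightarrow> ennreal 1" by (intro tendsto_ennrealI) simp
  then have "(\<lambda>n. box_ent m P r * ennreal (?f n)) \<longlonglongrightarrow> box_ent m P r * ennreal 1"
    by (intro tendsto_mult_ennreal) auto
  then have "eventually (\<lambda>n. y < box_ent m P r * ennreal (?f n)) sequentially"
    using r by (intro order_tendstoD) auto
  then show "eventually (\<lambda>n. y < box_ent m P n) sequentially"
    using eventually_ge_at_top[of r]
    by eventually_elim (use box_ent_ge[OF P] less_le_trans in blast)
next
  fix y assume "(SUP n. box_ent m P n) < y"
  then show "eventually (\<lambda>n. box_ent m P n < y) sequentially"
    by (intro always_eventually allI) (meson SUP_upper UNIV_I le_less_trans)
qed

lemma specific_entropy_eq_SUP: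
  fixes P :: "'d::finite config measure"
  assumes "P \<in> shift_invariant"
  shows "specific_entropy m P = (SUP n. box_ent m P n)"
  unfolding specific_entropy_def ent_restrict_law
  using box_ent_tendsto[OF assms] by (intro limI) (simp add: box_ent_def[abs_def])

lemma box_ent_bind_le:
  fixes K :: "'c \<Rightarrow> 'd::finite config measure"
  assumes K: "\<And>c. K c \<in> config_laws"
  shows "box_ent m (measure_pmf \<mu> \<bind> K) n \<le> (\<integral>\<^sup>+c. box_ent m (K c) n \<partial>measure_pmf \<mu>)"
proof -
  have "box_ent m (measure_pmf \<mu> \<bind> K) n \<le> (\<integral>\<^sup>+c. ent m (sites (lattice_box n)) (K c) \<partial>measure_pmf \<mu>) / of_nat (card (lattice_box n :: (int^'d) set))"
    unfolding box_ent_def by (intro divide_right_mono_ennreal ent_bind_le K) auto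
  also have "\<dots> = (\<integral>\<^sup>+c. box_ent m (K c) n \<partial>measure_pmf \<mu>)"
    unfolding box_ent_def by (rule nn_integral_divide[symmetric]) simp
  finally show ?thesis .
qed

lemma shift_invariant_bind:
  fixes K :: "'c \<Rightarrow> 'd::finite config measure"
  assumes K: "\<And>c. K c \<in> shift_invariant"
  shows "measure_pmf \<mu> \<bind> K \<in> shift_invariant"
proof -
  have c: "K c \<in> config_laws" for c using K shift_invariant_config_laws by auto
  have "distr (measure_pmf \<mu> \<bind> K) (config_space UNIV) (shift z) = measure_pmf \<mu> \<bind> (\<lambda>c. distr (K c) (config_space UNIV) (shift z))" for z
    using config_lawsD[OF c] measurable_shift[of z]
    by (intro distr_bind[where K="PiM (sites UNIV) cnt"] pmf_kernel(1)) (auto simp: config_space_eq)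
  then show ?thesis
    using K config_laws_bind[OF c, of \<mu>] by (simp add: shift_invariant_def config_laws_def config_space_eq)
qed

text \<open>Convexity holds for each box and passes to the supremum; with the entropy density
  written as a limit, the interchange with the integral would need an argument of its own.\<close>

lemma specific_entropy_bind_le:
  fixes K :: "'c \<Rightarrow> 'd::finite config measure"
  assumes K: "\<And>c. K c \<in> shift_invariant"
  shows "specific_entropy m (measure_pmf \<mu> \<bind> K) \<le> (\<integral>\<^sup>+c. specific_entropy m (K c) \<partial>measure_pmf \<mu>)"
proof -
  have c: "K c \<in> config_laws" for c using K shift_invariant_config_laws by auto
  show ?thesis
    unfolding specific_entropy_eq_SUP[OF shift_invariant_bind[OF K]]
  proof (rule SUP_least)
    fix n
    have "box_ent m (measure_pmf \<mu> \<bind> K) n \<le> (\<integral>\<^sup>+c. box_ent m (K c) n \<partial>measure_pmf \<mu>)"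
      by (rule box_ent_bind_le[OF c])
    also have "\<dots> \<le> (\<integral>\<^sup>+c. specific_entropy m (K c) \<partial>measure_pmf \<mu>)"
      by (intro nn_integral_mono) (simp add: specific_entropy_eq_SUP[OF K] SUP_upper)
    finally show "box_ent m (measure_pmf \<mu> \<bind> K) n \<le> (\<integral>\<^sup>+c. specific_entropy m (K c) \<partial>measure_pmf \<mu>)" .
  qed
qed

lemma poisson_process_shift_invariant: "poisson_process m \<in> shift_invariant"
proof -
  let ?M = "\<lambda>kx :: nat \<times> (int^'a). measure_pmf (poisson_law (m (fst kx)))"
  let ?P = "pois_on m (sites UNIV) :: 'a config measure"
  have "distr ?P (PiM (sites UNIV) cnt) (shift z) = ?P" for z :: "int^'a"
  proof -
    define f :: "nat \<times> (int^'a) \<Rightarrow> _" where "f = (\<lambda>(k, x). (k, x + z))"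
    have "distr ?P (PiM (sites UNIV) cnt) (shift z)
       = distr (PiM (sites UNIV) ?M) (PiM (sites UNIV) (\<lambda>i. ?M (f i))) (\<lambda>\<omega>. \<lambda>n\<in>sites UNIV. \<omega> (f n))"
      unfolding pois_on_def
      by (rule distr_cong) (auto intro!: sets_PiM_cong simp: shift_def f_def space_PiM PiE_def extensional_def fun_eq_iff)
    also have "\<dots> = PiM (sites UNIV) (\<lambda>i. ?M (f i))"
      by (rule distr_PiM_reindex) (auto simp: measure_pmf.prob_space_axioms inj_on_def f_def)
    also have "\<dots> = ?P" unfolding pois_on_def by (rule PiM_cong) (auto simp: f_def)
    finally show ?thesis .
  qed
  then show ?thesis
    by (simp add: shift_invariant_def poisson_process_eq config_space_eq prob_pois_on sets_pois_on)
qed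

subsection \<open>Change of the reference process\<close>

text \<open>The chain rule \<open>dP/dR = h * dP/dS\<close>. S is absolutely continuous with respect
  to R, and the converse may fail only on the set where h vanishes, which P does not charge; hence
  both entropies are finite or infinite together. The sign assumption on the integral makes addition
  in \<open>ennreal\<close> agree with addition in the reals.\<close>

lemma rel_entropy_change_reference:
  assumes P: "prob_space P" and R: "prob_space R" and S: "prob_space S"
    and sets: "sets P = sets R" and h[measurable]: "h \<in> borel_measurable R"
    and dens: "S = density R (\<lambda>x. ennreal (h x))"
    and pos: "AE x in P. 0 < h x" and int: "integrable P (\<lambda>x. ln (h x))"
    and c: "0 \<le> (\<integral>x. ln (h x) \<partial>P)"
  shows "rel_entropy P R = ennreal (\<integral>x. ln (h x) \<partial>P) + rel_entropy P S"
proof -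
  interpret P: prob_space P by fact
  interpret R: prob_space R by fact
  interpret S: prob_space S by fact
  have sS: "sets S = sets R" by (simp add: dens)
  have sPS: "sets P = sets S" using sets sS by simp
  have hP[measurable]: "h \<in> borel_measurable P" using h by (simp add: measurable_cong_sets[OF sets refl])
  have ac: "absolutely_continuous R P \<longleftrightarrow> absolutely_continuous S P"
  proof
    assume ac: "absolutely_continuous R P"
    show "absolutely_continuous S P"
      unfolding absolutely_continuous_def
    proof
      fix A assume "A \<in> null_sets S"
      then have A: "A \<in> sets R" "AE x in R. x \<in> A \<longrightarrow> \<not> 0 < h x"
        unfolding dens by (auto simp: null_sets_density_iff)
      have "AE x in P. x \<in> A \<longrightarrow> \<not> 0 < h x"
        using absolutely_continuous_AE[OF sets ac A(2)] .
      then have "AE x in P. x \<notin> A" using pos by eventually_elim auto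
      then show "A \<in> null_sets P" using A(1) sets by (simp add: AE_iff_null_sets)
    qed
  next
    assume ac: "absolutely_continuous S P"
    have "absolutely_continuous R S" unfolding dens by (intro absolutely_continuousI_density) simp
    then show "absolutely_continuous R P" using ac by (auto simp: absolutely_continuous_def)
  qed
  show ?thesis
  proof (cases "absolutely_continuous S P")
    case False
    then show ?thesis using ac by (simp add: rel_entropy_def)
  next
    case True
    define D where "D x = enn2real (RN_deriv R P x)" for x
    define D' where "D' x = enn2real (RN_deriv S P x)" for x
    have [measurable]: "D \<in> borel_measurable R" "D' \<in> borel_measurable S" by (simp_all add: D_def[abs_def] D'_def[abs_def])
    have "borel_measurable S = (borel_measurable R :: ('a \<Rightarrow> real) set)" "borel_measurable P = (borel_measurable R :: ('a \<Rightarrow> real) set)"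
      by (intro measurable_cong_sets[OF sS refl] measurable_cong_sets[OF sets refl])+
    then have [measurable]: "D' \<in> borel_measurable R" "D \<in> borel_measurable P" "D' \<in> borel_measurable P"
      using \<open>D \<in> borel_measurable R\<close> \<open>D' \<in> borel_measurable S\<close> by auto
    note f = rel_entropy_facts[OF P S sPS True, folded D'_def]
    have acR: "absolutely_continuous R P" using ac True by simp
    have "borel_measurable S = (borel_measurable R :: ('a \<Rightarrow> ennreal) set)"
      by (intro measurable_cong_sets[OF sS refl])
    then have RN'[measurable]: "RN_deriv S P \<in> borel_measurable R" using borel_measurable_RN_deriv[of S P] by simp
    have "density R (\<lambda>x. ennreal (h x) * RN_deriv S P x) = density S (RN_deriv S P)"
      by (subst (2) dens, subst density_density_eq) (use RN' in auto)
    also have "\<dots> = P" by (rule f(1))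
    finally have "AE x in R. ennreal (h x) * RN_deriv S P x = RN_deriv R P x"
      using RN' by (intro R.RN_deriv_unique) auto
    from absolutely_continuous_AE[OF sets acR this]
    have rn: "AE x in P. ennreal (h x) * RN_deriv S P x = RN_deriv R P x" .
    have "AE x in P. ln (D x) = ln (h x) + ln (D' x)"
      using rn pos f(2)
    proof eventually_elim
      case (elim x)
      then have "D x = h x * D' x"
        by (auto simp: D_def D'_def enn2real_mult simp flip: elim(1))
      then show ?case using elim by (simp add: ln_mult)
    qed
    note ae = this
    have ed: "entropy_density (exp 1) R P = (\<lambda>x. ln (D x))" "entropy_density (exp 1) S P = (\<lambda>x. ln (D' x))"
      by (auto simp: entropy_density_def D_def D'_def log_def)
    have "integrable P (\<lambda>x. ln (D x)) \<longleftrightarrow> integrable P (\<lambda>x. ln (h x) + ln (D' x))"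
      by (rule integrable_cong_AE) (use ae in auto)
    also have "\<dots> \<longleftrightarrow> integrable P (\<lambda>x. ln (D' x))"
      using int Bochner_Integration.integrable_diff[of P "\<lambda>x. ln (h x) + ln (D' x)" "\<lambda>x. ln (h x)"] by auto
    finally have i: "integrable P (\<lambda>x. ln (D x)) \<longleftrightarrow> integrable P (\<lambda>x. ln (D' x))" .
    show ?thesis
    proof (cases "integrable P (\<lambda>x. ln (D' x))")
      case False
      then show ?thesis using i ed by (simp add: rel_entropy_def)
    next
      case i': True
      have "(\<integral>x. ln (D x) \<partial>P) = (\<integral>x. ln (h x) + ln (D' x) \<partial>P)"
        by (rule integral_cong_AE) (use ae in auto)
      also have "\<dots> = (\<integral>x. ln (h x) \<partial>P) + (\<integral>x. ln (D' x) \<partial>P)" using int i' by simp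
      finally have "KL_divergence (exp 1) R P = (\<integral>x. ln (h x) \<partial>P) + KL_divergence (exp 1) S P"
        by (simp add: KL_divergence_def ed)
      moreover have "0 \<le> KL_divergence (exp 1) S P"
        using i' ed by (intro KL_nonneg'[OF P S sPS True]) simp
      ultimately show ?thesis
        using i i' ed acR True c by (simp add: rel_entropy_def ennreal_plus)
    qed
  qed
qed

text \<open>The target rate s may be 0. Then \<open>0 ^ 0 = 1\<close> turns the factor into
  \<open>exp r\<close> at n = 0 and 0 elsewhere, which is the density of the point mass at
  0.\<close>

lemma poisson_law_density:
  assumes "0 < r" "0 \<le> s"
  shows "measure_pmf (poisson_law s) = density (measure_pmf (poisson_law r)) (\<lambda>n. ennreal (exp (r - s) * (s / r) ^ n))"
proof -
  have "pmf (poisson_law s) n = pmf (poisson_law r) n * (exp (r - s) * (s / r) ^ n)" for n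
  proof (cases "s = 0")
    case True
    then show ?thesis using assms by (cases n) (auto simp: poisson_law_def exp_minus field_simps)
  next
    case False
    then show ?thesis using assms by (simp add: poisson_law_def exp_diff exp_minus field_simps power_divide)
  qed
  then have "(\<lambda>n. ennreal (pmf (poisson_law s) n)) = (\<lambda>n. ennreal (pmf (poisson_law r) n) * ennreal (exp (r - s) * (s / r) ^ n))"
    using assms by (simp add: fun_eq_iff ennreal_mult')
  then show ?thesis
    by (simp add: measure_pmf_eq_density density_density_eq)
qed

lemma pois_on_density:
  assumes J: "finite J" and r: "\<And>j. j \<in> J \<Longrightarrow> 0 < r (fst j)" and s: "\<And>j. j \<in> J \<Longrightarrow> 0 \<le> s (fst j)"
  shows "pois_on s J = density (pois_on r J)
    (\<lambda>\<omega>. ennreal (\<Prod>j\<in>J. exp (r (fst j) - s (fst j)) * (s (fst j) / r (fst j)) ^ \<omega> j))" (is "_ = density _ (\<lambda>\<omega>. ennreal (?h \<omega>))")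
proof -
  define g where "g j n = ennreal (exp (r (fst j) - s (fst j)) * (s (fst j) / r (fst j)) ^ n)" for j :: "nat \<times> 'a" and n
  let ?R = "\<lambda>j. measure_pmf (poisson_law (r (fst j)))" and ?S = "\<lambda>j. measure_pmf (poisson_law (s (fst j)))"
  interpret R: product_sigma_finite ?R
    by unfold_locales
  interpret S: product_sigma_finite ?S
    by unfold_locales
  have hg: "ennreal (?h \<omega>) = (\<Prod>j\<in>J. g j (\<omega> j))" for \<omega>
    unfolding g_def using r s by (intro prod_ennreal[symmetric]) (simp add: less_imp_le)
  have meas: "(\<lambda>\<omega>. \<Prod>j\<in>J. g j (\<omega> j)) \<in> borel_measurable (PiM J ?R)"
    by (intro borel_measurable_prod_ennreal measurable_compose[OF measurable_component_singleton]) auto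
  have "density (PiM J ?R) (\<lambda>\<omega>. \<Prod>j\<in>J. g j (\<omega> j)) = PiM J ?S"
  proof (rule S.PiM_eqI[OF J])
    show "sets (density (PiM J ?R) (\<lambda>\<omega>. \<Prod>j\<in>J. g j (\<omega> j))) = sets (PiM J ?S)"
      by (auto intro!: sets_PiM_cong)
    fix A :: "nat \<times> 'a \<Rightarrow> nat set"
    have A: "(\<Pi>\<^sub>E i\<in>J. A i) \<in> sets (PiM J ?R)" using J by (intro sets_PiM_I_finite) auto
    have "emeasure (density (PiM J ?R) (\<lambda>\<omega>. \<Prod>j\<in>J. g j (\<omega> j))) (Pi\<^sub>E J A)
        = (\<integral>\<^sup>+\<omega>. (\<Prod>j\<in>J. g j (\<omega> j)) * indicator (Pi\<^sub>E J A) \<omega> \<partial>PiM J ?R)"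
      by (rule emeasure_density[OF meas A])
    also have "\<dots> = (\<integral>\<^sup>+\<omega>. (\<Prod>j\<in>J. g j (\<omega> j) * indicator (A j) (\<omega> j)) \<partial>PiM J ?R)"
    proof (rule nn_integral_cong)
      fix \<omega> assume "\<omega> \<in> space (PiM J ?R)"
      then have "indicator (Pi\<^sub>E J A) \<omega> = (\<Prod>j\<in>J. indicator (A j) (\<omega> j) :: ennreal)"
        using J by (auto simp: space_PiM PiE_iff indicator_def prod_zero_iff)
      then show "(\<Prod>j\<in>J. g j (\<omega> j)) * indicator (Pi\<^sub>E J A) \<omega> = (\<Prod>j\<in>J. g j (\<omega> j) * indicator (A j) (\<omega> j))"
        by (simp add: prod.distrib)
    qed
    also have "\<dots> = (\<Prod>j\<in>J. \<integral>\<^sup>+n. g j n * indicator (A j) n \<partial>?R j)"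
      by (rule R.product_nn_integral_prod[OF J]) simp
    also have "\<dots> = (\<Prod>j\<in>J. emeasure (?S j) (A j))"
    proof (rule prod.cong[OF refl])
      fix j assume "j \<in> J"
      then show "(\<integral>\<^sup>+n. g j n * indicator (A j) n \<partial>?R j) = emeasure (?S j) (A j)"
        by (subst poisson_law_density[of "r (fst j)" "s (fst j)"]) (auto simp: r s emeasure_density g_def)
    qed
    finally show "emeasure (density (PiM J ?R) (\<lambda>\<omega>. \<Prod>j\<in>J. g j (\<omega> j))) (Pi\<^sub>E J A) = (\<Prod>j\<in>J. emeasure (?S j) (A j))" .
  qed
  then show ?thesis by (simp add: pois_on_def hg)
qed

text \<open>For positive \<open>q k\<close> and nonnegative \<open>m k\<close> this is the relative
  entropy of the Poisson law of rate \<open>m k\<close> with respect to that of rate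
  \<open>q k\<close>, and it is the k-th summand of \<open>seq_entropy m q\<close>.\<close>

abbreviation ent_term :: "(nat \<Rightarrow> real) \<Rightarrow> (nat \<Rightarrow> real) \<Rightarrow> nat \<Rightarrow> real" where
  "ent_term m q k \<equiv> q k - m k + m k * ln (m k / q k)"

text \<open>The Fenchel-Young inequality: as a function of \<open>m k\<close>, the term has convex
  conjugate \<open>q k * (exp s - 1)\<close>. It comes from \<open>ln x <= x - 1\<close> at
  \<open>x = q k * exp s / m k\<close>.\<close>

lemma ent_term_ge:
  assumes "0 < q k" "0 \<le> m k"
  shows "m k * s + q k * (1 - exp s) \<le> ent_term m q k"
proof (cases "m k = 0")
  case True
  then show ?thesis using assms by (simp add: algebra_simps)
next
  case False
  then have m: "m k > 0" using assms by simp
  define x where "x = q k * exp s / m k"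
  have "x > 0" using m assms by (simp add: x_def)
  then have "ln x \<le> x - 1" by (rule ln_le_minus_one)
  moreover have "ln x = s - ln (m k / q k)" using m assms by (simp add: x_def ln_div ln_mult)
  ultimately have "m k * (s - ln (m k / q k)) \<le> m k * (x - 1)" using m by (intro mult_left_mono) auto
  moreover have "m k * (x - 1) = q k * exp s - m k" using m by (simp add: x_def field_simps)
  ultimately show ?thesis by (simp add: algebra_simps)
qed

lemma ent_term_nonneg: "0 < q k \<Longrightarrow> 0 \<le> m k \<Longrightarrow> 0 \<le> ent_term m q k"
  using ent_term_ge[of q k m 0] by simp

lemma nn_integral_marg:
  assumes "sets P = sets (PiM (sites UNIV) cnt)" "J \<subseteq> sites UNIV" "f \<in> borel_measurable (PiM J cnt)"
  shows "(\<integral>\<^sup>+\<omega>. f \<omega> \<partial>marg J P) = (\<integral>\<^sup>+\<omega>. f (restrict \<omega> J) \<partial>P)"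
  unfolding marg_def using assms by (intro nn_integral_distr measurable_restrict_law) auto

text \<open>The log-density of one finite Poisson product against the other is affine in the counts,
  so its P-mean is fixed by the prescribed intensities and equals the sum of the entropy terms,
  whatever the correlations under P.\<close>

lemma ent_finite_change:
  fixes P :: "'d::finite config measure"
  assumes P: "P \<in> config_laws" and J: "finite J" "J \<subseteq> sites UNIV"
    and q: "\<And>k. k \<ge> 1 \<Longrightarrow> 0 < q k" and m: "\<And>k. k \<ge> 1 \<Longrightarrow> 0 \<le> m k"
    and mean: "\<And>k x. (k, x) \<in> J \<Longrightarrow> (\<integral>\<^sup>+\<omega>. of_nat (\<omega> (k, x)) \<partial>P) = ennreal (m k)"
  shows "ent q J P = ennreal (\<Sum>j\<in>J. ent_term m q (fst j)) + ent m J P"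
proof -
  have qJ: "0 < q (fst j)" and mJ: "0 \<le> m (fst j)" if "j \<in> J" for j
    using that J(2) q m by auto
  define h where "h \<omega> = (\<Prod>j\<in>J. exp (q (fst j) - m (fst j)) * (m (fst j) / q (fst j)) ^ \<omega> j)" for \<omega> :: "'d config"
  have comp: "(\<lambda>\<omega>. \<omega> j) \<in> measurable (PiM J cnt) (count_space UNIV)" if "j \<in> J" for j
    using that by (rule measurable_component_singleton)
  have hm: "h \<in> borel_measurable (PiM J cnt)"
    unfolding h_def[abs_def]
    by (intro borel_measurable_prod borel_measurable_times borel_measurable_const measurable_compose[OF comp]) auto
  have mc: "borel_measurable (marg J P) = (borel_measurable (PiM J cnt) :: (_ \<Rightarrow> real) set)"
      "borel_measurable (pois_on q J) = (borel_measurable (PiM J cnt) :: (_ \<Rightarrow> real) set)"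
      "borel_measurable (marg J P) = (borel_measurable (PiM J cnt) :: (_ \<Rightarrow> ennreal) set)"
    by (rule measurable_cong_sets; simp add: sets_pois_on)+
  have nnm: "(\<integral>\<^sup>+\<omega>. of_nat (\<omega> j) \<partial>marg J P) = ennreal (m (fst j))" if "j \<in> J" for j
  proof -
    have "(\<integral>\<^sup>+\<omega>. of_nat (\<omega> j) \<partial>marg J P) = (\<integral>\<^sup>+\<omega>. of_nat (restrict \<omega> J j) \<partial>P)"
      using comp[OF that] by (intro nn_integral_marg config_lawsD(2)[OF P] J(2) measurable_compose[OF comp[OF that]]) simp
    then show ?thesis using mean[of "fst j" "snd j"] that by simp
  qed
  have realm: "(\<lambda>\<omega>. real (\<omega> j)) \<in> borel_measurable (marg J P)" if "j \<in> J" for j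
    unfolding mc by (rule measurable_compose[OF comp[OF that]]) simp
  have im: "integrable (marg J P) (\<lambda>\<omega>. real (\<omega> j))" "(\<integral>\<omega>. real (\<omega> j) \<partial>marg J P) = m (fst j)" if "j \<in> J" for j
  proof -
    have "(\<integral>\<^sup>+\<omega>. ennreal (real (\<omega> j)) \<partial>marg J P) = ennreal (m (fst j))"
      using nnm[OF that] by (simp add: ennreal_of_nat_eq_real_of_nat)
    then show "integrable (marg J P) (\<lambda>\<omega>. real (\<omega> j))" "(\<integral>\<omega>. real (\<omega> j) \<partial>marg J P) = m (fst j)"
      using realm[OF that] mJ[OF that] by (auto intro!: integrableI_nn_integral_finite simp: integral_eq_nn_integral)
  qed
  \<comment> \<open>A count with mean 0 vanishes almost surely, so the factor
    \<open>0 ^ 0 = 1\<close> keeps the density positive P-almost everywhere even at vanishing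
    rates.\<close>
  have zero: "AE \<omega> in marg J P. m (fst j) = 0 \<longrightarrow> \<omega> j = 0" if "j \<in> J" for j
  proof (cases "m (fst j) = 0")
    case True
    then have "(\<integral>\<^sup>+\<omega>. of_nat (\<omega> j) \<partial>marg J P) = 0" using nnm[OF that] by simp
    moreover have "(\<lambda>\<omega>. of_nat (\<omega> j) :: ennreal) \<in> borel_measurable (marg J P)"
      unfolding mc by (rule measurable_compose[OF comp[OF that]]) simp
    ultimately have "AE \<omega> in marg J P. (of_nat (\<omega> j) :: ennreal) = 0"
      by (subst (asm) nn_integral_0_iff_AE) auto
    then show ?thesis by eventually_elim simp
  qed simp
  have ae: "AE \<omega> in marg J P. \<forall>j\<in>J. m (fst j) = 0 \<longrightarrow> \<omega> j = 0"
    using zero J(1) by (simp add: AE_finite_all)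
  have pos: "AE \<omega> in marg J P. 0 < h \<omega>"
    using ae
  proof eventually_elim
    case (elim \<omega>)
    have "0 < exp (q (fst j) - m (fst j)) * (m (fst j) / q (fst j)) ^ \<omega> j" if "j \<in> J" for j
      using elim that qJ[OF that] mJ[OF that] by (cases "m (fst j) = 0") auto
    then show ?case unfolding h_def by (intro prod_pos) auto
  qed
  have lnh: "AE \<omega> in marg J P. ln (h \<omega>) = (\<Sum>j\<in>J. q (fst j) - m (fst j) + real (\<omega> j) * ln (m (fst j) / q (fst j)))"
    using ae
  proof eventually_elim
    case (elim \<omega>)
    have p: "0 < exp (q (fst j) - m (fst j)) * (m (fst j) / q (fst j)) ^ \<omega> j \<and>
      ln (exp (q (fst j) - m (fst j)) * (m (fst j) / q (fst j)) ^ \<omega> j)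
        = q (fst j) - m (fst j) + real (\<omega> j) * ln (m (fst j) / q (fst j))" if "j \<in> J" for j
    proof (cases "m (fst j) = 0")
      case True
      then show ?thesis using elim that by simp
    next
      case False
      then have "m (fst j) / q (fst j) > 0" using qJ[OF that] mJ[OF that] by simp
      then show ?thesis using False qJ[OF that] by (simp add: ln_mult ln_realpow)
    qed
    have pos': "0 < exp (q (fst j) - m (fst j)) * (m (fst j) / q (fst j)) ^ \<omega> j" if "j \<in> J" for j
      using p[OF that] by blast
    have "ln (h \<omega>) = (\<Sum>j\<in>J. ln (exp (q (fst j) - m (fst j)) * (m (fst j) / q (fst j)) ^ \<omega> j))"
      unfolding h_def by (intro ln_prod J(1)) (rule less_imp_neq[OF pos', symmetric])
    then show ?case using p by simp
  qed
  let ?l = "\<lambda>\<omega>. \<Sum>j\<in>J. q (fst j) - m (fst j) + real (\<omega> j) * ln (m (fst j) / q (fst j))"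
  interpret M: prob_space "marg J P" by (rule prob_marg[OF config_lawsD[OF P] J(2)])
  have il: "integrable (marg J P) ?l" using im by (intro Bochner_Integration.integrable_sum) auto
  have lm: "(\<lambda>\<omega>. ln (h \<omega>)) \<in> borel_measurable (marg J P)" unfolding mc using hm by simp
  have i: "integrable (marg J P) (\<lambda>\<omega>. ln (h \<omega>))"
    using il lnh lm by (subst integrable_cong_AE[of _ _ ?l]) auto
  have "(\<integral>\<omega>. ln (h \<omega>) \<partial>marg J P) = (\<integral>\<omega>. ?l \<omega> \<partial>marg J P)"
    using il lnh lm by (intro integral_cong_AE) auto
  also have "\<dots> = (\<Sum>j\<in>J. ent_term m q (fst j))"
    using im by (subst Bochner_Integration.integral_sum) (auto simp: M.prob_space intro!: sum.cong)
  finally have l: "(\<integral>\<omega>. ln (h \<omega>) \<partial>marg J P) = (\<Sum>j\<in>J. ent_term m q (fst j))" .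
  have "rel_entropy (marg J P) (pois_on q J) = ennreal (\<integral>\<omega>. ln (h \<omega>) \<partial>marg J P) + rel_entropy (marg J P) (pois_on m J)"
  proof (rule rel_entropy_change_reference[OF M.prob_space_axioms prob_pois_on prob_pois_on _ _ _ pos i])
    show "pois_on m J = density (pois_on q J) (\<lambda>\<omega>. ennreal (h \<omega>))"
      unfolding h_def by (intro pois_on_density J(1) qJ mJ)
    show "0 \<le> (\<integral>\<omega>. ln (h \<omega>) \<partial>marg J P)"
      unfolding l using ent_term_nonneg qJ mJ by (intro sum_nonneg) auto
  qed (use hm mc in \<open>auto simp: sets_pois_on\<close>)
  then show ?thesis by (simp add: ent_def l)
qed

lemma SUP_finite_sites:
  fixes g :: "nat \<Rightarrow> ennreal"
  assumes Q: "finite Q"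
  shows "(SUP J\<in>{J. finite J \<and> J \<subseteq> sites Q}. \<Sum>j\<in>J. g (fst j)) = of_nat (card Q) * (\<Sum>\<^sub>\<infinity>k\<in>{1..}. g k)"
proof (rule antisym)
  have sup: "(\<Sum>\<^sub>\<infinity>k\<in>{1..}. g k) = (SUP F\<in>{F. finite F \<and> F \<subseteq> {1..}}. sum g F)"
    by (rule nonneg_infsum_complete) simp
  have prod: "(\<Sum>j\<in>K \<times> Q. g (fst j)) = of_nat (card Q) * sum g K" for K
    by (simp add: sum.cartesian_product[symmetric] case_prod_unfold sum_distrib_left)
       (simp add: sum.cartesian_product' sum_distrib_left)
  show "(SUP J\<in>{J. finite J \<and> J \<subseteq> sites Q}. \<Sum>j\<in>J. g (fst j)) \<le> of_nat (card Q) * (\<Sum>\<^sub>\<infinity>k\<in>{1..}. g k)"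
  proof (rule SUP_least)
    fix J assume J: "J \<in> {J. finite J \<and> J \<subseteq> sites Q}"
    have "(\<Sum>j\<in>J. g (fst j)) \<le> (\<Sum>j\<in>fst ` J \<times> Q. g (fst j))"
      using J Q by (intro sum_mono2) force+
    also have "\<dots> = of_nat (card Q) * sum g (fst ` J)" by (rule prod)
    also have "\<dots> \<le> of_nat (card Q) * (\<Sum>\<^sub>\<infinity>k\<in>{1..}. g k)"
      unfolding sup using J by (intro mult_left_mono SUP_upper) auto
    finally show "(\<Sum>j\<in>J. g (fst j)) \<le> of_nat (card Q) * (\<Sum>\<^sub>\<infinity>k\<in>{1..}. g k)" .
  qed
  show "of_nat (card Q) * (\<Sum>\<^sub>\<infinity>k\<in>{1..}. g k) \<le> (SUP J\<in>{J. finite J \<and> J \<subseteq> sites Q}. \<Sum>j\<in>J. g (fst j))"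
    unfolding sup SUP_mult_left_ennreal
  proof (rule SUP_least)
    fix K assume K: "K \<in> {F. finite F \<and> F \<subseteq> {1::nat..}}"
    show "of_nat (card Q) * sum g K \<le> (SUP J\<in>{J. finite J \<and> J \<subseteq> sites Q}. \<Sum>j\<in>J. g (fst j))"
      unfolding prod[symmetric] using K Q by (intro SUP_upper) auto
  qed
qed

lemma mean_site:
  fixes P :: "'d::finite config measure"
  assumes P: "P \<in> shift_invariant" and k: "k \<ge> 1"
  shows "(\<integral>\<^sup>+\<omega>. of_nat (\<omega> (k, x)) \<partial>P) = (\<integral>\<^sup>+\<omega>. N_mark {0} k \<omega> \<partial>P)"
proof -
  have Pc: "P \<in> config_laws" using P shift_invariant_config_laws by auto
  have m: "(\<lambda>\<omega>. of_nat (\<omega> (k, y)) :: ennreal) \<in> borel_measurable (config_space UNIV)" for y :: "int^'d"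
    unfolding config_space_eq using k by (intro measurable_compose[OF measurable_component_singleton]) auto
  have s: "shift x \<in> measurable P (config_space UNIV)"
    using measurable_shift[of x] by (simp only: measurable_cong_sets[OF config_lawsD(2)[OF Pc] refl] config_space_eq)
  have "(\<integral>\<^sup>+\<omega>. of_nat (\<omega> (k, 0)) \<partial>P) = (\<integral>\<^sup>+\<omega>. of_nat (\<omega> (k, 0)) \<partial>distr P (config_space UNIV) (shift x))"
    using P by (simp add: shift_invariant_def)
  also have "\<dots> = (\<integral>\<^sup>+\<omega>. of_nat (shift x \<omega> (k, 0)) \<partial>P)"
    by (rule nn_integral_distr[OF s]) (simp add: m)
  finally show ?thesis by (simp add: shift_def N_mark_def)
qed

lemma ent_box_change:
  fixes P :: "'d::finite config measure"
  assumes P: "P \<in> shift_invariant" and Q: "finite Q"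
    and q: "\<And>k. k \<ge> 1 \<Longrightarrow> 0 < q k" and m: "\<And>k. k \<ge> 1 \<Longrightarrow> 0 \<le> m k"
    and mean: "\<And>k. k \<ge> 1 \<Longrightarrow> (\<integral>\<^sup>+\<omega>. N_mark {0} k \<omega> \<partial>P) = ennreal (m k)"
  shows "ent q (sites Q) P = of_nat (card Q) * seq_entropy m q + ent m (sites Q) P"
proof -
  have Pc: "P \<in> config_laws" using P shift_invariant_config_laws by auto
  let ?F = "{J. finite J \<and> J \<subseteq> sites Q}"
  let ?s = "\<lambda>J :: (nat \<times> (int^'d)) set. \<Sum>j\<in>J. ennreal (ent_term m q (fst j))"
  have "ent q (sites Q) P = (SUP J\<in>?F. ent q J P)" by (intro ent_eq_SUP Pc) auto
  also have "\<dots> = (SUP J\<in>?F. ?s J + ent m J P)"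
  proof (rule SUP_cong[OF refl])
    fix J assume J: "J \<in> ?F"
    then have Js: "J \<subseteq> sites UNIV" by auto
    have "ent q J P = ennreal (\<Sum>j\<in>J. ent_term m q (fst j)) + ent m J P"
    proof (rule ent_finite_change[OF Pc _ Js q m])
      fix k x assume "(k, x) \<in> J"
      then have "k \<ge> 1" using J by auto
      then show "(\<integral>\<^sup>+\<omega>. of_nat (\<omega> (k, x)) \<partial>P) = ennreal (m k)" by (simp add: mean_site[OF P] mean)
    qed (use J in auto)
    also have "ennreal (\<Sum>j\<in>J. ent_term m q (fst j)) = ?s J"
      using J q m ent_term_nonneg by (intro sum_ennreal[symmetric]) (auto simp: subset_iff)
    finally show "ent q J P = ?s J + ent m J P" .
  qed
  \<comment> \<open>A supremum of sums splits because the index sets are directed under union and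
    both summands grow with J: the first by nonnegativity of its terms, the second by monotonicity
    of \<open>ent\<close>.\<close>
  also have "\<dots> = (SUP J\<in>?F. ?s J) + (SUP J\<in>?F. ent m J P)"
  proof (rule SUP_add_directed_ennreal)
    fix I J assume IJ: "I \<in> ?F" "J \<in> ?F"
    show "\<exists>K\<in>?F. ?s I + ent m J P \<le> ?s K + ent m K P"
    proof (rule bexI[of _ "I \<union> J"])
      show "?s I + ent m J P \<le> ?s (I \<union> J) + ent m (I \<union> J) P"
        using IJ by (intro add_mono sum_mono2 ent_mono[OF Pc]) auto
    qed (use IJ in auto)
  qed
  also have "(SUP J\<in>?F. ent m J P) = ent m (sites Q) P" by (intro ent_eq_SUP[symmetric] Pc) auto
  also have "(SUP J\<in>?F. ?s J) = of_nat (card Q) * seq_entropy m q"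
    unfolding seq_entropy_def by (rule SUP_finite_sites[OF Q])
  finally show ?thesis .
qed

text \<open>After division by the volume the additive term is the same for every box, so it leaves
  the supremum; the identity holds box by box, without asymptotics.\<close>

lemma specific_entropy_change:
  fixes P :: "'d::finite config measure"
  assumes P: "P \<in> shift_invariant"
    and q: "\<And>k. k \<ge> 1 \<Longrightarrow> 0 < q k" and m: "\<And>k. k \<ge> 1 \<Longrightarrow> 0 \<le> m k"
    and mean: "\<And>k. k \<ge> 1 \<Longrightarrow> (\<integral>\<^sup>+\<omega>. N_mark {0} k \<omega> \<partial>P) = ennreal (m k)"
  shows "specific_entropy q P = seq_entropy m q + specific_entropy m P"
proof -
  have "box_ent q P n = seq_entropy m q + box_ent m P n" for n
  proof -
    let ?c = "of_nat (card (lattice_box n :: (int^'d) set)) :: ennreal"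
    have c: "?c \<noteq> 0" "?c \<noteq> top" by (auto simp: card_lattice_box simp del: of_nat_power)
    have "box_ent q P n = (seq_entropy m q * ?c + ent m (sites (lattice_box n)) P) / ?c"
      unfolding box_ent_def by (subst ent_box_change[OF P finite_lattice_box q m mean]) (auto simp: mult.commute)
    also have "\<dots> = seq_entropy m q * ?c / ?c + box_ent m P n"
      by (simp add: box_ent_def add_divide_distrib_ennreal)
    finally show ?thesis using c by (simp add: ennreal_mult_divide_eq)
  qed
  then show ?thesis
    by (simp add: specific_entropy_eq_SUP[OF P] ennreal_SUP_add_right)
qed

section \<open>Moments and entropy density of the Poisson process\<close>

lemma poisson_moment_sums:
  fixes r :: real
  shows "(\<lambda>n. real n * (r ^ n / fact n)) sums (r * exp r)"
    and "(\<lambda>n. (real n)\<^sup>2 * (r ^ n / fact n)) sums ((r\<^sup>2 + r) * exp r)"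
proof -
  have e: "(\<lambda>n. r ^ n / fact n) sums exp r" using exp_converges[of r] by (simp add: field_simps)
  have "(\<lambda>n. real (Suc n) * (r ^ Suc n / fact (Suc n))) = (\<lambda>n. r * (r ^ n / fact n))"
    by (auto simp: fun_eq_iff field_simps simp del: of_nat_Suc)
  then have "(\<lambda>n. real (Suc n) * (r ^ Suc n / fact (Suc n))) sums (r * exp r)"
    using sums_mult[OF e, of r] by simp
  then show 1: "(\<lambda>n. real n * (r ^ n / fact n)) sums (r * exp r)"
    by (subst (asm) sums_Suc_iff) simp
  have "(\<lambda>n. (real (Suc n))\<^sup>2 * (r ^ Suc n / fact (Suc n))) = (\<lambda>n. r * (real n * (r ^ n / fact n) + r ^ n / fact n))"
  proof
    fix n
    have "(real (Suc n))\<^sup>2 * (r ^ Suc n / fact (Suc n)) = real (Suc n) * (r * (r ^ n / fact n))"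
      by (simp add: power2_eq_square field_simps del: of_nat_Suc)
    also have "\<dots> = r * (real n * (r ^ n / fact n) + r ^ n / fact n)" by (simp add: algebra_simps add_divide_distrib)
    finally show "(real (Suc n))\<^sup>2 * (r ^ Suc n / fact (Suc n)) = r * (real n * (r ^ n / fact n) + r ^ n / fact n)" .
  qed
  then have "(\<lambda>n. (real (Suc n))\<^sup>2 * (r ^ Suc n / fact (Suc n))) sums (r * (r * exp r + exp r))"
    using sums_mult[OF sums_add[OF 1 e], of r] by simp
  then have "(\<lambda>n. (real n)\<^sup>2 * (r ^ n / fact n)) sums (r * (r * exp r + exp r))"
    by (subst (asm) sums_Suc_iff) simp
  then show "(\<lambda>n. (real n)\<^sup>2 * (r ^ n / fact n)) sums ((r\<^sup>2 + r) * exp r)"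
    by (simp add: power2_eq_square algebra_simps)
qed

lemma nn_integral_poisson_law:
  assumes "0 \<le> r"
  shows "(\<integral>\<^sup>+n. of_nat n \<partial>measure_pmf (poisson_law r)) = ennreal r"
    and "(\<integral>\<^sup>+n. of_nat n * of_nat n \<partial>measure_pmf (poisson_law r)) = ennreal (r\<^sup>2 + r)"
proof -
  have gen: "(\<integral>\<^sup>+n. ennreal (f n) \<partial>measure_pmf (poisson_law r)) = ennreal (L * exp (- r))"
    if r: "r > 0" and f: "\<And>n. 0 \<le> f n" "(\<lambda>n. f n * (r ^ n / fact n)) sums L" for f L
  proof -
    have "(\<integral>\<^sup>+n. ennreal (f n) \<partial>measure_pmf (poisson_law r)) = (\<Sum>n. ennreal (f n * (r ^ n / fact n) * exp (- r)))"
      using r f(1) by (simp add: nn_integral_measure_pmf nn_integral_count_space_nat poisson_law_def ennreal_mult'[symmetric] mult_ac)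
    also have "\<dots> = ennreal (L * exp (- r))"
      using r f by (intro suminf_ennreal_eq sums_mult2) auto
    finally show ?thesis .
  qed
  show "(\<integral>\<^sup>+n. of_nat n \<partial>measure_pmf (poisson_law r)) = ennreal r"
  proof (cases "r = 0")
    case False
    then have "(\<integral>\<^sup>+n. ennreal (real n) \<partial>measure_pmf (poisson_law r)) = ennreal (r * exp r * exp (- r))"
      using assms by (intro gen poisson_moment_sums) auto
    then show ?thesis by (simp add: ennreal_of_nat_eq_real_of_nat mult.assoc flip: exp_add)
  qed (simp add: poisson_law_def)
  show "(\<integral>\<^sup>+n. of_nat n * of_nat n \<partial>measure_pmf (poisson_law r)) = ennreal (r\<^sup>2 + r)"
  proof (cases "r = 0")
    case False
    then have "(\<integral>\<^sup>+n. ennreal ((real n)\<^sup>2) \<partial>measure_pmf (poisson_law r)) = ennreal ((r\<^sup>2 + r) * exp r * exp (- r))"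
      using assms by (intro gen poisson_moment_sums) auto
    then show ?thesis by (simp add: ennreal_of_nat_eq_real_of_nat ennreal_mult'[symmetric] power2_eq_square mult.assoc flip: exp_add)
  qed (simp add: poisson_law_def)
qed

lemma nn_integral_pois_on_site:
  assumes "i \<in> K"
  shows "(\<integral>\<^sup>+\<omega>. f (\<omega> i) \<partial>pois_on m K) = (\<integral>\<^sup>+n. f n \<partial>measure_pmf (poisson_law (m (fst i))))"
proof -
  let ?M = "\<lambda>kx. measure_pmf (poisson_law (m (fst kx)))"
  have "(\<integral>\<^sup>+n. f n \<partial>?M i) = (\<integral>\<^sup>+n. f n \<partial>distr (PiM K ?M) (?M i) (\<lambda>\<omega>. \<omega> i))"
    using assms by (subst distr_PiM_component) (auto simp: measure_pmf.prob_space_axioms)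
  also have "\<dots> = (\<integral>\<^sup>+\<omega>. f (\<omega> i) \<partial>PiM K ?M)"
    using assms by (intro nn_integral_distr) (auto intro: measurable_component_singleton)
  finally show ?thesis by (simp add: pois_on_def)
qed

lemma poisson_process_mean:
  assumes "k \<ge> 1" "0 \<le> m k"
  shows "(\<integral>\<^sup>+\<omega>. N_mark {0} k \<omega> \<partial>(poisson_process m :: 'd::finite config measure)) = ennreal (m k)"
proof -
  have "(\<integral>\<^sup>+\<omega>. of_nat (\<omega> (k, 0 :: int^'d)) \<partial>pois_on m (sites UNIV)) = ennreal (m k)"
    using assms by (subst nn_integral_pois_on_site[where f=of_nat]) (auto simp: nn_integral_poisson_law)
  then show ?thesis by (simp add: poisson_process_eq N_mark_def)
qed

lemma specific_entropy_poisson_process_self: "specific_entropy m (poisson_process m :: 'd::finite config measure) = 0"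
  unfolding specific_entropy_eq_SUP[OF poisson_process_shift_invariant] box_ent_def
  by (simp add: ent_def poisson_process_eq marg_pois_on Sigma_mono rel_entropy_self prob_pois_on)

lemma specific_entropy_poisson_process:
  assumes q: "\<And>k. k \<ge> 1 \<Longrightarrow> 0 < q k" and m: "\<And>k. k \<ge> 1 \<Longrightarrow> 0 \<le> m k"
  shows "specific_entropy q (poisson_process m :: 'd::finite config measure) = seq_entropy m q"
  using specific_entropy_change[OF poisson_process_shift_invariant q m poisson_process_mean[OF _ m]]
  by (simp add: specific_entropy_poisson_process_self)

subsection \<open>Convexity and monotonicity of \<open>\<phi>\<close>\<close>

lemma infsum_nat_ennreal:
  fixes f :: "nat \<Rightarrow> ennreal"
  shows "infsum f UNIV = (\<Sum>n. f n)"
proof -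
  have "f summable_on UNIV" by (rule nonneg_summable_on_complete) simp
  from has_sum_imp_sums[OF has_sum_infsum[OF this]] show ?thesis by (rule sums_unique)
qed

text \<open>Reduces unordered sums over countable sets to series, from which measurability and the
  interchange with the integral are inherited.\<close>

lemma infsum_ennreal_enumerate:
  fixes f :: "'a \<Rightarrow> ennreal"
  assumes "countable I" "infinite I"
  shows "infsum f I = (\<Sum>n. f (from_nat_into I n))"
  using infsum_reindex_bij_betw[OF bij_betw_from_nat_into[OF assms], of f] by (simp add: infsum_nat_ennreal)

lemma borel_measurable_infsum_ennreal:
  fixes f :: "'i \<Rightarrow> 'a \<Rightarrow> ennreal"
  assumes I: "countable I" and f: "\<And>i. i \<in> I \<Longrightarrow> f i \<in> borel_measurable M"
  shows "(\<lambda>x. \<Sum>\<^sub>\<infinity>i\<in>I. f i x) \<in> borel_measurable M"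
proof (cases "finite I")
  case True
  then show ?thesis using f by (simp add: borel_measurable_sum)
next
  case False
  then show ?thesis
    using f from_nat_into[OF infinite_imp_nonempty[OF False]]
    by (simp add: infsum_ennreal_enumerate[OF I] borel_measurable_suminf)
qed

lemma nn_integral_infsum:
  fixes f :: "'i \<Rightarrow> 'a \<Rightarrow> ennreal"
  assumes I: "countable I" and f: "\<And>i. i \<in> I \<Longrightarrow> f i \<in> borel_measurable M"
  shows "(\<integral>\<^sup>+x. (\<Sum>\<^sub>\<infinity>i\<in>I. f i x) \<partial>M) = (\<Sum>\<^sub>\<infinity>i\<in>I. \<integral>\<^sup>+x. f i x \<partial>M)"
proof (cases "finite I")
  case True
  then show ?thesis using f by (simp add: nn_integral_sum)
next
  case False
  then show ?thesis
    using f from_nat_into[OF infinite_imp_nonempty[OF False]]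
    by (simp add: infsum_ennreal_enumerate[OF I] nn_integral_suminf)
qed

section \<open>Competitors in the variational problem and their mixtures\<close>

definition cost ::
  "(nat \<Rightarrow> (int^'d::finite) set) \<Rightarrow> (int^'d \<Rightarrow> real) \<Rightarrow> (nat \<Rightarrow> real) \<Rightarrow> nat \<Rightarrow> 'd config measure \<Rightarrow> ennreal" where
  "cost G v q a P = specific_entropy q P + (\<integral>\<^sup>+\<omega>. Phi G v {0} UNIV \<omega> \<partial>P)
     + 2 * ennreal (vbar v) * of_nat a * (\<integral>\<^sup>+\<omega>. N_particles {0} \<omega> \<partial>P) + ennreal (vbar v) * of_nat a ^ 2"

definition admissible :: "(nat \<Rightarrow> real) \<Rightarrow> nat pmf \<Rightarrow> (nat \<Rightarrow> 'd::finite config measure) \<Rightarrow> bool" where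
  "admissible m \<psi> P \<longleftrightarrow> range P \<subseteq> shift_invariant \<and>
     (\<forall>k\<ge>1. (\<integral>\<^sup>+a. (\<integral>\<^sup>+\<omega>. N_mark {0} k \<omega> \<partial>P a) \<partial>measure_pmf \<psi>) = ennreal (m k))"

text \<open>As integrals against a \<open>pmf\<close>, the weighted sums become accessible to
  binding and conditioning, and indices of weight 0 become null.\<close>

lemma suminf_pmf_eq_nn_integral: "(\<Sum>a. ennreal (pmf \<psi> a) * f a) = (\<integral>\<^sup>+a. f a \<partial>measure_pmf \<psi>)"
  by (simp add: nn_integral_measure_pmf nn_integral_count_space_nat)

lemma varphi_eq:
  "varphi G v q m \<psi> = Inf {(\<integral>\<^sup>+a. cost G v q a (P a) \<partial>measure_pmf \<psi>) | P. admissible m \<psi> P}"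
  unfolding varphi_def suminf_pmf_eq_nn_integral cost_def[symmetric] admissible_def ..

lemma varphi_le: "admissible m \<psi> P \<Longrightarrow> varphi G v q m \<psi> \<le> (\<integral>\<^sup>+a. cost G v q a (P a) \<partial>measure_pmf \<psi>)"
  unfolding varphi_eq by (rule Inf_lower) auto

lemma le_varphi:
  "(\<And>P. admissible m \<psi> P \<Longrightarrow> c \<le> (\<integral>\<^sup>+a. cost G v q a (P a) \<partial>measure_pmf \<psi>)) \<Longrightarrow> c \<le> varphi G v q m \<psi>"
  unfolding varphi_eq by (rule Inf_greatest) auto

lemma measurable_count_site:
  "(k, x) \<in> K \<Longrightarrow> (\<lambda>\<omega>. of_nat (\<omega> (k, x)) :: ennreal) \<in> borel_measurable (PiM K cnt)"
  by (rule measurable_compose[OF measurable_component_singleton]) auto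

lemma N_mark_0: "N_mark {0} k \<omega> = of_nat (\<omega> (k, 0))"
  by (simp add: N_mark_def)

lemma measurable_N_mark: "k \<ge> 1 \<Longrightarrow> N_mark {0} k \<in> borel_measurable (PiM (sites UNIV) cnt)"
  unfolding N_mark_0[abs_def] by (rule measurable_count_site) auto

lemma measurable_N_particles: "N_particles {0} \<in> borel_measurable (PiM (sites UNIV) cnt)"
  unfolding N_particles_def[abs_def]
  by (intro borel_measurable_infsum_ennreal borel_measurable_times_ennreal borel_measurable_const measurable_N_mark) auto

lemma measurable_Phi: "Phi G v \<Lambda> \<Lambda>' \<in> borel_measurable (PiM (sites UNIV) cnt)"
proof -
  have "(\<lambda>\<omega>. case i of (x, y) \<Rightarrow> \<Sum>\<^sub>\<infinity>(k, l)\<in>{1..} \<times> {1..}. of_nat (\<omega> (k, x)) * of_nat (\<omega> (l, y)) * ennreal (mark_interaction v x y (G k) (G l)))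
    \<in> borel_measurable (PiM (sites UNIV) cnt)" for i
    unfolding case_prod_unfold
    by (intro borel_measurable_infsum_ennreal borel_measurable_times_ennreal borel_measurable_const measurable_count_site) auto
  then show ?thesis
    unfolding Phi_def[abs_def] by (intro borel_measurable_infsum_ennreal) auto
qed

lemma nn_integral_config_bind:
  fixes K :: "'c \<Rightarrow> 'd::finite config measure"
  assumes K: "\<And>c. K c \<in> shift_invariant" and f: "f \<in> borel_measurable (PiM (sites UNIV) cnt)"
  shows "(\<integral>\<^sup>+\<omega>. f \<omega> \<partial>(measure_pmf \<mu> \<bind> K)) = (\<integral>\<^sup>+c. \<integral>\<^sup>+\<omega>. f \<omega> \<partial>K c \<partial>measure_pmf \<mu>)"
proof -
  have "K c \<in> config_laws" for c using K shift_invariant_config_laws by auto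
  note c = config_lawsD[OF this]
  show ?thesis by (rule nn_integral_bind[OF f pmf_kernel(1)[OF c]])
qed

text \<open>The entropy is convex; all other terms of the cost are affine in the law for fixed
  a.\<close>

lemma cost_bind_le:
  fixes K :: "'c \<Rightarrow> 'd::finite config measure"
  assumes K: "\<And>c. K c \<in> shift_invariant"
  shows "cost G v q a (measure_pmf \<mu> \<bind> K) \<le> (\<integral>\<^sup>+c. cost G v q a (K c) \<partial>measure_pmf \<mu>)"
proof -
  have "(\<integral>\<^sup>+c. cost G v q a (K c) \<partial>measure_pmf \<mu>) = (\<integral>\<^sup>+c. specific_entropy q (K c) \<partial>measure_pmf \<mu>)
     + (\<integral>\<^sup>+c. \<integral>\<^sup>+\<omega>. Phi G v {0} UNIV \<omega> \<partial>K c \<partial>measure_pmf \<mu>)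
     + 2 * ennreal (vbar v) * of_nat a * (\<integral>\<^sup>+c. \<integral>\<^sup>+\<omega>. N_particles {0} \<omega> \<partial>K c \<partial>measure_pmf \<mu>) + ennreal (vbar v) * of_nat a ^ 2"
    unfolding cost_def by (simp add: nn_integral_add nn_integral_cmult measure_pmf.emeasure_space_1)
  then show ?thesis
    unfolding cost_def nn_integral_config_bind[OF K measurable_Phi] nn_integral_config_bind[OF K measurable_N_particles]
    by (auto intro!: add_mono specific_entropy_bind_le[OF K])
qed

text \<open>Disintegration of \<mu> along \<alpha>. For a outside the support of \<psi> the
  conditional law is unspecified, but such a carry no weight.\<close>

lemma nn_integral_disintegrate:
  fixes \<mu> :: "'c pmf"
  assumes \<psi>: "map_pmf \<alpha> \<mu> = \<psi>"
  shows "(\<integral>\<^sup>+a. (\<integral>\<^sup>+c. F a c \<partial>cond_pmf \<mu> {c. \<alpha> c = a}) \<partial>\<psi>) = (\<integral>\<^sup>+c. F (\<alpha> c) c \<partial>\<mu>)"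
proof -
  have ne: "set_pmf \<mu> \<inter> {c. \<alpha> c = a} \<noteq> {}" if "a \<in> set_pmf \<psi>" for a using that \<psi> by auto
  have b: "bind_pmf \<psi> (\<lambda>a. cond_pmf \<mu> {c. \<alpha> c = a}) = \<mu>"
    using \<psi> by (intro bind_cond_pmf_cancel) (auto simp: vimage_def eq_commute intro!: arg_cong[where f="measure _"])
  have "(\<integral>\<^sup>+c. F (\<alpha> c) c \<partial>\<mu>) = (\<integral>\<^sup>+a. (\<integral>\<^sup>+c. F (\<alpha> c) c \<partial>cond_pmf \<mu> {c. \<alpha> c = a}) \<partial>\<psi>)"
    by (subst b[symmetric]) (rule nn_integral_bind_pmf)
  also have "\<dots> = (\<integral>\<^sup>+a. (\<integral>\<^sup>+c. F a c \<partial>cond_pmf \<mu> {c. \<alpha> c = a}) \<partial>\<psi>)"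
    by (intro nn_integral_cong_AE AE_pmfI) (auto simp: set_cond_pmf[OF ne] intro!: nn_integral_cong_AE AE_pmfI)
  finally show ?thesis by simp
qed

text \<open>Averaging over the fibres of \<open>\<alpha>\<close> does not increase the cost, so \<open>\<phi>\<close> may be bounded by competitors
  that depend on more than the number \<open>a\<close>.\<close>

lemma varphi_le_mixture:
  fixes \<mu> :: "'c pmf" and R :: "'c \<Rightarrow> 'd::finite config measure"
  assumes \<psi>: "map_pmf \<alpha> \<mu> = \<psi>" and R: "\<And>c. R c \<in> shift_invariant"
    and m: "\<And>k. k \<ge> 1 \<Longrightarrow> (\<integral>\<^sup>+c. (\<integral>\<^sup>+\<omega>. N_mark {0} k \<omega> \<partial>R c) \<partial>\<mu>) = ennreal (m k)"
  shows "varphi G v q m \<psi> \<le> (\<integral>\<^sup>+c. cost G v q (\<alpha> c) (R c) \<partial>\<mu>)"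
proof -
  define P where "P a = measure_pmf (cond_pmf \<mu> {c. \<alpha> c = a}) \<bind> R" for a
  have P: "P a \<in> shift_invariant" for a unfolding P_def by (rule shift_invariant_bind[OF R])
  have "admissible m \<psi> P"
    unfolding admissible_def
  proof (intro conjI allI impI)
    fix k :: nat assume k: "1 \<le> k"
    have "(\<integral>\<^sup>+a. \<integral>\<^sup>+\<omega>. N_mark {0} k \<omega> \<partial>P a \<partial>\<psi>) = (\<integral>\<^sup>+a. \<integral>\<^sup>+c. \<integral>\<^sup>+\<omega>. N_mark {0} k \<omega> \<partial>R c \<partial>cond_pmf \<mu> {c. \<alpha> c = a} \<partial>\<psi>)"
      unfolding P_def by (simp add: nn_integral_config_bind[OF R measurable_N_mark[OF k]])
    also have "\<dots> = ennreal (m k)" by (simp add: nn_integral_disintegrate[OF \<psi>] m[OF k])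
    finally show "(\<integral>\<^sup>+a. \<integral>\<^sup>+\<omega>. N_mark {0} k \<omega> \<partial>P a \<partial>\<psi>) = ennreal (m k)" .
  qed (use P in auto)
  then have "varphi G v q m \<psi> \<le> (\<integral>\<^sup>+a. cost G v q a (P a) \<partial>\<psi>)" by (rule varphi_le)
  also have "\<dots> \<le> (\<integral>\<^sup>+a. \<integral>\<^sup>+c. cost G v q a (R c) \<partial>cond_pmf \<mu> {c. \<alpha> c = a} \<partial>\<psi>)"
    unfolding P_def by (intro nn_integral_mono cost_bind_le R)
  also have "\<dots> = (\<integral>\<^sup>+c. cost G v q (\<alpha> c) (R c) \<partial>\<mu>)" by (rule nn_integral_disintegrate[OF \<psi>])
  finally show ?thesis .
qed

text \<open>Allows a bound against every competitor to be turned into one against the infimum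
  without nearly optimal choices. A weight t that is neither 0 nor infinite can be divided out in
  \<open>ennreal\<close>.\<close>

lemma le_add_mult_Inf:
  fixes z c t :: ennreal
  assumes t: "0 < t" "t < top" and le: "\<And>x. x \<in> A \<Longrightarrow> z \<le> c + t * x"
  shows "z \<le> c + t * Inf A"
proof (cases "c = top")
  case False
  have "(z - c) / t \<le> Inf A"
  proof (rule Inf_greatest)
    fix x assume "x \<in> A"
    then have "z - c \<le> t * x" using le False by (simp add: ennreal_minus_le_iff)
    then have "(z - c) / t \<le> (t * x) / t" by (rule divide_right_mono_ennreal)
    then show "(z - c) / t \<le> x" using t by (simp add: mult.commute[of t] ennreal_mult_divide_eq)
  qed
  then have "t * ((z - c) / t) \<le> t * Inf A" by (rule mult_left_mono) simp
  then have "z - c \<le> t * Inf A" using t by (simp add: ennreal_times_divide ennreal_mult_divide_eq mult.commute[of t])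
  then show ?thesis using False by (simp add: ennreal_minus_le_iff)
qed simp

lemma le_mult_add_mult_Inf:
  fixes z s t :: ennreal
  assumes "0 < s" "s < top" "0 < t" "t < top" "\<And>x y. x \<in> A \<Longrightarrow> y \<in> B \<Longrightarrow> z \<le> s * x + t * y"
  shows "z \<le> s * Inf A + t * Inf B"
proof (rule le_add_mult_Inf[OF assms(3,4)])
  fix y assume "y \<in> B"
  then have "z \<le> t * y + s * Inf A"
    using assms by (intro le_add_mult_Inf[OF assms(1,2)]) (auto simp: add.commute)
  then show "z \<le> s * Inf A + t * y" by (simp add: add.commute)
qed

text \<open>A coin of bias t decides which of two competing families is used. The endpoints are
  treated apart: a weight 0 cannot be divided out, and there \<psi> simply coincides with
  \<open>\<psi>2\<close> or \<open>\<psi>1\<close>.\<close>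

lemma varphi_convex:
  fixes G :: "nat \<Rightarrow> (int^'d::finite) set"
  assumes m: "\<And>k. k \<ge> 1 \<Longrightarrow> 0 \<le> m1 k" "\<And>k. k \<ge> 1 \<Longrightarrow> 0 \<le> m2 k" and t: "0 \<le> t" "t \<le> 1"
    and \<psi>: "\<And>a. pmf \<psi> a = t * pmf \<psi>1 a + (1 - t) * pmf \<psi>2 a"
  shows "varphi G v q (\<lambda>k. t * m1 k + (1 - t) * m2 k) \<psi>
    \<le> ennreal t * varphi G v q m1 \<psi>1 + ennreal (1 - t) * varphi G v q m2 \<psi>2"
proof -
  consider "t = 0" | "t = 1" | "0 < t" "t < 1" using t by force
  then show ?thesis
  proof cases
    case 1
    then have "\<psi> = \<psi>2" using \<psi> by (intro pmf_eqI) simp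
    then show ?thesis using 1 by simp
  next
    case 2
    then have "\<psi> = \<psi>1" using \<psi> by (intro pmf_eqI) simp
    then show ?thesis using 2 by simp
  next
    case 3
    show ?thesis
      unfolding varphi_eq[of G v q m1] varphi_eq[of G v q m2]
    proof (rule le_mult_add_mult_Inf)
      fix x y
      assume "x \<in> {\<integral>\<^sup>+a. cost G v q a (P a) \<partial>\<psi>1 |P. admissible m1 \<psi>1 P}"
        and "y \<in> {\<integral>\<^sup>+a. cost G v q a (P a) \<partial>\<psi>2 |P. admissible m2 \<psi>2 P}"
      then obtain P1 P2 where P1: "admissible m1 \<psi>1 P1" "x = (\<integral>\<^sup>+a. cost G v q a (P1 a) \<partial>\<psi>1)"
        and P2: "admissible m2 \<psi>2 P2" "y = (\<integral>\<^sup>+a. cost G v q a (P2 a) \<partial>\<psi>2)" by auto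
      \<comment> \<open>The joint law of the coin and of a. Its second marginal is \<psi>, so the
        competitor depending on both can be averaged down to one depending on a.\<close>
      define \<mu> where "\<mu> = bind_pmf (bernoulli_pmf t) (\<lambda>b. map_pmf (Pair b) (if b then \<psi>1 else \<psi>2))"
      define R where "R = (\<lambda>(b, a). if b then P1 a else P2 a)"
      have int: "(\<integral>\<^sup>+c. F c \<partial>\<mu>) = ennreal t * (\<integral>\<^sup>+a. F (True, a) \<partial>\<psi>1) + ennreal (1 - t) * (\<integral>\<^sup>+a. F (False, a) \<partial>\<psi>2)" for F
        using t by (simp add: \<mu>_def mult.commute)
      have "map_pmf snd \<mu> = bind_pmf (bernoulli_pmf t) (\<lambda>b. if b then \<psi>1 else \<psi>2)"
        by (auto simp: \<mu>_def map_bind_pmf pmf.map_comp comp_def intro!: bind_pmf_cong)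
      also have "\<dots> = \<psi>" using t by (intro pmf_eqI) (simp add: pmf_bind \<psi> mult.commute)
      finally have map: "map_pmf snd \<mu> = \<psi>" .
      have "varphi G v q (\<lambda>k. t * m1 k + (1 - t) * m2 k) \<psi> \<le> (\<integral>\<^sup>+c. cost G v q (snd c) (R c) \<partial>\<mu>)"
      proof (rule varphi_le_mixture[OF map])
        show "R c \<in> shift_invariant" for c using P1 P2 by (auto simp: R_def admissible_def split: prod.split)
        show "(\<integral>\<^sup>+c. \<integral>\<^sup>+\<omega>. N_mark {0} k \<omega> \<partial>R c \<partial>\<mu>) = ennreal (t * m1 k + (1 - t) * m2 k)" if k: "k \<ge> 1" for k
          using P1(1) P2(1) k m[OF k] t by (simp add: int R_def admissible_def ennreal_mult' ennreal_plus)
      qed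
      also have "\<dots> = ennreal t * x + ennreal (1 - t) * y" by (simp add: int R_def P1 P2)
      finally show "varphi G v q (\<lambda>k. t * m1 k + (1 - t) * m2 k) \<psi> \<le> ennreal t * x + ennreal (1 - t) * y" .
    qed (use 3 in auto)
  qed
qed

text \<open>The quantile functions of \<open>\<psi>\<close> and \<open>\<psi>'\<close> at a common uniform variable realise the monotone coupling.\<close>

definition quantile :: "nat pmf \<Rightarrow> real \<Rightarrow> nat" where
  "quantile \<psi> u = (if u < 1 then LEAST a. u \<le> measure_pmf.prob \<psi> {..a} else 0)"

lemma quantile_measurable: "quantile \<psi> \<in> measurable borel (count_space UNIV)"
  unfolding quantile_def[abs_def] by measurable

lemma ex_quantile: "u < 1 \<Longrightarrow> \<exists>a. u \<le> measure_pmf.prob \<psi> {..a}" for \<psi> :: "nat pmf"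
proof -
  assume u: "u < 1"
  have "(\<lambda>n. measure_pmf.prob \<psi> {..n}) \<longlonglongrightarrow> measure_pmf.prob \<psi> (\<Union>n. {..n})"
    by (rule measure_pmf.finite_Lim_measure_incseq) (auto simp: incseq_def)
  moreover have "(\<Union>n::nat. {..n}) = UNIV" by auto
  ultimately have "(\<lambda>n. measure_pmf.prob \<psi> {..n}) \<longlonglongrightarrow> 1" by simp
  then have "eventually (\<lambda>n. u < measure_pmf.prob \<psi> {..n}) sequentially" using u by (rule order_tendstoD)
  then show ?thesis by (auto simp: eventually_sequentially intro: less_imp_le)
qed

text \<open>The Galois connection between quantile and distribution function. It yields both the law
  of the quantile and the order between the quantiles of stochastically ordered laws.\<close>

lemma quantile_le_iff: "u < 1 \<Longrightarrow> quantile \<psi> u \<le> a \<longleftrightarrow> u \<le> measure_pmf.prob \<psi> {..a}"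
proof -
  assume u: "u < 1"
  have 1: "u \<le> measure_pmf.prob \<psi> {..quantile \<psi> u}"
    unfolding quantile_def using u LeastI_ex[OF ex_quantile[OF u]] by simp
  show ?thesis
  proof
    assume "quantile \<psi> u \<le> a"
    then have "measure_pmf.prob \<psi> {..quantile \<psi> u} \<le> measure_pmf.prob \<psi> {..a}"
      by (intro measure_pmf.finite_measure_mono) auto
    then show "u \<le> measure_pmf.prob \<psi> {..a}" using 1 by simp
  next
    assume "u \<le> measure_pmf.prob \<psi> {..a}"
    then show "quantile \<psi> u \<le> a" unfolding quantile_def using u by (simp add: Least_le)
  qed
qed

abbreviation unif01 :: "real measure" where "unif01 \<equiv> uniform_measure lborel {0<..<1}"

lemma prob_unif01: "prob_space unif01"
  by (rule prob_space_uniform_measure) auto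

lemma prob_quantile: "measure unif01 {u. quantile \<psi> u \<le> a} = measure_pmf.prob \<psi> {..a}"
proof -
  let ?p = "measure_pmf.prob \<psi> {..a}"
  have p: "0 \<le> ?p" "?p \<le> 1" by auto
  have s: "{u. quantile \<psi> u \<le> a} \<in> sets borel"
    using quantile_measurable[of \<psi>] by (auto dest!: measurable_sets[of _ _ _ "{..a}"] simp: vimage_def)
  \<comment> \<open>On the open unit interval the event is \<open>(0, F a]\<close>, except when
    \<open>F a = 1\<close>, where the right endpoint is missing.\<close>
  have "{0<..<1} \<inter> {u. quantile \<psi> u \<le> a} = (if ?p < 1 then {0<..?p} else {0<..<1})"
    using p by (auto simp: quantile_le_iff)
  then have "measure lborel ({0<..<1} \<inter> {u. quantile \<psi> u \<le> a}) = ?p"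
    using p(1) antisym[OF p(2)] by (cases "?p < 1") (simp_all add: not_less)
  then show ?thesis using s by (subst measure_uniform_measure) auto
qed

lemma pmf_nat_eqI:
  fixes \<psi> \<psi>' :: "nat pmf"
  assumes "\<And>a. measure_pmf.prob \<psi> {..a} = measure_pmf.prob \<psi>' {..a}"
  shows "\<psi> = \<psi>'"
proof (rule pmf_eqI)
  fix a
  have *: "pmf p a = measure_pmf.prob p {..a} - (if a = 0 then 0 else measure_pmf.prob p {..a - 1})" for p :: "nat pmf"
  proof (cases a)
    case 0
    then show ?thesis by (simp add: measure_pmf_single)
  next
    case (Suc b)
    have "measure_pmf.prob p ({..b} \<union> {Suc b}) = measure_pmf.prob p {..b} + measure_pmf.prob p {Suc b}"
      by (rule measure_pmf.finite_measure_Union) auto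
    moreover have "{..b} \<union> {Suc b} = {..Suc b}" by auto
    ultimately show ?thesis using Suc by (simp add: measure_pmf_single)
  qed
  show "pmf \<psi> a = pmf \<psi>' a" unfolding * assms ..
qed

text \<open>The coupling is the joint law of the two quantiles under the uniform law, where the
  first never exceeds the second. What remains is to present this law as a
  \<open>pmf\<close>.\<close>

lemma monotone_coupling:
  assumes "\<psi> \<le>\<^sub>s\<^sub>t \<psi>'"
  shows "\<exists>\<pi>. map_pmf fst \<pi> = \<psi> \<and> map_pmf snd \<pi> = \<psi>' \<and> (\<forall>(a, b)\<in>set_pmf \<pi>. a \<le> b)"
proof -
  have F: "measure_pmf.prob \<psi>' {..a} \<le> measure_pmf.prob \<psi> {..a}" for a
  proof -
    have *: "measure_pmf.prob p {..a} = 1 - measure_pmf.prob p {Suc a..}" for p :: "nat pmf"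
    proof -
      have "{..a} = UNIV - {Suc a..}" by auto
      then show ?thesis using measure_pmf.prob_compl[of "{Suc a..}" p] by simp
    qed
    show ?thesis using assms unfolding * stoch_le_def by simp
  qed
  have le: "quantile \<psi> u \<le> quantile \<psi>' u" for u
  proof (cases "u < 1")
    case True
    then have "u \<le> measure_pmf.prob \<psi>' {..quantile \<psi>' u}" using quantile_le_iff by blast
    then have "u \<le> measure_pmf.prob \<psi> {..quantile \<psi>' u}" using F order_trans by blast
    then show ?thesis using True quantile_le_iff by blast
  qed (simp add: quantile_def)
  interpret U: prob_space unif01 by (rule prob_unif01)
  define h where "h u = (quantile \<psi> u, quantile \<psi>' u)" for u
  have h: "h \<in> measurable unif01 (count_space UNIV)"
    unfolding h_def[abs_def]
    using measurable_Pair[OF quantile_measurable[of \<psi>] quantile_measurable[of \<psi>']]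
    by (simp add: pair_measure_countable cong: measurable_cong_sets)
  define N where "N = distr unif01 (count_space UNIV) h"
  interpret N: prob_space N unfolding N_def by (rule U.prob_space_distr[OF h])
  \<comment> \<open>The space of pairs is countable, so the points of mass 0 form a null set; this
    is the discreteness required of a \<open>pmf\<close>.\<close>
  have null: "emeasure N {c. measure N {c} = 0} = 0"
  proof -
    have "emeasure N {c. measure N {c} = 0} = (\<integral>\<^sup>+c. emeasure N {c} \<partial>count_space {c. measure N {c} = 0})"
      by (rule emeasure_countable_singleton) (auto simp: N_def)
    also have "\<dots> = 0" by (auto simp: N.emeasure_eq_measure nn_integral_0_iff_AE AE_count_space)
    finally show ?thesis .
  qed
  have "AE c in N. measure N {c} \<noteq> 0"
    by (rule AE_I[of _ _ "{c. measure N {c} = 0}"]) (auto simp: null N_def[symmetric], simp add: N_def)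
  then have N_pmf: "measure_pmf (Abs_pmf N) = N"
    by (intro Abs_pmf_inverse) (auto simp: N.prob_space_axioms, simp add: N_def)
  define \<pi> where "\<pi> = Abs_pmf N"
  have prob: "measure_pmf.prob \<pi> A = measure unif01 (h -` A)" for A
    unfolding \<pi>_def N_pmf by (subst N_def, subst measure_distr[OF h]) auto
  have "map_pmf fst \<pi> = \<psi>"
  proof (rule pmf_nat_eqI)
    fix a
    have "h -` fst -` {..a} = {u. quantile \<psi> u \<le> a}" by (auto simp: h_def)
    then show "measure_pmf.prob (map_pmf fst \<pi>) {..a} = measure_pmf.prob \<psi> {..a}"
      by (simp only: measure_map_pmf prob prob_quantile)
  qed
  moreover have "map_pmf snd \<pi> = \<psi>'"
  proof (rule pmf_nat_eqI)
    fix a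
    have "h -` snd -` {..a} = {u. quantile \<psi>' u \<le> a}" by (auto simp: h_def)
    then show "measure_pmf.prob (map_pmf snd \<pi>) {..a} = measure_pmf.prob \<psi>' {..a}"
      by (simp only: measure_map_pmf prob prob_quantile)
  qed
  \<comment> \<open>An atom of positive mass has a nonempty preimage, so it is a pair of quantiles
    at a common u.\<close>
  moreover have "a \<le> b" if "(a, b) \<in> set_pmf \<pi>" for a b
  proof -
    have "measure_pmf.prob \<pi> {(a, b)} \<noteq> 0" using that by (simp add: measure_pmf_single set_pmf_iff)
    then have "h -` {(a, b)} \<noteq> {}" unfolding prob by (metis measure_empty)
    then show ?thesis using le by (auto simp: h_def)
  qed
  ultimately show ?thesis by (intro exI[of _ \<pi>]) auto
qed

lemma cost_mono: "a \<le> b \<Longrightarrow> cost G v q a P \<le> cost G v q b P"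
  unfolding cost_def by (intro add_mono mult_mono power_mono order_refl) auto

text \<open>The law chosen for the larger number b is kept while its cost is charged at the smaller
  number a. The intensity constraint sees only the second coordinate of the coupling, and the cost
  increases with a.\<close>

lemma varphi_mono:
  fixes G :: "nat \<Rightarrow> (int^'d::finite) set"
  assumes st: "\<psi> \<le>\<^sub>s\<^sub>t \<psi>'"
  shows "varphi G v q m \<psi> \<le> varphi G v q m \<psi>'"
proof (rule le_varphi)
  fix P :: "nat \<Rightarrow> 'd config measure" assume P: "admissible m \<psi>' P"
  obtain \<pi> where \<pi>: "map_pmf fst \<pi> = \<psi>" "map_pmf snd \<pi> = \<psi>'" "\<And>a b. (a, b) \<in> set_pmf \<pi> \<Longrightarrow> a \<le> b"
    using monotone_coupling[OF st] by blast
  have int: "(\<integral>\<^sup>+c. F (snd c) \<partial>\<pi>) = (\<integral>\<^sup>+b. F b \<partial>\<psi>')" for F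
    by (simp flip: \<pi>(2))
  have "varphi G v q m \<psi> \<le> (\<integral>\<^sup>+c. cost G v q (fst c) (P (snd c)) \<partial>\<pi>)"
  proof (rule varphi_le_mixture[OF \<pi>(1)])
    show "P (snd c) \<in> shift_invariant" for c using P by (auto simp: admissible_def)
    show "(\<integral>\<^sup>+c. \<integral>\<^sup>+\<omega>. N_mark {0} k \<omega> \<partial>P (snd c) \<partial>\<pi>) = ennreal (m k)" if "k \<ge> 1" for k
      using P that int[of "\<lambda>b. \<integral>\<^sup>+\<omega>. N_mark {0} k \<omega> \<partial>P b"] by (simp add: admissible_def)
  qed
  also have "\<dots> \<le> (\<integral>\<^sup>+c. cost G v q (snd c) (P (snd c)) \<partial>\<pi>)"
    using \<pi>(3) by (intro nn_integral_mono_AE AE_pmfI cost_mono) auto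
  also have "\<dots> = (\<integral>\<^sup>+a. cost G v q a (P a) \<partial>\<psi>')" by (rule int)
  finally show "varphi G v q m \<psi> \<le> (\<integral>\<^sup>+a. cost G v q a (P a) \<partial>\<psi>')" .
qed

subsection \<open>The mean interaction energy\<close>

text \<open>With sums read as integrals over counting measure, every exchange of summation with
  summation or expectation is an instance of Tonelli's theorem.\<close>

lemma infsum_eq_nn_integral_count_space:
  fixes f :: "'a \<Rightarrow> ennreal"
  assumes "countable A"
  shows "infsum f A = (\<integral>\<^sup>+x. f x \<partial>count_space A)"
proof (cases "finite A")
  case True
  then show ?thesis by (simp add: nn_integral_count_space_finite)
next
  case False
  show ?thesis
    unfolding infsum_ennreal_enumerate[OF assms False]
    by (simp add: nn_integral_bij_count_space[OF bij_betw_from_nat_into[OF assms False], symmetric] nn_integral_count_space_nat)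
qed

lemma borel_measurable_nn_integral_count_space:
  fixes f :: "'i \<Rightarrow> 'a \<Rightarrow> ennreal"
  assumes "countable I" "\<And>i. i \<in> I \<Longrightarrow> f i \<in> borel_measurable M"
  shows "(\<lambda>x. \<integral>\<^sup>+i. f i x \<partial>count_space I) \<in> borel_measurable M"
  using borel_measurable_infsum_ennreal[OF assms] by (simp add: infsum_eq_nn_integral_count_space[OF assms(1)])

lemma nn_integral_count_space_Sigma:
  "(\<integral>\<^sup>+p. f p \<partial>count_space (Sigma A B)) = (\<integral>\<^sup>+a. \<integral>\<^sup>+b. f (a, b) \<partial>count_space (B a) \<partial>count_space A)"
proof -
  have "(\<integral>\<^sup>+p. f p \<partial>count_space (Sigma A B)) = (\<integral>\<^sup>+p. f p * indicator (Sigma A B) p \<partial>count_space UNIV)"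
    by (rule nn_integral_count_space_indicator) simp
  also have "\<dots> = (\<integral>\<^sup>+a. \<integral>\<^sup>+b. f (a, b) * indicator (Sigma A B) (a, b) \<partial>count_space UNIV \<partial>count_space UNIV)"
    by (rule nn_integral_fst_count_space[symmetric])
  also have "\<dots> = (\<integral>\<^sup>+a. (\<integral>\<^sup>+b. f (a, b) * indicator (B a) b \<partial>count_space UNIV) * indicator A a \<partial>count_space UNIV)"
    by (subst nn_integral_multc[symmetric]) (auto intro!: nn_integral_cong split: split_indicator)
  also have "\<dots> = (\<integral>\<^sup>+a. (\<integral>\<^sup>+b. f (a, b) * indicator (B a) b \<partial>count_space UNIV) \<partial>count_space A)"
    by (rule nn_integral_count_space_indicator[symmetric]) simp
  also have "\<dots> = (\<integral>\<^sup>+a. \<integral>\<^sup>+b. f (a, b) \<partial>count_space (B a) \<partial>count_space A)"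
    by (intro nn_integral_cong nn_integral_count_space_indicator[symmetric]) simp
  finally show ?thesis .
qed

lemma nn_integral_count_space_swap:
  assumes "countable A"
  shows "(\<integral>\<^sup>+a. \<integral>\<^sup>+b. f a b \<partial>count_space B \<partial>count_space A) = (\<integral>\<^sup>+b. \<integral>\<^sup>+a. f a b \<partial>count_space A \<partial>count_space B)"
  using assms by (intro nn_integral_count_space_nn_integral[symmetric]) auto

lemma has_sum_imp_infsum_ennreal:
  assumes "(f has_sum S) A" "\<And>x. x \<in> A \<Longrightarrow> 0 \<le> f x"
  shows "(\<Sum>\<^sub>\<infinity>x\<in>A. ennreal (f x)) = ennreal S"
proof -
  have s: "f summable_on A" using assms(1) by (auto simp: summable_on_def)
  have "ennreal (infsum f A) = (\<Sum>\<^sub>\<infinity>x\<in>A. ennreal (f x))"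
    by (subst infsum_nonneg_is_SUPREMUM_ennreal[OF s])
       (auto simp: assms nonneg_infsum_complete sum_ennreal subset_iff intro!: SUP_cong)
  then show ?thesis using infsumI[OF assms(1)] by simp
qed

locale marked_lattice =
  fixes G :: "nat \<Rightarrow> (int^'d::finite) set" and v :: "int^'d \<Rightarrow> real"
  assumes card_mark: "\<And>k. k \<ge> 1 \<Longrightarrow> card (G k) = k"
    and v_nonneg: "\<And>x. 0 \<le> v x" and v_sym: "\<And>x. v (- x) = v x" and v_supp: "finite {x. v x \<noteq> 0}"
begin

text \<open>A pair of a mark size and a position relative to the site that carries the mark.\<close>

definition particles :: "(nat \<times> (int^'d)) set" where "particles = Sigma {1..} G"

lemma finite_mark: "k \<ge> 1 \<Longrightarrow> finite (G k)"
  using card_mark by (intro card_ge_0_finite) auto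

lemma countable_particles: "countable particles"
  by simp

lemma nn_integral_particles:
  "(\<integral>\<^sup>+p. f p \<partial>count_space particles) = (\<integral>\<^sup>+k. (\<Sum>i\<in>G k. f (k, i)) \<partial>count_space {1..})"
  unfolding particles_def nn_integral_count_space_Sigma
  by (intro nn_integral_cong) (simp add: nn_integral_count_space_finite finite_mark)

lemma vbar_nonneg: "0 \<le> vbar v"
  unfolding vbar_def using v_nonneg by (intro sum_nonneg) auto

lemma nn_integral_v: "(\<integral>\<^sup>+z. ennreal (v z) \<partial>count_space UNIV) = ennreal (vbar v)"
  unfolding vbar_def using v_supp v_nonneg
  by (subst nn_integral_count_space'[where A="{x. v x \<noteq> 0}"]) (auto simp: sum_ennreal)

lemma nn_integral_lattice_reindex:
  "(\<integral>\<^sup>+z. f (c + z) \<partial>count_space UNIV) = (\<integral>\<^sup>+z. f z \<partial>count_space (UNIV :: (int^'d) set))"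
  using nn_integral_bij_count_space[of "\<lambda>z. c + z" UNIV UNIV f]
  by (auto simp: bij_betw_def inj_on_def surj_def intro!: exI[of _ "_ - c"])

text \<open>Each mark interaction is resolved into interactions of single particles, which is the
  form in which two-point functions appear.\<close>

lemma Phi_eq:
  "Phi G v {0} UNIV \<omega> = (\<integral>\<^sup>+y. \<integral>\<^sup>+p. \<integral>\<^sup>+r. of_nat (\<omega> (fst p, 0)) * of_nat (\<omega> (fst r, y)) * ennreal (v (snd p - y - snd r))
     \<partial>count_space particles \<partial>count_space particles \<partial>count_space UNIV)"
proof -
  let ?t = "\<lambda>y k l. of_nat (\<omega> (k, 0)) * of_nat (\<omega> (l, y)) * ennreal (mark_interaction v 0 y (G k) (G l))"
  have inner: "(\<Sum>\<^sub>\<infinity>(k, l)\<in>{1..} \<times> {1..}. ?t y k l) = (\<integral>\<^sup>+k. \<integral>\<^sup>+l. ?t y k l \<partial>count_space {1..} \<partial>count_space {1..})" for y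
    by (simp only: infsum_eq_nn_integral_count_space[OF countableI_type] nn_integral_count_space_Sigma prod.case)
  have "Phi G v {0} UNIV \<omega> = (\<Sum>\<^sub>\<infinity>p\<in>{0 :: int^'d} \<times> UNIV. \<Sum>\<^sub>\<infinity>(k, l)\<in>{1..} \<times> {1..}. ?t (snd p) k l)"
    unfolding Phi_def by (intro infsum_cong) auto
  also have "\<dots> = (\<integral>\<^sup>+x. \<integral>\<^sup>+y. \<integral>\<^sup>+k. \<integral>\<^sup>+l. ?t y k l \<partial>count_space {1..} \<partial>count_space {1..} \<partial>count_space UNIV \<partial>count_space {0 :: int^'d})"
    unfolding inner by (simp only: infsum_eq_nn_integral_count_space[OF countableI_type] nn_integral_count_space_Sigma snd_conv)
  also have "\<dots> = (\<integral>\<^sup>+y. \<integral>\<^sup>+k. \<integral>\<^sup>+l. ?t y k l \<partial>count_space {1..} \<partial>count_space {1..} \<partial>count_space UNIV)"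
    by (subst nn_integral_count_space_finite) simp_all
  also have "\<dots> = (\<integral>\<^sup>+y. \<integral>\<^sup>+p. \<integral>\<^sup>+r. of_nat (\<omega> (fst p, 0)) * of_nat (\<omega> (fst r, y)) * ennreal (v (snd p - y - snd r))
     \<partial>count_space particles \<partial>count_space particles \<partial>count_space UNIV)"
  proof (rule nn_integral_cong)
    fix y :: "int^'d"
    let ?s = "\<lambda>k i l j. of_nat (\<omega> (k, 0)) * of_nat (\<omega> (l, y)) * ennreal (v (i - y - j))"
    have t: "?t y k l = (\<Sum>i\<in>G k. \<Sum>j\<in>G l. ?s k i l j)" for k l
    proof -
      have "ennreal (mark_interaction v 0 y (G k) (G l)) = (\<Sum>i\<in>G k. \<Sum>j\<in>G l. ennreal (v (i - y - j)))"
        by (simp add: mark_interaction_def v_nonneg sum_nonneg)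
      then show ?thesis by (simp only: sum_distrib_left)
    qed
    have "(\<integral>\<^sup>+k. \<integral>\<^sup>+l. ?t y k l \<partial>count_space {1..} \<partial>count_space {1..})
       = (\<integral>\<^sup>+k. (\<Sum>i\<in>G k. \<integral>\<^sup>+l. (\<Sum>j\<in>G l. ?s k i l j) \<partial>count_space {1..}) \<partial>count_space {1..})"
      unfolding t by (intro nn_integral_cong nn_integral_sum) simp
    then show "(\<integral>\<^sup>+k. \<integral>\<^sup>+l. ?t y k l \<partial>count_space {1..} \<partial>count_space {1..})
      = (\<integral>\<^sup>+p. \<integral>\<^sup>+r. ?s (fst p) (snd p) (fst r) (snd r) \<partial>count_space particles \<partial>count_space particles)"
      unfolding nn_integral_particles by simp
  qed
  finally show ?thesis .
qed

definition pair_mean :: "'d config measure \<Rightarrow> nat \<Rightarrow> nat \<Rightarrow> int^'d \<Rightarrow> int^'d \<Rightarrow> ennreal" where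
  "pair_mean P k l x y = (\<integral>\<^sup>+\<omega>. of_nat (\<omega> (k, x)) * of_nat (\<omega> (l, y)) \<partial>P)"

lemma measurable_site:
  assumes "P \<in> config_laws" "p \<in> particles"
  shows "(\<lambda>\<omega>. of_nat (\<omega> (fst p, x)) :: ennreal) \<in> borel_measurable P"
  using assms measurable_count_site[of "fst p" x "sites UNIV"]
  by (auto simp: particles_def measurable_cong_sets[OF config_lawsD(2)])

lemma nn_integral_double_particles:
  assumes P: "P \<in> config_laws"
  shows "(\<integral>\<^sup>+\<omega>. \<integral>\<^sup>+p. \<integral>\<^sup>+r. of_nat (\<omega> (fst p, x p)) * of_nat (\<omega> (fst r, y r)) * w (p, r) \<partial>count_space particles \<partial>count_space particles \<partial>P)
    = (\<integral>\<^sup>+p. \<integral>\<^sup>+r. pair_mean P (fst p) (fst r) (x p) (y r) * w (p, r) \<partial>count_space particles \<partial>count_space particles)"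
proof -
  note ms = measurable_site[OF P]
  let ?D = "count_space particles"
  let ?g = "\<lambda>\<omega> p r. of_nat (\<omega> (fst p, x p)) * of_nat (\<omega> (fst r, y r)) * w (p, r) :: ennreal"
  have m: "(\<lambda>\<omega>. ?g \<omega> p r) \<in> borel_measurable P" if "p \<in> particles" "r \<in> particles" for p r
    using that by (intro borel_measurable_times_ennreal borel_measurable_const ms)
  have "(\<integral>\<^sup>+\<omega>. \<integral>\<^sup>+p. \<integral>\<^sup>+r. ?g \<omega> p r \<partial>?D \<partial>?D \<partial>P) = (\<integral>\<^sup>+p. \<integral>\<^sup>+\<omega>. \<integral>\<^sup>+r. ?g \<omega> p r \<partial>?D \<partial>P \<partial>?D)"
    by (intro nn_integral_count_space_nn_integral borel_measurable_nn_integral_count_space countable_particles m)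
  also have "\<dots> = (\<integral>\<^sup>+p. \<integral>\<^sup>+r. \<integral>\<^sup>+\<omega>. ?g \<omega> p r \<partial>P \<partial>?D \<partial>?D)"
    by (intro nn_integral_cong nn_integral_count_space_nn_integral countable_particles m) simp_all
  also have "\<dots> = (\<integral>\<^sup>+p. \<integral>\<^sup>+r. pair_mean P (fst p) (fst r) (x p) (y r) * w (p, r) \<partial>?D \<partial>?D)"
    unfolding pair_mean_def
    by (intro nn_integral_cong nn_integral_multc borel_measurable_times_ennreal ms) simp_all
  finally show ?thesis .
qed

lemma nn_integral_Phi:
  assumes P: "P \<in> config_laws"
  shows "(\<integral>\<^sup>+\<omega>. Phi G v {0} UNIV \<omega> \<partial>P) = (\<integral>\<^sup>+y. \<integral>\<^sup>+p. \<integral>\<^sup>+r. pair_mean P (fst p) (fst r) 0 y * ennreal (v (snd p - y - snd r))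
     \<partial>count_space particles \<partial>count_space particles \<partial>count_space UNIV)"
proof -
  note ms = measurable_site[OF P]
  have "(\<integral>\<^sup>+\<omega>. Phi G v {0} UNIV \<omega> \<partial>P) = (\<integral>\<^sup>+y. \<integral>\<^sup>+\<omega>. \<integral>\<^sup>+p. \<integral>\<^sup>+r. of_nat (\<omega> (fst p, 0)) * of_nat (\<omega> (fst r, y)) * ennreal (v (snd p - y - snd r))
     \<partial>count_space particles \<partial>count_space particles \<partial>P \<partial>count_space UNIV)"
    unfolding Phi_eq
    by (intro nn_integral_count_space_nn_integral countableI_type
       borel_measurable_nn_integral_count_space countable_particles borel_measurable_times_ennreal borel_measurable_const ms)
  also have "\<dots> = (\<integral>\<^sup>+y. \<integral>\<^sup>+p. \<integral>\<^sup>+r. pair_mean P (fst p) (fst r) 0 y * ennreal (v (snd p - y - snd r))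
     \<partial>count_space particles \<partial>count_space particles \<partial>count_space UNIV)"
    by (rule nn_integral_cong)
       (use nn_integral_double_particles[OF P, where x="\<lambda>_. 0" and y="\<lambda>_. y" and w="\<lambda>(p, r). ennreal (v (snd p - y - snd r))" for y] in simp)
  finally show ?thesis .
qed

text \<open>A mark of size k contributes \<open>card (G k) = k\<close> particles; this is where the
  weight k in the mass constraint comes from.\<close>

lemma nn_integral_particles_mass:
  assumes "((\<lambda>k. real k * m k) has_sum \<rho>) {1..}" "\<And>k. k \<ge> 1 \<Longrightarrow> 0 \<le> m k"
  shows "(\<integral>\<^sup>+p. ennreal (m (fst p)) \<partial>count_space particles) = ennreal \<rho>"
proof -
  have "(\<integral>\<^sup>+p. ennreal (m (fst p)) \<partial>count_space particles) = (\<integral>\<^sup>+k. ennreal (real k * m k) \<partial>count_space {1..})"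
    unfolding nn_integral_particles
    by (intro nn_integral_cong) (simp add: card_mark ennreal_mult'' assms ennreal_of_nat_eq_real_of_nat)
  also have "\<dots> = (\<Sum>\<^sub>\<infinity>k\<in>{1..}. ennreal (real k * m k))" by (simp add: infsum_eq_nn_integral_count_space)
  also have "\<dots> = ennreal \<rho>" using assms by (intro has_sum_imp_infsum_ennreal) auto
  finally show ?thesis .
qed

text \<open>Different coordinates are independent; a coordinate paired with itself has the Poisson
  second moment, which exceeds the squared mean by the rate.\<close>

lemma pair_mean_poisson_le:
  assumes m: "\<And>k. k \<ge> 1 \<Longrightarrow> 0 \<le> m k" and k: "k \<ge> 1" "l \<ge> 1"
  shows "pair_mean (poisson_process m) k l 0 y \<le> ennreal (m k) * ennreal (m l) + (if y = 0 \<and> k = l then ennreal (m k) else 0)"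
proof -
  let ?P = "pois_on m (sites UNIV) :: 'd config measure"
  interpret prob_space ?P by (rule prob_pois_on)
  have mean: "(\<integral>\<^sup>+\<omega>. of_nat (\<omega> (k', x)) \<partial>?P) = ennreal (m k')" if "k' \<ge> 1" for k' and x :: "int^'d"
    using that m by (subst nn_integral_pois_on_site[where f=of_nat]) (auto simp: nn_integral_poisson_law)
  show ?thesis
  proof (cases "y = 0 \<and> k = l")
    case True
    have "(\<integral>\<^sup>+\<omega>. of_nat (\<omega> (k, 0)) * of_nat (\<omega> (k, 0)) \<partial>?P) = ennreal ((m k)\<^sup>2 + m k)"
      using k m by (subst nn_integral_pois_on_site[where f="\<lambda>n. of_nat n * of_nat n"]) (auto simp: nn_integral_poisson_law)
    then show ?thesis
      using True k m by (simp add: pair_mean_def poisson_process_eq ennreal_mult' power2_eq_square)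
  next
    case False
    let ?i = "(k, 0)" and ?j = "(l, y)"
    have ne: "?i \<noteq> ?j" using False by auto
    have iv: "indep_vars (\<lambda>_. borel) (\<lambda>i \<omega>. of_nat (\<omega> i) :: ennreal) {?i, ?j}"
    proof -
      have "indep_vars (\<lambda>kx. measure_pmf (poisson_law (m (fst kx)))) (\<lambda>i \<omega>. \<omega> i) {?i, ?j}"
        by (rule indep_vars_subset[OF indep_vars_pois_on]) (use k in auto)
      from indep_vars_compose[OF this, of "\<lambda>_. of_nat :: nat \<Rightarrow> ennreal" "\<lambda>_. borel"]
      show ?thesis by (simp add: comp_def)
    qed
    have "(\<integral>\<^sup>+\<omega>. (\<Prod>i\<in>{?i, ?j}. of_nat (\<omega> i)) \<partial>?P) = (\<Prod>i\<in>{?i, ?j}. \<integral>\<^sup>+\<omega>. of_nat (\<omega> i) \<partial>?P)"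
      by (rule indep_vars_nn_integral[OF _ iv]) auto
    then have "(\<integral>\<^sup>+\<omega>. of_nat (\<omega> ?i) * of_nat (\<omega> ?j) \<partial>?P) = ennreal (m k) * ennreal (m l)"
      using ne mean k by simp
    then show ?thesis using False by (simp add: pair_mean_def poisson_process_eq)
  qed
qed

text \<open>The product part of the pair means gives \<open>vbar v * \<rho>\<^sup>2\<close>, since
  summing v over the relative position yields \<open>vbar v\<close> for every pair of particles. The
  diagonal excess of the Poisson second moment gives the term linear in \<rho>.\<close>

lemma Phi_poisson_process_le:
  assumes m: "\<And>k. k \<ge> 1 \<Longrightarrow> 0 \<le> m k" and \<rho>: "((\<lambda>k. real k * m k) has_sum \<rho>) {1..}"
  shows "(\<integral>\<^sup>+\<omega>. Phi G v {0} UNIV \<omega> \<partial>(poisson_process m)) \<le> ennreal (vbar v * (\<rho>\<^sup>2 + \<rho>))"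
proof -
  let ?D = "count_space particles" and ?U = "count_space (UNIV :: (int^'d) set)"
  have \<rho>0: "0 \<le> \<rho>" using \<rho> m by (intro has_sum_nonneg[OF \<rho>]) auto
  note mass = nn_integral_particles_mass[OF \<rho> m]
  have Pc: "poisson_process m \<in> config_laws" using poisson_process_shift_invariant shift_invariant_config_laws by auto
  let ?d = "\<lambda>(y :: int^'d) (p :: nat \<times> (int^'d)) (r :: nat \<times> (int^'d)). if y = 0 \<and> fst p = fst r then ennreal (m (fst p)) else 0 :: ennreal"
  have "(\<integral>\<^sup>+\<omega>. Phi G v {0} UNIV \<omega> \<partial>(poisson_process m))
     \<le> (\<integral>\<^sup>+y. \<integral>\<^sup>+p. \<integral>\<^sup>+r. (ennreal (m (fst p)) * ennreal (m (fst r)) + ?d y p r) * ennreal (v (snd p - y - snd r)) \<partial>?D \<partial>?D \<partial>?U)"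
    unfolding nn_integral_Phi[OF Pc]
    by (intro nn_integral_mono mult_right_mono pair_mean_poisson_le m) (auto simp: particles_def)
  also have "\<dots> = (\<integral>\<^sup>+y. \<integral>\<^sup>+p. \<integral>\<^sup>+r. ennreal (m (fst p)) * ennreal (m (fst r)) * ennreal (v (snd p - y - snd r)) \<partial>?D \<partial>?D \<partial>?U)
     + (\<integral>\<^sup>+y. \<integral>\<^sup>+p. \<integral>\<^sup>+r. ?d y p r * ennreal (v (snd p - y - snd r)) \<partial>?D \<partial>?D \<partial>?U)"
    by (simp add: distrib_right nn_integral_add)
  also have "(\<integral>\<^sup>+y. \<integral>\<^sup>+p. \<integral>\<^sup>+r. ennreal (m (fst p)) * ennreal (m (fst r)) * ennreal (v (snd p - y - snd r)) \<partial>?D \<partial>?D \<partial>?U)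
     = (\<integral>\<^sup>+p. \<integral>\<^sup>+r. \<integral>\<^sup>+y. ennreal (m (fst p)) * ennreal (m (fst r)) * ennreal (v (snd p - y - snd r)) \<partial>?U \<partial>?D \<partial>?D)"
    by (simp add: nn_integral_count_space_swap[where A=UNIV])
  also have "\<dots> = (\<integral>\<^sup>+p. \<integral>\<^sup>+r. ennreal (m (fst p)) * ennreal (m (fst r)) * ennreal (vbar v) \<partial>?D \<partial>?D)"
  proof (intro nn_integral_cong)
    fix p r :: "nat \<times> (int^'d)"
    have "(\<integral>\<^sup>+y. ennreal (v (snd p - y - snd r)) \<partial>?U) = (\<integral>\<^sup>+y. ennreal (v (- (snd r - snd p + y))) \<partial>?U)"
      by (simp add: algebra_simps)
    also have "\<dots> = ennreal (vbar v)"
      unfolding v_sym nn_integral_lattice_reindex[of "\<lambda>y. ennreal (v y)"] by (rule nn_integral_v)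
    finally show "(\<integral>\<^sup>+y. ennreal (m (fst p)) * ennreal (m (fst r)) * ennreal (v (snd p - y - snd r)) \<partial>?U)
        = ennreal (m (fst p)) * ennreal (m (fst r)) * ennreal (vbar v)"
      by (simp add: nn_integral_cmult)
  qed
  also have "\<dots> = ennreal \<rho> * ennreal \<rho> * ennreal (vbar v)"
    by (simp add: nn_integral_cmult nn_integral_multc mass)
  \<comment> \<open>The excess couples a particle only with the positions of the mark
    \<open>G k\<close> of its own size k. For a fixed particle these positions are distinct, so the
    sum of v over them is at most \<open>vbar v\<close>.\<close>
  also have "(\<integral>\<^sup>+y. \<integral>\<^sup>+p. \<integral>\<^sup>+r. ?d y p r * ennreal (v (snd p - y - snd r)) \<partial>?D \<partial>?D \<partial>?U) \<le> ennreal \<rho> * ennreal (vbar v)"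
  proof -
    have "(\<integral>\<^sup>+y. \<integral>\<^sup>+p. \<integral>\<^sup>+r. ?d y p r * ennreal (v (snd p - y - snd r)) \<partial>?D \<partial>?D \<partial>?U)
      = (\<integral>\<^sup>+p. \<integral>\<^sup>+r. ?d 0 p r * ennreal (v (snd p - snd r)) \<partial>?D \<partial>?D)"
      by (subst nn_integral_count_space'[where A="{0}"]) (auto intro!: nn_integral_zero' simp: AE_count_space)
    also have "\<dots> \<le> (\<integral>\<^sup>+p. ennreal (m (fst p)) * ennreal (vbar v) \<partial>?D)"
    proof (rule nn_integral_mono)
      fix p assume "p \<in> space ?D"
      then have p: "fst p \<ge> 1" by (auto simp: particles_def)
      have "(\<integral>\<^sup>+r. ?d 0 p r * ennreal (v (snd p - snd r)) \<partial>?D)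
        = (\<integral>\<^sup>+k. (\<Sum>j\<in>G k. (if fst p = k then ennreal (m (fst p)) * ennreal (v (snd p - j)) else 0)) \<partial>count_space {1..})"
        unfolding nn_integral_particles by (intro nn_integral_cong sum.cong) auto
      also have "\<dots> = (\<Sum>j\<in>G (fst p). ennreal (m (fst p)) * ennreal (v (snd p - j)))"
        using p by (subst nn_integral_count_space'[where A="{fst p}"]) auto
      also have "\<dots> = ennreal (m (fst p)) * (\<Sum>j\<in>G (fst p). ennreal (v (snd p - j)))" by (simp add: sum_distrib_left)
      also have "(\<Sum>j\<in>G (fst p). ennreal (v (snd p - j))) \<le> (\<integral>\<^sup>+j. ennreal (v (snd p - j)) \<partial>?U)"
        using finite_mark[OF p]
        by (subst nn_integral_count_space_finite[symmetric], simp)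
           (auto simp: nn_integral_count_space_indicator intro!: nn_integral_mono split: split_indicator)
      also have "(\<integral>\<^sup>+j. ennreal (v (snd p - j)) \<partial>?U) = (\<integral>\<^sup>+j. ennreal (v (- (- snd p + j))) \<partial>?U)" by simp
      also have "\<dots> = ennreal (vbar v)"
        unfolding v_sym nn_integral_lattice_reindex[of "\<lambda>y. ennreal (v y)"] by (rule nn_integral_v)
      finally show "(\<integral>\<^sup>+r. ?d 0 p r * ennreal (v (snd p - snd r)) \<partial>?D) \<le> ennreal (m (fst p)) * ennreal (vbar v)"
        by (simp add: mult_left_mono)
    qed
    also have "\<dots> = ennreal \<rho> * ennreal (vbar v)" by (simp add: nn_integral_multc mass)
    finally show ?thesis .
  qed
  finally have "(\<integral>\<^sup>+\<omega>. Phi G v {0} UNIV \<omega> \<partial>(poisson_process m)) \<le> ennreal \<rho> * ennreal \<rho> * ennreal (vbar v) + ennreal \<rho> * ennreal (vbar v)"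
    by (simp add: add_left_mono)
  also have "\<dots> = ennreal (vbar v * (\<rho>\<^sup>2 + \<rho>))"
    using \<rho>0 vbar_nonneg by (simp add: ennreal_mult'[symmetric] ennreal_plus[symmetric] power2_eq_square algebra_simps del: ennreal_plus)
  finally show ?thesis .
qed

text \<open>\<open>occ\<close> counts the particles at a lattice site; by translation invariance, the mean of
  \<open>\<Phi>\<close> is the sum of \<open>v z\<close> against its two-point function.\<close>

definition occ :: "int^'d \<Rightarrow> 'd config \<Rightarrow> ennreal" where
  "occ z \<omega> = (\<integral>\<^sup>+p. of_nat (\<omega> (fst p, z - snd p)) \<partial>count_space particles)"

lemma pair_mean_shift:
  assumes P: "P \<in> shift_invariant" and k: "k \<ge> 1" "l \<ge> 1"
  shows "pair_mean P k l (x + z) (y + z) = pair_mean P k l x y"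
proof -
  have Pc: "P \<in> config_laws" using P shift_invariant_config_laws by auto
  have m: "(\<lambda>\<omega>. of_nat (\<omega> (k, x)) * of_nat (\<omega> (l, y)) :: ennreal) \<in> borel_measurable (config_space UNIV)"
    unfolding config_space_eq using k by (intro borel_measurable_times_ennreal measurable_count_site) auto
  have s: "shift z \<in> measurable P (config_space UNIV)"
    using measurable_shift[of z] by (simp only: measurable_cong_sets[OF config_lawsD(2)[OF Pc] refl] config_space_eq)
  have "pair_mean P k l x y = pair_mean (distr P (config_space UNIV) (shift z)) k l x y"
    using P by (simp add: shift_invariant_def)
  also have "\<dots> = (\<integral>\<^sup>+\<omega>. of_nat (shift z \<omega> (k, x)) * of_nat (shift z \<omega> (l, y)) \<partial>P)"
    unfolding pair_mean_def by (rule nn_integral_distr[OF s]) (simp add: m)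
  finally show ?thesis by (simp add: shift_def pair_mean_def)
qed

text \<open>Translating each pair of points so that the first lies at the origin leaves an
  expression without x: the field \<open>occ\<close> has translation-invariant second
  moments.\<close>

lemma occ_two_point:
  assumes P: "P \<in> shift_invariant"
  shows "(\<integral>\<^sup>+\<omega>. occ x \<omega> * occ (x + z) \<omega> \<partial>P)
    = (\<integral>\<^sup>+p. \<integral>\<^sup>+r. pair_mean P (fst p) (fst r) 0 (z + snd p - snd r) \<partial>count_space particles \<partial>count_space particles)"
proof -
  have Pc: "P \<in> config_laws" using P shift_invariant_config_laws by auto
  have "(\<integral>\<^sup>+\<omega>. occ x \<omega> * occ (x + z) \<omega> \<partial>P) = (\<integral>\<^sup>+\<omega>. \<integral>\<^sup>+p. \<integral>\<^sup>+r. of_nat (\<omega> (fst p, x - snd p)) * of_nat (\<omega> (fst r, x + z - snd r)) * 1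
     \<partial>count_space particles \<partial>count_space particles \<partial>P)"
    unfolding occ_def by (simp add: nn_integral_cmult nn_integral_multc)
  also have "\<dots> = (\<integral>\<^sup>+p. \<integral>\<^sup>+r. pair_mean P (fst p) (fst r) (x - snd p) (x + z - snd r) \<partial>count_space particles \<partial>count_space particles)"
    using nn_integral_double_particles[OF Pc, where w="\<lambda>_. 1" and x="\<lambda>p. x - snd p" and y="\<lambda>r. x + z - snd r"] by simp
  also have "\<dots> = (\<integral>\<^sup>+p. \<integral>\<^sup>+r. pair_mean P (fst p) (fst r) 0 (z + snd p - snd r) \<partial>count_space particles \<partial>count_space particles)"
  proof (intro nn_integral_cong)
    fix p r assume "p \<in> space (count_space particles)" "r \<in> space (count_space particles)"
    then have k: "fst p \<ge> 1" "fst r \<ge> 1" by (auto simp: particles_def)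
    show "pair_mean P (fst p) (fst r) (x - snd p) (x + z - snd r) = pair_mean P (fst p) (fst r) 0 (z + snd p - snd r)"
      using pair_mean_shift[OF P k, of 0 "x - snd p" "z + snd p - snd r"] by (simp add: algebra_simps)
  qed
  finally show ?thesis .
qed

text \<open>For particles at relative positions \<open>snd p\<close> and \<open>snd r\<close>, the
  substitution \<open>y = snd p - snd r + z\<close> turns the argument of v into \<open>-z\<close>,
  and v is even; the remaining sum over particles is the two-point function at distance z.\<close>

lemma nn_integral_Phi_occ:
  assumes P: "P \<in> shift_invariant"
  shows "(\<integral>\<^sup>+\<omega>. Phi G v {0} UNIV \<omega> \<partial>P) = (\<integral>\<^sup>+z. ennreal (v z) * (\<integral>\<^sup>+\<omega>. occ 0 \<omega> * occ z \<omega> \<partial>P) \<partial>count_space UNIV)"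
proof -
  let ?D = "count_space particles" and ?U = "count_space (UNIV :: (int^'d) set)"
  have Pc: "P \<in> config_laws" using P shift_invariant_config_laws by auto
  have "(\<integral>\<^sup>+\<omega>. Phi G v {0} UNIV \<omega> \<partial>P) = (\<integral>\<^sup>+p. \<integral>\<^sup>+r. \<integral>\<^sup>+y. pair_mean P (fst p) (fst r) 0 y * ennreal (v (snd p - y - snd r)) \<partial>?U \<partial>?D \<partial>?D)"
    unfolding nn_integral_Phi[OF Pc] by (simp add: nn_integral_count_space_swap[where A=UNIV])
  also have "\<dots> = (\<integral>\<^sup>+p. \<integral>\<^sup>+r. \<integral>\<^sup>+z. ennreal (v z) * pair_mean P (fst p) (fst r) 0 (z + snd p - snd r) \<partial>?U \<partial>?D \<partial>?D)"
  proof (rule nn_integral_cong, rule nn_integral_cong)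
    fix p r :: "nat \<times> (int^'d)"
    have "(\<integral>\<^sup>+y. pair_mean P (fst p) (fst r) 0 y * ennreal (v (snd p - y - snd r)) \<partial>?U)
      = (\<integral>\<^sup>+z. pair_mean P (fst p) (fst r) 0 (snd p - snd r + z) * ennreal (v (snd p - (snd p - snd r + z) - snd r)) \<partial>?U)"
      by (rule nn_integral_lattice_reindex[symmetric])
    also have "\<dots> = (\<integral>\<^sup>+z. ennreal (v z) * pair_mean P (fst p) (fst r) 0 (z + snd p - snd r) \<partial>?U)"
      by (intro nn_integral_cong) (simp add: v_sym algebra_simps)
    finally show "(\<integral>\<^sup>+y. pair_mean P (fst p) (fst r) 0 y * ennreal (v (snd p - y - snd r)) \<partial>?U)
      = (\<integral>\<^sup>+z. ennreal (v z) * pair_mean P (fst p) (fst r) 0 (z + snd p - snd r) \<partial>?U)" .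
  qed
  also have "\<dots> = (\<integral>\<^sup>+z. \<integral>\<^sup>+p. \<integral>\<^sup>+r. ennreal (v z) * pair_mean P (fst p) (fst r) 0 (z + snd p - snd r) \<partial>?D \<partial>?D \<partial>?U)"
    by (simp add: nn_integral_count_space_swap[where A=UNIV])
  also have "\<dots> = (\<integral>\<^sup>+z. ennreal (v z) * (\<integral>\<^sup>+\<omega>. occ 0 \<omega> * occ z \<omega> \<partial>P) \<partial>?U)"
    using occ_two_point[OF P, of 0] by (simp add: nn_integral_cmult)
  finally show ?thesis .
qed

text \<open>This is \<open>(s - 2 c)^2 >= 0\<close>, the tangent to the square at
  \<open>2 c\<close>, arranged without subtraction so that it also holds for infinite s.\<close>

lemma ennreal_square_ge: "ennreal (4 * c) * s \<le> s * s + ennreal (4 * c\<^sup>2)" if "c \<ge> 0" for s :: ennreal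
proof (cases s)
  case (real x)
  have "4 * c * x \<le> x * x + 4 * c\<^sup>2"
    using zero_le_power2[of "x - 2 * c"] by (simp add: power2_eq_square algebra_simps)
  then show ?thesis using real that
    by (simp add: ennreal_mult'[symmetric] ennreal_plus[symmetric] ennreal_leI del: ennreal_plus)
qed simp

text \<open>The sum of the field at 0 and z has mean \<open>2 * \<rho>\<close>, so its second moment
  is at least \<open>4 * \<rho>\<^sup>2\<close>. Expanding the square and using that the second
  moments at 0 and z agree gives the bound. The tangent inequality takes the place of Jensen's, so
  infinite second moments need no separate treatment.\<close>

lemma occ_two_point_ge:
  assumes P: "P \<in> shift_invariant" and m: "\<And>k. k \<ge> 1 \<Longrightarrow> 0 \<le> m k"
    and mean: "\<And>k. k \<ge> 1 \<Longrightarrow> (\<integral>\<^sup>+\<omega>. N_mark {0} k \<omega> \<partial>P) = ennreal (m k)"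
    and \<rho>: "((\<lambda>k. real k * m k) has_sum \<rho>) {1..}"
  shows "ennreal (2 * \<rho>\<^sup>2) \<le> (\<integral>\<^sup>+\<omega>. occ 0 \<omega> * occ z \<omega> \<partial>P) + (\<integral>\<^sup>+\<omega>. occ 0 \<omega> * occ 0 \<omega> \<partial>P)"
proof -
  have \<rho>0: "0 \<le> \<rho>" using \<rho> m by (intro has_sum_nonneg[OF \<rho>]) auto
  have Pc: "P \<in> config_laws" using P shift_invariant_config_laws by auto
  interpret prob_space P by (rule config_lawsD[OF Pc])
  note ms = measurable_site[OF Pc]
  have om[measurable]: "occ x \<in> borel_measurable P" for x
    unfolding occ_def[abs_def] by (intro borel_measurable_nn_integral_count_space countable_particles ms)
  have mean_occ: "(\<integral>\<^sup>+\<omega>. occ x \<omega> \<partial>P) = ennreal \<rho>" for x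
  proof -
    have "(\<integral>\<^sup>+\<omega>. occ x \<omega> \<partial>P) = (\<integral>\<^sup>+p. \<integral>\<^sup>+\<omega>. of_nat (\<omega> (fst p, x - snd p)) \<partial>P \<partial>count_space particles)"
      unfolding occ_def by (intro nn_integral_count_space_nn_integral countable_particles ms)
    also have "\<dots> = (\<integral>\<^sup>+p. ennreal (m (fst p)) \<partial>count_space particles)"
      by (intro nn_integral_cong) (auto simp: mean_site[OF P] mean particles_def)
    finally show ?thesis by (simp add: nn_integral_particles_mass[OF \<rho> m])
  qed
  let ?S = "\<lambda>x y. \<integral>\<^sup>+\<omega>. occ x \<omega> * occ y \<omega> \<partial>P"
  have zz: "?S z z = ?S 0 0" using occ_two_point[OF P, of z 0] occ_two_point[OF P, of 0 0] by simp
  have "ennreal (4 * \<rho>) * (\<integral>\<^sup>+\<omega>. occ 0 \<omega> + occ z \<omega> \<partial>P) = (\<integral>\<^sup>+\<omega>. ennreal (4 * \<rho>) * (occ 0 \<omega> + occ z \<omega>) \<partial>P)"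
    by (rule nn_integral_cmult[symmetric]) simp
  also have "\<dots> \<le> (\<integral>\<^sup>+\<omega>. (occ 0 \<omega> + occ z \<omega>) * (occ 0 \<omega> + occ z \<omega>) + ennreal (4 * \<rho>\<^sup>2) \<partial>P)"
    by (intro nn_integral_mono ennreal_square_ge \<rho>0)
  also have "\<dots> = (\<integral>\<^sup>+\<omega>. 2 * (occ 0 \<omega> * occ z \<omega>) + occ 0 \<omega> * occ 0 \<omega> + occ z \<omega> * occ z \<omega> + ennreal (4 * \<rho>\<^sup>2) \<partial>P)"
    by (intro nn_integral_cong) (simp add: distrib_left distrib_right mult.commute add_ac mult_2)
  also have "\<dots> = 2 * ?S 0 z + ?S 0 0 + ?S z z + ennreal (4 * \<rho>\<^sup>2)"
    by (simp add: nn_integral_add nn_integral_cmult emeasure_space_1)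
  also have "\<dots> = 2 * (?S 0 z + ?S 0 0) + ennreal (4 * \<rho>\<^sup>2)" unfolding zz by (simp add: mult_2 distrib_left add_ac)
  also have "ennreal (4 * \<rho>) * (\<integral>\<^sup>+\<omega>. occ 0 \<omega> + occ z \<omega> \<partial>P) = ennreal (4 * \<rho>\<^sup>2) + ennreal (4 * \<rho>\<^sup>2)"
    using \<rho>0 by (simp add: nn_integral_add mean_occ ennreal_mult'[symmetric] ennreal_plus[symmetric] power2_eq_square algebra_simps del: ennreal_plus)
  finally have "ennreal (4 * \<rho>\<^sup>2) \<le> 2 * (?S 0 z + ?S 0 0)"
    by (simp add: add.commute ennreal_add_left_cancel_le)
  then show ?thesis
  proof (cases "?S 0 z + ?S 0 0")
    case (real x)
    then have "ennreal (4 * \<rho>\<^sup>2) \<le> ennreal (2 * x)" using \<open>ennreal (4 * \<rho>\<^sup>2) \<le> _\<close> by (simp add: ennreal_mult')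
    then show ?thesis using real by (simp add: ennreal_le_iff ennreal_leI)
  qed auto
qed

text \<open>Let w be the total weight of v off the origin. The condition
  \<open>2 * v 0 \<ge> vbar v\<close> says \<open>w <= v 0\<close>, so each off-site term can be
  paired with a share of the on-site term of equal weight, each pair giving twice the squared mean.
  The leftover on-site weight \<open>v 0 - w\<close> is bounded with the second moment alone, and
  \<open>(v 0 - w) + 2 * w = vbar v\<close>.\<close>

lemma Phi_ge:
  assumes P: "P \<in> shift_invariant" and m: "\<And>k. k \<ge> 1 \<Longrightarrow> 0 \<le> m k"
    and mean: "\<And>k. k \<ge> 1 \<Longrightarrow> (\<integral>\<^sup>+\<omega>. N_mark {0} k \<omega> \<partial>P) = ennreal (m k)"
    and \<rho>: "((\<lambda>k. real k * m k) has_sum \<rho>) {1..}" and v0: "2 * v 0 \<ge> vbar v"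
  shows "ennreal (vbar v * \<rho>\<^sup>2) \<le> (\<integral>\<^sup>+\<omega>. Phi G v {0} UNIV \<omega> \<partial>P)"
proof -
  let ?S = "\<lambda>z. \<integral>\<^sup>+\<omega>. occ 0 \<omega> * occ z \<omega> \<partial>P"
  define w where "w = vbar v - v 0"
  have split: "(\<integral>\<^sup>+z. ennreal (v z) * f z \<partial>count_space UNIV) = ennreal (v 0) * f 0 + (\<integral>\<^sup>+z. ennreal (v z) * f z \<partial>count_space (UNIV - {0}))" for f :: "int^'d \<Rightarrow> ennreal"
  proof -
    have "(\<integral>\<^sup>+z. ennreal (v z) * f z \<partial>count_space UNIV) = (\<integral>\<^sup>+z. ennreal (v z) * f z * indicator {0} z + ennreal (v z) * f z * indicator (UNIV - {0}) z \<partial>count_space UNIV)"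
      by (intro nn_integral_cong) (auto split: split_indicator)
    also have "\<dots> = (\<integral>\<^sup>+z. ennreal (v z) * f z \<partial>count_space {0}) + (\<integral>\<^sup>+z. ennreal (v z) * f z \<partial>count_space (UNIV - {0}))"
      by (simp add: nn_integral_add nn_integral_count_space_indicator)
    finally show ?thesis by (simp add: nn_integral_count_space_finite)
  qed
  have w: "(\<integral>\<^sup>+z. ennreal (v z) \<partial>count_space (UNIV - {0})) = ennreal w" and "w \<ge> 0"
  proof -
    have "ennreal (vbar v) = ennreal (v 0) + (\<integral>\<^sup>+z. ennreal (v z) \<partial>count_space (UNIV - {0}))"
      using split[of "\<lambda>_. 1"] by (simp add: nn_integral_v)
    then show "(\<integral>\<^sup>+z. ennreal (v z) \<partial>count_space (UNIV - {0})) = ennreal w" "w \<ge> 0"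
      using v_nonneg[of 0] vbar_nonneg unfolding w_def
      by (cases "\<integral>\<^sup>+z. ennreal (v z) \<partial>count_space (UNIV - {0})"; simp add: ennreal_plus[symmetric] del: ennreal_plus)+
  qed
  have two: "ennreal (2 * \<rho>\<^sup>2) \<le> ?S z + ?S 0" for z by (rule occ_two_point_ge[OF P m mean \<rho>])
  have one: "ennreal (\<rho>\<^sup>2) \<le> ?S 0"
  proof (cases "?S 0")
    case (real x)
    then show ?thesis using two[of 0] by (simp add: ennreal_plus[symmetric] ennreal_leI del: ennreal_plus)
  qed simp
  have "ennreal (vbar v * \<rho>\<^sup>2) = ennreal (v 0 - w) * ennreal (\<rho>\<^sup>2) + ennreal w * ennreal (2 * \<rho>\<^sup>2)"
  proof -
    have "vbar v * \<rho>\<^sup>2 = (v 0 - w) * \<rho>\<^sup>2 + w * (2 * \<rho>\<^sup>2)" by (simp add: w_def algebra_simps)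
    moreover have "v 0 - w \<ge> 0" using v0 by (simp add: w_def)
    ultimately show ?thesis using \<open>w \<ge> 0\<close> by (simp only: ennreal_plus ennreal_mult mult_nonneg_nonneg zero_le_power2 zero_le_numeral)
  qed
  also have "ennreal w * ennreal (2 * \<rho>\<^sup>2) = (\<integral>\<^sup>+z. ennreal (v z) * ennreal (2 * \<rho>\<^sup>2) \<partial>count_space (UNIV - {0}))"
    by (simp add: nn_integral_multc w)
  also have "ennreal (v 0 - w) * ennreal (\<rho>\<^sup>2) + \<dots> \<le> ennreal (v 0 - w) * ?S 0 + (\<integral>\<^sup>+z. ennreal (v z) * (?S z + ?S 0) \<partial>count_space (UNIV - {0}))"
    by (intro add_mono mult_left_mono nn_integral_mono one two) auto
  also have "\<dots> = (ennreal (v 0 - w) + ennreal w) * ?S 0 + (\<integral>\<^sup>+z. ennreal (v z) * ?S z \<partial>count_space (UNIV - {0}))"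
    by (simp add: distrib_left nn_integral_add nn_integral_multc w distrib_right add_ac)
  also have "ennreal (v 0 - w) + ennreal w = ennreal (v 0)"
    using v0 \<open>w \<ge> 0\<close> by (simp add: w_def ennreal_plus[symmetric] del: ennreal_plus)
  also have "ennreal (v 0) * ?S 0 + (\<integral>\<^sup>+z. ennreal (v z) * ?S z \<partial>count_space (UNIV - {0})) = (\<integral>\<^sup>+\<omega>. Phi G v {0} UNIV \<omega> \<partial>P)"
    unfolding nn_integral_Phi_occ[OF P] by (rule split[symmetric])
  finally show ?thesis .
qed

end

subsection \<open>The function \<open>\<chi>\<close>\<close>

lemma convex_on_at_zero_less:
  fixes g :: "real \<Rightarrow> real"
  assumes g: "convex_on {0..} g" and e: "0 < e"
  shows "\<exists>d>0. \<forall>t. 0 \<le> t \<and> t < d \<longrightarrow> g t < g 0 + e"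
proof -
  define d where "d = min 1 (e / (\<bar>g 1 - g 0\<bar> + 1))"
  have d: "0 < d" using e by (auto simp: d_def)
  moreover have "g t < g 0 + e" if t: "0 \<le> t" "t < d" for t
  proof -
    have "t \<le> 1" using t by (simp add: d_def)
    then have "g ((1 - t) *\<^sub>R 0 + t *\<^sub>R 1) \<le> (1 - t) * g 0 + t * g 1"
      using t by (intro convex_onD[OF g]) auto
    then have "g t \<le> g 0 + t * (g 1 - g 0)" by (simp add: algebra_simps)
    also have "t * (g 1 - g 0) \<le> t * (\<bar>g 1 - g 0\<bar> + 1)" using t by (intro mult_left_mono) auto
    also have "t * (\<bar>g 1 - g 0\<bar> + 1) < e" using t by (simp add: d_def pos_less_divide_eq)
    finally show ?thesis by simp
  qed
  ultimately show ?thesis by blast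
qed

text \<open>At the endpoint the chord to 1 bounds a convex function from above, which gives upper
  semicontinuity. The other half can fail for convex functions and is therefore a
  hypothesis.\<close>

lemma convex_on_continuous_halfline:
  fixes g :: "real \<Rightarrow> real"
  assumes g: "convex_on {0..} g"
    and lsc: "\<And>e. 0 < e \<Longrightarrow> \<exists>d>0. \<forall>t. 0 \<le> t \<and> t < d \<longrightarrow> g 0 - e < g t"
  shows "continuous_on {0..} g"
  unfolding continuous_on_eq_continuous_within
proof
  fix x :: real assume x: "x \<in> {0..}"
  show "continuous (at x within {0..}) g"
  proof (cases "x = 0")
    case False
    have "convex_on {0<..} g" by (rule convex_on_subset[OF g]) (auto intro: convex_real_interval)
    then have "continuous_on {0<..} g" by (intro convex_on_continuous) auto
    then have "continuous (at x) g" using x False by (simp add: continuous_on_eq_continuous_at)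
    then show ?thesis by (rule continuous_at_imp_continuous_at_within)
  next
    case True
    show ?thesis
      unfolding continuous_within_eps_delta
    proof (intro allI impI)
      fix e :: real assume e: "0 < e"
      obtain d1 where d1: "d1 > 0" "\<And>t. 0 \<le> t \<Longrightarrow> t < d1 \<Longrightarrow> g t < g 0 + e" using convex_on_at_zero_less[OF g e] by blast
      obtain d2 where d2: "d2 > 0" "\<And>t. 0 \<le> t \<Longrightarrow> t < d2 \<Longrightarrow> g 0 - e < g t" using lsc[OF e] by blast
      show "\<exists>d>0. \<forall>x'\<in>{0..}. dist x' x < d \<longrightarrow> dist (g x') (g x) < e"
      proof (intro exI[of _ "min d1 d2"] conjI ballI impI)
        fix t :: real assume t: "t \<in> {0..}" "dist t x < min d1 d2"
        then have "0 \<le> t" "t < d1" "t < d2" using True by (auto simp: dist_real_def)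
        then show "dist (g t) (g x) < e" using d1(2)[of t] d2(2)[of t] True by (simp add: dist_real_def abs_less_iff)
      qed (use d1 d2 in auto)
    qed
  qed
qed

text \<open>Separate continuity does not suffice in general. Monotonicity in s squeezes
  \<open>f r' s'\<close> between the two functions \<open>f r' sm\<close> and \<open>f r' sp\<close>
  of r' alone, whose second arguments are fixed; \<open>sm\<close> is clipped at 0 to stay in the
  domain.\<close>

lemma continuous_on_quadrant_separately_mono:
  fixes f :: "real \<Rightarrow> real \<Rightarrow> real"
  assumes c1: "\<And>s. 0 \<le> s \<Longrightarrow> continuous_on {0..} (\<lambda>r. f r s)"
    and c2: "\<And>r. 0 \<le> r \<Longrightarrow> continuous_on {0..} (f r)"
    and mono: "\<And>r s s'. 0 \<le> r \<Longrightarrow> 0 \<le> s \<Longrightarrow> s \<le> s' \<Longrightarrow> f r s \<le> f r s'"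
  shows "continuous_on ({0..} \<times> {0..}) (\<lambda>(r, s). f r s)"
  unfolding continuous_on_iff
proof (intro ballI allI impI)
  fix x :: "real \<times> real" and e :: real assume x: "x \<in> {0..} \<times> {0..}" and e: "0 < e"
  obtain r s where rs: "x = (r, s)" "0 \<le> r" "0 \<le> s" using x by auto
  have e2: "0 < e / 2" using e by simp
  obtain d1 where d1: "d1 > 0" "\<And>s'. 0 \<le> s' \<Longrightarrow> dist s' s < d1 \<Longrightarrow> dist (f r s') (f r s) < e / 2"
    using c2[OF rs(2)] rs(3) e2 unfolding continuous_on_iff by (metis atLeast_iff)
  define sp where "sp = s + d1 / 2"
  define sm where "sm = max 0 (s - d1 / 2)"
  have sp: "0 \<le> sp" "dist sp s < d1" and sm: "0 \<le> sm" "dist sm s < d1" "sm \<le> s"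
    using d1(1) rs(3) by (auto simp: sp_def sm_def dist_real_def)
  obtain d2 where d2: "d2 > 0" "\<And>r'. 0 \<le> r' \<Longrightarrow> dist r' r < d2 \<Longrightarrow> dist (f r' sp) (f r sp) < e / 2"
    using c1[OF sp(1)] rs(2) e2 unfolding continuous_on_iff by (metis atLeast_iff)
  obtain d3 where d3: "d3 > 0" "\<And>r'. 0 \<le> r' \<Longrightarrow> dist r' r < d3 \<Longrightarrow> dist (f r' sm) (f r sm) < e / 2"
    using c1[OF sm(1)] rs(2) e2 unfolding continuous_on_iff by (metis atLeast_iff)
  define d where "d = min (d1 / 2) (min d2 d3)"
  show "\<exists>d>0. \<forall>x'\<in>{0..} \<times> {0..}. dist x' x < d \<longrightarrow> dist (case x' of (r, s) \<Rightarrow> f r s) (case x of (r, s) \<Rightarrow> f r s) < e"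
  proof (intro exI[of _ d] conjI ballI impI)
    show "0 < d" using d1 d2 d3 by (simp add: d_def)
    fix x' :: "real \<times> real" assume x': "x' \<in> {0..} \<times> {0..}" "dist x' x < d"
    obtain r' s' where rs': "x' = (r', s')" "0 \<le> r'" "0 \<le> s'" using x' by auto
    have "dist r' r \<le> dist x' x" "dist s' s \<le> dist x' x"
      using dist_fst_le[of x' x] dist_snd_le[of x' x] by (auto simp: rs rs')
    then have dr: "dist r' r < d2" "dist r' r < d3" and ds: "dist s' s < d1 / 2" using x'(2) by (auto simp: d_def)
    have "\<bar>s' - s\<bar> < d1 / 2" using ds by (simp only: dist_real_def)
    then have "s' \<le> sp" "s - d1 / 2 \<le> s'" unfolding sp_def by linarith+
    moreover from this have "sm \<le> s'" using rs'(3) by (simp add: sm_def)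
    ultimately have "s' \<le> sp" "sm \<le> s'" by auto
    then have "f r' sm \<le> f r' s'" "f r' s' \<le> f r' sp" using mono rs' sm by auto
    moreover have "\<bar>f r' sp - f r sp\<bar> < e / 2" "\<bar>f r' sm - f r sm\<bar> < e / 2" "\<bar>f r sp - f r s\<bar> < e / 2" "\<bar>f r sm - f r s\<bar> < e / 2"
      using d2(2)[OF rs'(2) dr(1)] d3(2)[OF rs'(2) dr(2)] d1(2)[OF sp] d1(2)[OF sm(1,2)] by (auto simp: dist_real_def)
    ultimately have "\<bar>f r' s' - f r s\<bar> < e" by linarith
    then show "dist (case x' of (r, s) \<Rightarrow> f r s) (case x of (r, s) \<Rightarrow> f r s) < e" by (simp add: rs rs' dist_real_def)
  qed
qed

section \<open>Mass profiles, laws with given mean, and their mixtures\<close>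

lemma has_sum_0_nonneg:
  fixes f :: "'a \<Rightarrow> real"
  assumes "(f has_sum 0) A" "\<And>x. x \<in> A \<Longrightarrow> 0 \<le> f x" "x \<in> A"
  shows "f x = 0"
  using assms infsumI[OF assms(1)] by (intro nonneg_infsum_le_0D[of f A x]) (auto simp: summable_on_def)

definition mass_profile :: "(nat \<Rightarrow> real) \<Rightarrow> real \<Rightarrow> bool" where
  "mass_profile m \<rho> \<longleftrightarrow> (\<forall>k\<ge>1. 0 \<le> m k) \<and> ((\<lambda>k. real k * m k) has_sum \<rho>) {1..}"

definition mean_pmf :: "nat pmf \<Rightarrow> real \<Rightarrow> bool" where
  "mean_pmf \<psi> \<sigma> \<longleftrightarrow> ((\<lambda>a. real a * pmf \<psi> a) has_sum \<sigma>) UNIV"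

definition mix_pmf :: "real \<Rightarrow> 'a pmf \<Rightarrow> 'a pmf \<Rightarrow> 'a pmf" where
  "mix_pmf t \<psi>1 \<psi>2 = bind_pmf (bernoulli_pmf t) (\<lambda>b. if b then \<psi>1 else \<psi>2)"

lemma pmf_mix: "0 \<le> t \<Longrightarrow> t \<le> 1 \<Longrightarrow> pmf (mix_pmf t \<psi>1 \<psi>2) a = t * pmf \<psi>1 a + (1 - t) * pmf \<psi>2 a"
  by (simp add: mix_pmf_def pmf_bind mult.commute)

lemma mass_profileD: "mass_profile m \<rho> \<Longrightarrow> k \<ge> 1 \<Longrightarrow> 0 \<le> m k"
  by (simp add: mass_profile_def)

lemma mass_profile_zero: "mass_profile m 0 \<Longrightarrow> k \<ge> 1 \<Longrightarrow> m k = 0"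
  using has_sum_0_nonneg[of "\<lambda>k. real k * m k" "{1..}" k] by (auto simp: mass_profile_def)

lemma mean_pmf_zero: "mean_pmf \<psi> 0 \<Longrightarrow> \<psi> = return_pmf 0"
proof -
  assume "mean_pmf \<psi> 0"
  then have "real a * pmf \<psi> a = 0" for a
    using has_sum_0_nonneg[of "\<lambda>a. real a * pmf \<psi> a" UNIV a] by (simp add: mean_pmf_def)
  then have "a = 0" if "a \<in> set_pmf \<psi>" for a using that by (auto simp: set_pmf_iff)
  then show ?thesis by (simp add: set_pmf_subset_singleton[symmetric] subset_iff)
qed

lemma mean_return_pmf: "mean_pmf (return_pmf 0) 0"
proof -
  have "(\<lambda>a. real a * pmf (return_pmf 0) a) = (\<lambda>_. 0)" by (auto simp: fun_eq_iff indicator_def)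
  then show ?thesis by (simp add: mean_pmf_def)
qed

text \<open>Supplies a law of prescribed mean whose second moment is finite, as the term quadratic
  in a requires for \<chi> to be finite.\<close>

lemma mean_poisson_law: "0 \<le> \<sigma> \<Longrightarrow> mean_pmf (poisson_law \<sigma>) \<sigma>"
proof (cases "\<sigma> = 0")
  case True
  then show ?thesis using mean_return_pmf by (simp add: poisson_law_def)
next
  case False
  assume "0 \<le> \<sigma>"
  then have "(\<lambda>n. real n * (\<sigma> ^ n / fact n) * exp (- \<sigma>)) sums (\<sigma> * exp \<sigma> * exp (- \<sigma>))"
    by (intro sums_mult2 poisson_moment_sums)
  then have "((\<lambda>n. real n * (\<sigma> ^ n / fact n) * exp (- \<sigma>)) has_sum \<sigma>) UNIV"
    using \<open>0 \<le> \<sigma>\<close> by (intro sums_nonneg_imp_has_sum) (auto simp: mult.assoc simp flip: exp_add)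
  then show ?thesis using False \<open>0 \<le> \<sigma>\<close> by (simp add: mean_pmf_def poisson_law_def mult.assoc)
qed

lemma mass_profile_mix:
  assumes "mass_profile m1 \<rho>1" "mass_profile m2 \<rho>2" "0 \<le> t" "t \<le> 1"
  shows "mass_profile (\<lambda>k. t * m1 k + (1 - t) * m2 k) (t * \<rho>1 + (1 - t) * \<rho>2)"
proof -
  have "((\<lambda>k. t * (real k * m1 k) + (1 - t) * (real k * m2 k)) has_sum (t * \<rho>1 + (1 - t) * \<rho>2)) {1..}"
    using assms by (intro has_sum_add has_sum_cmult_right) (auto simp: mass_profile_def)
  moreover have "(\<lambda>k. t * (real k * m1 k) + (1 - t) * (real k * m2 k)) = (\<lambda>k. real k * (t * m1 k + (1 - t) * m2 k))"
    by (simp add: fun_eq_iff algebra_simps)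
  ultimately show ?thesis using assms by (simp add: mass_profile_def)
qed

lemma mean_pmf_mix:
  assumes "mean_pmf \<psi>1 \<sigma>1" "mean_pmf \<psi>2 \<sigma>2" "0 \<le> t" "t \<le> 1"
  shows "mean_pmf (mix_pmf t \<psi>1 \<psi>2) (t * \<sigma>1 + (1 - t) * \<sigma>2)"
proof -
  have "((\<lambda>a. t * (real a * pmf \<psi>1 a) + (1 - t) * (real a * pmf \<psi>2 a)) has_sum (t * \<sigma>1 + (1 - t) * \<sigma>2)) UNIV"
    using assms by (intro has_sum_add has_sum_cmult_right) (auto simp: mean_pmf_def)
  then show ?thesis using assms by (simp add: mean_pmf_def pmf_mix algebra_simps)
qed

lemma chi_eq: "chi G v q \<rho> \<sigma> = Inf {varphi G v q m \<psi> | m \<psi>. mass_profile m \<rho> \<and> mean_pmf \<psi> \<sigma>}"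
  by (simp add: chi_def mass_profile_def mean_pmf_def conj_assoc)

lemma chi_le: "mass_profile m \<rho> \<Longrightarrow> mean_pmf \<psi> \<sigma> \<Longrightarrow> chi G v q \<rho> \<sigma> \<le> varphi G v q m \<psi>"
  unfolding chi_eq by (rule Inf_lower) auto

lemma le_chi: "(\<And>m \<psi>. mass_profile m \<rho> \<Longrightarrow> mean_pmf \<psi> \<sigma> \<Longrightarrow> c \<le> varphi G v q m \<psi>) \<Longrightarrow> c \<le> chi G v q \<rho> \<sigma>"
  unfolding chi_eq by (rule Inf_greatest) auto

lemma chi_convex:
  assumes t: "0 < t" "t < 1"
  shows "chi G v q (t * \<rho>1 + (1 - t) * \<rho>2) (t * \<sigma>1 + (1 - t) * \<sigma>2)
    \<le> ennreal t * chi G v q \<rho>1 \<sigma>1 + ennreal (1 - t) * chi G v q \<rho>2 \<sigma>2"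
  unfolding chi_eq[of G v q \<rho>1] chi_eq[of G v q \<rho>2]
proof (rule le_mult_add_mult_Inf)
  fix x y
  assume "x \<in> {varphi G v q m \<psi> | m \<psi>. mass_profile m \<rho>1 \<and> mean_pmf \<psi> \<sigma>1}"
    and "y \<in> {varphi G v q m \<psi> | m \<psi>. mass_profile m \<rho>2 \<and> mean_pmf \<psi> \<sigma>2}"
  then obtain m1 \<psi>1 m2 \<psi>2 where 1: "mass_profile m1 \<rho>1" "mean_pmf \<psi>1 \<sigma>1" "x = varphi G v q m1 \<psi>1"
    and 2: "mass_profile m2 \<rho>2" "mean_pmf \<psi>2 \<sigma>2" "y = varphi G v q m2 \<psi>2" by auto
  have "chi G v q (t * \<rho>1 + (1 - t) * \<rho>2) (t * \<sigma>1 + (1 - t) * \<sigma>2)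
      \<le> varphi G v q (\<lambda>k. t * m1 k + (1 - t) * m2 k) (mix_pmf t \<psi>1 \<psi>2)"
    using 1 2 t by (intro chi_le mass_profile_mix mean_pmf_mix) auto
  also have "\<dots> \<le> ennreal t * x + ennreal (1 - t) * y"
    unfolding 1 2 using t mass_profileD[OF 1(1)] mass_profileD[OF 2(1)] by (intro varphi_convex) (auto simp: pmf_mix)
  finally show "chi G v q (t * \<rho>1 + (1 - t) * \<rho>2) (t * \<sigma>1 + (1 - t) * \<sigma>2) \<le> ennreal t * x + ennreal (1 - t) * y" .
qed (use t in auto)

text \<open>Moving a part of the mass to 0 multiplies every tail from \<open>a \<ge> 1\<close> on by
  t.\<close>

lemma stoch_le_mix_return_0:
  assumes "0 \<le> t" "t \<le> 1"
  shows "mix_pmf t \<psi> (return_pmf 0) \<le>\<^sub>s\<^sub>t \<psi>"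
  unfolding stoch_le_def
proof
  fix a :: nat
  show "measure_pmf.prob (mix_pmf t \<psi> (return_pmf 0)) {a..} \<le> measure_pmf.prob \<psi> {a..}"
  proof (cases "a = 0")
    case True
    then have "{a..} = UNIV" by auto
    then show ?thesis by simp
  next
    case False
    have "emeasure (measure_pmf (mix_pmf t \<psi> (return_pmf 0))) {a..} = ennreal t * emeasure (measure_pmf \<psi>) {a..}"
      using False assms by (simp add: mix_pmf_def mult.commute)
    also have "\<dots> = ennreal (t * measure_pmf.prob \<psi> {a..})"
      using assms by (simp add: measure_pmf.emeasure_eq_measure ennreal_mult')
    finally have "measure_pmf.prob (mix_pmf t \<psi> (return_pmf 0)) {a..} = t * measure_pmf.prob \<psi> {a..}"
      using assms by (simp add: measure_pmf.emeasure_eq_measure)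
    also have "\<dots> \<le> 1 * measure_pmf.prob \<psi> {a..}" using assms by (intro mult_right_mono) auto
    finally show ?thesis by simp
  qed
qed

text \<open>A law of mean \<sigma>' is diluted with the point mass at 0 until its mean is \<sigma>;
  it decreases stochastically, and so does \<phi>.\<close>

lemma chi_mono:
  assumes "0 \<le> \<sigma>" "\<sigma> \<le> \<sigma>'"
  shows "chi G v q \<rho> \<sigma> \<le> chi G v q \<rho> \<sigma>'"
proof (cases "\<sigma> = \<sigma>'")
  case False
  show ?thesis
  proof (rule le_chi)
    fix m \<psi> assume m: "mass_profile m \<rho>" and \<psi>: "mean_pmf \<psi> \<sigma>'"
    \<comment> \<open>The dilution ratio. Since \<open>\<sigma> \<noteq> \<sigma>'\<close> here,
      \<sigma>' is positive.\<close>
    define t where "t = \<sigma> / \<sigma>'"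
    have t: "0 \<le> t" "t \<le> 1" "t * \<sigma>' = \<sigma>" using assms False by (auto simp: t_def)
    have "mean_pmf (mix_pmf t \<psi> (return_pmf 0)) \<sigma>"
      using mean_pmf_mix[OF \<psi> mean_return_pmf t(1,2)] t(3) by simp
    then have "chi G v q \<rho> \<sigma> \<le> varphi G v q m (mix_pmf t \<psi> (return_pmf 0))" by (rule chi_le[OF m])
    also have "\<dots> \<le> varphi G v q m \<psi>" by (intro varphi_mono stoch_le_mix_return_0 t)
    finally show "chi G v q \<rho> \<sigma> \<le> varphi G v q m \<psi>" .
  qed
qed simp

section \<open>Two-sided entropy bounds and continuity of \<chi>\<close>

locale lattice_model = marked_lattice G v
  for G :: "nat \<Rightarrow> (int^'d::finite) set" and v :: "int^'d \<Rightarrow> real" +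
  fixes q :: "nat \<Rightarrow> real"
  assumes q_pos: "\<And>k. k \<ge> 1 \<Longrightarrow> 0 < q k" and q_summable: "q summable_on {1..}"
begin

definition q_total :: real where "q_total = (\<Sum>\<^sub>\<infinity>k\<in>{1..}. q k)"

lemma q_has_sum: "(q has_sum q_total) {1..}"
  unfolding q_total_def using q_summable by simp

lemma q_total_nonneg: "0 \<le> q_total"
  using q_has_sum q_pos by (intro has_sum_nonneg[OF q_has_sum]) (auto intro: less_imp_le)

lemma mean_N_particles:
  assumes P: "P \<in> shift_invariant" and \<rho>: "mass_profile m \<rho>"
    and mean: "\<And>k. k \<ge> 1 \<Longrightarrow> (\<integral>\<^sup>+\<omega>. N_mark {0} k \<omega> \<partial>P) = ennreal (m k)"
  shows "(\<integral>\<^sup>+\<omega>. N_particles {0} \<omega> \<partial>P) = ennreal \<rho>"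
proof -
  have Pc: "P \<in> config_laws" using P shift_invariant_config_laws by auto
  have Nm: "N_mark {0} k \<in> borel_measurable P" if "k \<ge> 1" for k
    using measurable_N_mark[OF that] by (simp only: measurable_cong_sets[OF config_lawsD(2)[OF Pc] refl])
  have "(\<integral>\<^sup>+\<omega>. N_particles {0} \<omega> \<partial>P) = (\<Sum>\<^sub>\<infinity>k\<in>{1..}. \<integral>\<^sup>+\<omega>. of_nat k * N_mark {0} k \<omega> \<partial>P)"
    unfolding N_particles_def using Nm by (intro nn_integral_infsum) auto
  also have "\<dots> = (\<Sum>\<^sub>\<infinity>k\<in>{1..}. ennreal (real k * m k))"
    using Nm mean mass_profileD[OF \<rho>]
    by (intro infsum_cong) (simp add: nn_integral_cmult ennreal_mult' ennreal_of_nat_eq_real_of_nat)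
  also have "\<dots> = ennreal \<rho>"
    using \<rho> by (intro has_sum_imp_infsum_ennreal) (auto simp: mass_profile_def)
  finally show ?thesis .
qed

lemma cost_poisson_process_le:
  assumes \<rho>: "mass_profile m \<rho>"
  shows "cost G v q a (poisson_process m) \<le> seq_entropy m q + ennreal (vbar v * (\<rho>\<^sup>2 + \<rho>))
    + (2 * ennreal (vbar v) * of_nat a * ennreal \<rho> + ennreal (vbar v) * of_nat a ^ 2)"
proof -
  note m = mass_profileD[OF \<rho>]
  have "(\<integral>\<^sup>+\<omega>. Phi G v {0} UNIV \<omega> \<partial>(poisson_process m)) \<le> ennreal (vbar v * (\<rho>\<^sup>2 + \<rho>))"
    using \<rho> m by (intro Phi_poisson_process_le) (auto simp: mass_profile_def)
  moreover have "(\<integral>\<^sup>+\<omega>. N_particles {0} \<omega> \<partial>(poisson_process m :: 'd config measure)) = ennreal \<rho>"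
    by (rule mean_N_particles[OF poisson_process_shift_invariant \<rho> poisson_process_mean[OF _ m]])
  moreover have "specific_entropy q (poisson_process m :: 'd config measure) = seq_entropy m q"
    by (rule specific_entropy_poisson_process[OF q_pos m])
  ultimately show ?thesis unfolding cost_def by (auto simp: add.assoc intro!: add_mono)
qed

lemma varphi_le_poisson:
  assumes \<rho>: "mass_profile m \<rho>"
  shows "varphi G v q m \<psi> \<le> seq_entropy m q + ennreal (vbar v * (\<rho>\<^sup>2 + \<rho>))
    + (\<integral>\<^sup>+a. 2 * ennreal (vbar v) * of_nat a * ennreal \<rho> + ennreal (vbar v) * of_nat a ^ 2 \<partial>measure_pmf \<psi>)"
proof -
  have "admissible m \<psi> (\<lambda>_. poisson_process m :: 'd config measure)"
    using poisson_process_mean[OF _ mass_profileD[OF \<rho>]]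
    by (auto simp: admissible_def poisson_process_shift_invariant measure_pmf.emeasure_space_1)
  then have "varphi G v q m \<psi> \<le> (\<integral>\<^sup>+a. cost G v q a (poisson_process m) \<partial>measure_pmf \<psi>)" by (rule varphi_le)
  also have "\<dots> \<le> (\<integral>\<^sup>+a. seq_entropy m q + ennreal (vbar v * (\<rho>\<^sup>2 + \<rho>))
    + (2 * ennreal (vbar v) * of_nat a * ennreal \<rho> + ennreal (vbar v) * of_nat a ^ 2) \<partial>measure_pmf \<psi>)"
    by (intro nn_integral_mono cost_poisson_process_le \<rho>)
  also have "\<dots> = seq_entropy m q + ennreal (vbar v * (\<rho>\<^sup>2 + \<rho>))
    + (\<integral>\<^sup>+a. 2 * ennreal (vbar v) * of_nat a * ennreal \<rho> + ennreal (vbar v) * of_nat a ^ 2 \<partial>measure_pmf \<psi>)"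
    by (subst nn_integral_add) (simp_all add: measure_pmf.emeasure_space_1)
  finally show ?thesis .
qed

text \<open>The \<psi>-average of a competing family is a shift-invariant law of intensity m, so its
  entropy density is at least \<open>seq_entropy m q\<close>, and by convexity so is the averaged
  entropy of the family. The quadratic term is retained because it must cancel exactly when two
  masses are compared under the same \<psi>.\<close>

lemma varphi_ge_entropy:
  assumes m: "\<And>k. k \<ge> 1 \<Longrightarrow> 0 \<le> m k"
  shows "seq_entropy m q + (\<integral>\<^sup>+a. ennreal (vbar v) * of_nat a ^ 2 \<partial>measure_pmf \<psi>) \<le> varphi G v q m \<psi>"
proof (rule le_varphi)
  fix P :: "nat \<Rightarrow> 'd config measure" assume P: "admissible m \<psi> P"
  then have Ps: "P a \<in> shift_invariant" for a by (auto simp: admissible_def)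
  let ?B = "measure_pmf \<psi> \<bind> P"
  have B: "?B \<in> shift_invariant" by (rule shift_invariant_bind[OF Ps])
  have "(\<integral>\<^sup>+\<omega>. N_mark {0} k \<omega> \<partial>?B) = ennreal (m k)" if "k \<ge> 1" for k
    using P that by (simp add: nn_integral_config_bind[OF Ps measurable_N_mark[OF that]] admissible_def)
  then have "seq_entropy m q \<le> specific_entropy q ?B"
    by (subst specific_entropy_change[OF B q_pos m]) auto
  also have "\<dots> \<le> (\<integral>\<^sup>+a. specific_entropy q (P a) \<partial>measure_pmf \<psi>)" by (rule specific_entropy_bind_le[OF Ps])
  finally have "seq_entropy m q + (\<integral>\<^sup>+a. ennreal (vbar v) * of_nat a ^ 2 \<partial>measure_pmf \<psi>)
     \<le> (\<integral>\<^sup>+a. specific_entropy q (P a) + ennreal (vbar v) * of_nat a ^ 2 \<partial>measure_pmf \<psi>)"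
    by (simp add: nn_integral_add add_right_mono)
  also have "\<dots> \<le> (\<integral>\<^sup>+a. cost G v q a (P a) \<partial>measure_pmf \<psi>)"
    unfolding cost_def by (intro nn_integral_mono add_right_mono) (simp add: add.assoc)
  finally show "seq_entropy m q + (\<integral>\<^sup>+a. ennreal (vbar v) * of_nat a ^ 2 \<partial>measure_pmf \<psi>) \<le> (\<integral>\<^sup>+a. cost G v q a (P a) \<partial>measure_pmf \<psi>)" .
qed

lemma seq_entropy_zero:
  assumes "\<And>k. k \<ge> 1 \<Longrightarrow> m k = 0"
  shows "seq_entropy m q = ennreal q_total"
proof -
  have "seq_entropy m q = (\<Sum>\<^sub>\<infinity>k\<in>{1..}. ennreal (q k))"
    unfolding seq_entropy_def using assms by (intro infsum_cong) simp
  also have "\<dots> = ennreal q_total"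
    using q_pos by (intro has_sum_imp_infsum_ennreal[OF q_has_sum]) (auto intro: less_imp_le)
  finally show ?thesis .
qed

text \<open>All mass sits in marks of size 1. This profile has explicit finite entropy for every
  \<rho>, and its \<open>\<rho> ln \<rho>\<close> behaviour is what produces the infinite slope at
  0.\<close>

definition monomer :: "real \<Rightarrow> nat \<Rightarrow> real" where
  "monomer \<rho> k = (if k = 1 then \<rho> else 0)"

lemma mass_profile_monomer: "0 \<le> \<rho> \<Longrightarrow> mass_profile (monomer \<rho>) \<rho>"
proof -
  assume "0 \<le> \<rho>"
  have "((\<lambda>k. real k * monomer \<rho> k) has_sum \<rho>) {1}" by (rule has_sum_finiteI) (auto simp: monomer_def)
  then have "((\<lambda>k. real k * monomer \<rho> k) has_sum \<rho>) {1..}"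
    by (subst has_sum_cong_neutral[of "{1}" "{1..}"]) (auto simp: monomer_def)
  then show ?thesis using \<open>0 \<le> \<rho>\<close> by (auto simp: mass_profile_def monomer_def)
qed

lemma seq_entropy_monomer:
  assumes "0 \<le> \<rho>"
  shows "seq_entropy (monomer \<rho>) q = ennreal (q_total - \<rho> + \<rho> * ln (\<rho> / q 1))"
    and "0 \<le> q_total - \<rho> + \<rho> * ln (\<rho> / q 1)"
proof -
  let ?c = "\<lambda>k::nat. if k = 1 then - \<rho> + \<rho> * ln (\<rho> / q 1) else 0"
  have "(?c has_sum (- \<rho> + \<rho> * ln (\<rho> / q 1))) {1}" by (rule has_sum_finiteI) auto
  then have "(?c has_sum (- \<rho> + \<rho> * ln (\<rho> / q 1))) {1..}"
    by (subst has_sum_cong_neutral[of "{1}" "{1..}"]) auto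
  from has_sum_add[OF q_has_sum this]
  have s: "((\<lambda>k. ent_term (monomer \<rho>) q k) has_sum (q_total - \<rho> + \<rho> * ln (\<rho> / q 1))) {1..}"
    by (subst has_sum_cong[where g="\<lambda>k. q k + ?c k"]) (auto simp: monomer_def algebra_simps)
  have nn: "0 \<le> ent_term (monomer \<rho>) q k" if "k \<in> {1..}" for k
    using that assms by (intro ent_term_nonneg q_pos) (auto simp: monomer_def)
  show "seq_entropy (monomer \<rho>) q = ennreal (q_total - \<rho> + \<rho> * ln (\<rho> / q 1))"
    unfolding seq_entropy_def by (rule has_sum_imp_infsum_ennreal[OF s nn])
  show "0 \<le> q_total - \<rho> + \<rho> * ln (\<rho> / q 1)" by (rule has_sum_nonneg[OF s nn])
qed

lemma chi_finite:
  assumes "0 \<le> \<rho>" "0 \<le> \<sigma>"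
  shows "chi G v q \<rho> \<sigma> < top"
proof -
  have "chi G v q \<rho> \<sigma> \<le> varphi G v q (monomer \<rho>) (poisson_law \<sigma>)"
    using assms by (intro chi_le mass_profile_monomer mean_poisson_law)
  also have "\<dots> \<le> seq_entropy (monomer \<rho>) q + ennreal (vbar v * (\<rho>\<^sup>2 + \<rho>))
    + (\<integral>\<^sup>+a. 2 * ennreal (vbar v) * of_nat a * ennreal \<rho> + ennreal (vbar v) * of_nat a ^ 2 \<partial>measure_pmf (poisson_law \<sigma>))"
    using assms by (intro varphi_le_poisson mass_profile_monomer)
  also have "(\<integral>\<^sup>+a. 2 * ennreal (vbar v) * of_nat a * ennreal \<rho> + ennreal (vbar v) * of_nat a ^ 2 \<partial>measure_pmf (poisson_law \<sigma>))
    = 2 * ennreal (vbar v) * ennreal \<sigma> * ennreal \<rho> + ennreal (vbar v) * ennreal (\<sigma>\<^sup>2 + \<sigma>)"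
    using assms by (simp add: nn_integral_add nn_integral_cmult nn_integral_multc nn_integral_poisson_law power2_eq_square)
  also have "seq_entropy (monomer \<rho>) q + ennreal (vbar v * (\<rho>\<^sup>2 + \<rho>)) + \<dots> < top"
    using assms by (auto simp: seq_entropy_monomer ennreal_mult_less_top less_top)
  finally show ?thesis .
qed

text \<open>Lower semicontinuity of \<open>\<chi>\<close> at \<open>\<rho>\<^sub>m\<^sub>i = 0\<close>: the slopes \<open>- C k\<close> are used in the Legendre bound
  \<open>ent_term_ge\<close>, and C is then chosen large.\<close>

lemma q_total_le_seq_entropy:
  assumes \<rho>: "mass_profile m \<rho>" and C: "0 \<le> C"
  shows "ennreal q_total \<le> seq_entropy m q + ennreal (exp (- C) * q_total + C * \<rho>)"
proof -
  have sm: "(f :: nat \<Rightarrow> ennreal) summable_on A" for f A by (rule nonneg_summable_on_complete) simp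
  let ?r = "\<lambda>k. exp (- C) * q k + C * (real k * m k)"
  have pt: "ennreal (q k) \<le> ennreal (ent_term m q k) + ennreal (?r k)" if "k \<in> {1..}" for k
  proof -
    have k: "k \<ge> 1" using that by simp
    note q = q_pos[OF k] and m = mass_profileD[OF \<rho> k]
    have "C * 1 \<le> C * real k" using C k by (intro mult_left_mono) auto
    then have "exp (- C * real k) \<le> exp (- C)" by simp
    then have "q k * exp (- C * real k) \<le> q k * exp (- C)" using q by (intro mult_left_mono) auto
    moreover have "m k * (- C * real k) + q k * (1 - exp (- C * real k)) \<le> ent_term m q k"
      by (rule ent_term_ge[of q k m, OF q m])
    ultimately have "q k \<le> ent_term m q k + ?r k" by (simp add: algebra_simps)
    then have "ennreal (q k) \<le> ennreal (ent_term m q k + ?r k)" by (rule ennreal_leI)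
    then show ?thesis using ent_term_nonneg[of q k m, OF q m] q m C by (simp add: ennreal_plus)
  qed
  have "ennreal q_total = (\<Sum>\<^sub>\<infinity>k\<in>{1..}. ennreal (q k))"
    using q_pos by (intro has_sum_imp_infsum_ennreal[symmetric] q_has_sum) (auto intro: less_imp_le)
  also have "\<dots> \<le> (\<Sum>\<^sub>\<infinity>k\<in>{1..}. ennreal (ent_term m q k) + ennreal (?r k))"
    by (rule infsum_mono[OF sm sm pt])
  also have "\<dots> = seq_entropy m q + (\<Sum>\<^sub>\<infinity>k\<in>{1..}. ennreal (?r k))"
    unfolding seq_entropy_def by (rule infsum_add[OF sm sm])
  also have "(\<Sum>\<^sub>\<infinity>k\<in>{1..}. ennreal (?r k)) = ennreal (exp (- C) * q_total + C * \<rho>)"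
  proof (rule has_sum_imp_infsum_ennreal)
    show "(?r has_sum (exp (- C) * q_total + C * \<rho>)) {1..}"
      using \<rho> by (intro has_sum_add has_sum_cmult_right q_has_sum) (simp add: mass_profile_def)
    show "0 \<le> ?r k" if "k \<in> {1..}" for k
      using that C q_pos[of k] mass_profileD[OF \<rho>, of k] by simp
  qed
  finally show ?thesis .
qed

text \<open>A pair \<open>(m, \<psi>)\<close> is compared with the empty profile under the same
  \<psi>. At mass 0 the Poisson upper bound reduces to \<open>q_total\<close> plus the quadratic
  term in a; the lower bound for \<open>(m, \<psi>)\<close> contains the same quadratic term, so
  only the entropies have to be compared.\<close>

lemma chi_zero_left_le:
  assumes C: "0 \<le> C"
  shows "chi G v q 0 \<sigma> \<le> ennreal (exp (- C) * q_total + C * \<rho>) + chi G v q \<rho> \<sigma>"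
proof -
  have "chi G v q 0 \<sigma> \<le> ennreal (exp (- C) * q_total + C * \<rho>) + 1 * chi G v q \<rho> \<sigma>"
    unfolding chi_eq[of G v q \<rho>]
  proof (rule le_add_mult_Inf)
    fix x assume "x \<in> {varphi G v q m \<psi> | m \<psi>. mass_profile m \<rho> \<and> mean_pmf \<psi> \<sigma>}"
    then obtain m \<psi> where m: "mass_profile m \<rho>" "mean_pmf \<psi> \<sigma>" "x = varphi G v q m \<psi>" by auto
    have z: "mass_profile (\<lambda>_. 0) 0" by (simp add: mass_profile_def)
    let ?A = "\<integral>\<^sup>+a. ennreal (vbar v) * of_nat a ^ 2 \<partial>measure_pmf \<psi>"
    have "chi G v q 0 \<sigma> \<le> varphi G v q (\<lambda>_. 0) \<psi>" by (rule chi_le[OF z m(2)])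
    also have "\<dots> \<le> seq_entropy (\<lambda>_. 0) q + ?A" using varphi_le_poisson[OF z] by simp
    also have "\<dots> = ennreal q_total + ?A" by (simp add: seq_entropy_zero)
    also have "\<dots> \<le> (seq_entropy m q + ennreal (exp (- C) * q_total + C * \<rho>)) + ?A"
      by (intro add_right_mono q_total_le_seq_entropy m(1) C)
    also have "\<dots> = ennreal (exp (- C) * q_total + C * \<rho>) + 1 * (seq_entropy m q + ?A)" by (simp add: add_ac)
    also have "\<dots> \<le> ennreal (exp (- C) * q_total + C * \<rho>) + 1 * x"
      unfolding m(3) using varphi_ge_entropy[of m \<psi>] mass_profileD[OF m(1)] by (intro add_left_mono mult_left_mono) auto
    finally show "chi G v q 0 \<sigma> \<le> ennreal (exp (- C) * q_total + C * \<rho>) + 1 * x" .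
  qed auto
  then show ?thesis by simp
qed

abbreviation chi_real :: "real \<Rightarrow> real \<Rightarrow> real" where
  "chi_real \<rho> \<sigma> \<equiv> enn2real (chi G v q \<rho> \<sigma>)"

lemma chi_eq_real: "0 \<le> \<rho> \<Longrightarrow> 0 \<le> \<sigma> \<Longrightarrow> chi G v q \<rho> \<sigma> = ennreal (chi_real \<rho> \<sigma>)"
  using chi_finite[of \<rho> \<sigma>] by (simp add: ennreal_enn2real_if)

lemma chi_real_le: "0 \<le> c \<Longrightarrow> chi G v q \<rho> \<sigma> \<le> ennreal c \<Longrightarrow> chi_real \<rho> \<sigma> \<le> c"
  by (metis enn2real_ennreal enn2real_mono ennreal_less_top)

lemma chi_real_convex:
  assumes "0 < t" "t < 1" "0 \<le> \<rho>1" "0 \<le> \<rho>2" "0 \<le> \<sigma>1" "0 \<le> \<sigma>2"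
  shows "chi_real (t * \<rho>1 + (1 - t) * \<rho>2) (t * \<sigma>1 + (1 - t) * \<sigma>2) \<le> t * chi_real \<rho>1 \<sigma>1 + (1 - t) * chi_real \<rho>2 \<sigma>2"
proof (rule chi_real_le)
  have "chi G v q (t * \<rho>1 + (1 - t) * \<rho>2) (t * \<sigma>1 + (1 - t) * \<sigma>2)
     \<le> ennreal t * ennreal (chi_real \<rho>1 \<sigma>1) + ennreal (1 - t) * ennreal (chi_real \<rho>2 \<sigma>2)"
    using chi_convex[OF assms(1,2), of G v q \<rho>1 \<rho>2 \<sigma>1 \<sigma>2] assms by (simp add: chi_eq_real[symmetric])
  also have "\<dots> = ennreal (t * chi_real \<rho>1 \<sigma>1 + (1 - t) * chi_real \<rho>2 \<sigma>2)"
    using assms by (subst ennreal_plus) (auto simp: ennreal_mult)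
  finally show "chi G v q (t * \<rho>1 + (1 - t) * \<rho>2) (t * \<sigma>1 + (1 - t) * \<sigma>2) \<le> ennreal (t * chi_real \<rho>1 \<sigma>1 + (1 - t) * chi_real \<rho>2 \<sigma>2)" .
qed (use assms in simp)

lemma chi_real_convex_on: "convex_on ({0..} \<times> {0..}) (\<lambda>(\<rho>, \<sigma>). chi_real \<rho> \<sigma>)"
proof (rule convex_onI)
  fix t :: real and x y :: "real \<times> real"
  assume t: "0 < t" "t < 1" and xy: "x \<in> {0..} \<times> {0..}" "y \<in> {0..} \<times> {0..}"
  then show "(case (1 - t) *\<^sub>R x + t *\<^sub>R y of (\<rho>, \<sigma>) \<Rightarrow> chi_real \<rho> \<sigma>)
     \<le> (1 - t) * (case x of (\<rho>, \<sigma>) \<Rightarrow> chi_real \<rho> \<sigma>) + t * (case y of (\<rho>, \<sigma>) \<Rightarrow> chi_real \<rho> \<sigma>)"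
    using chi_real_convex[of "1 - t" "fst x" "fst y" "snd x" "snd y"] by (auto simp: case_prod_unfold)
qed (intro convex_Times convex_real_interval)

lemma chi_real_convex_on_left: "0 \<le> \<sigma> \<Longrightarrow> convex_on {0..} (\<lambda>\<rho>. chi_real \<rho> \<sigma>)"
proof (rule convex_onI)
  fix t x y :: real
  assume "0 \<le> \<sigma>" "0 < t" "t < 1" "x \<in> {0..}" "y \<in> {0..}"
  moreover have "(1 - t) * \<sigma> + t * \<sigma> = \<sigma>" by (simp add: algebra_simps)
  ultimately show "chi_real ((1 - t) *\<^sub>R x + t *\<^sub>R y) \<sigma> \<le> (1 - t) * chi_real x \<sigma> + t * chi_real y \<sigma>"
    using chi_real_convex[of "1 - t" x y \<sigma> \<sigma>] by simp
qed (rule convex_real_interval)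

lemma chi_real_convex_on_right: "0 \<le> \<rho> \<Longrightarrow> convex_on {0..} (chi_real \<rho>)"
proof (rule convex_onI)
  fix t x y :: real
  assume "0 \<le> \<rho>" "0 < t" "t < 1" "x \<in> {0..}" "y \<in> {0..}"
  moreover have "(1 - t) * \<rho> + t * \<rho> = \<rho>" by (simp add: algebra_simps)
  ultimately show "chi_real \<rho> ((1 - t) *\<^sub>R x + t *\<^sub>R y) \<le> (1 - t) * chi_real \<rho> x + t * chi_real \<rho> y"
    using chi_real_convex[of "1 - t" \<rho> \<rho> x y] by simp
qed (rule convex_real_interval)

lemma chi_real_mono:
  assumes "0 \<le> \<rho>" "0 \<le> \<sigma>" "\<sigma> \<le> \<sigma>'"
  shows "chi_real \<rho> \<sigma> \<le> chi_real \<rho> \<sigma>'"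
  using chi_mono[OF assms(2,3), of G v q \<rho>] chi_finite[of \<rho> \<sigma>'] assms by (intro enn2real_mono) auto

text \<open>The error in the comparison with mass 0 has a part that is small for large C and a part
  that is small for small mass once C is fixed.\<close>

lemma chi_real_continuous_left:
  assumes \<sigma>: "0 \<le> \<sigma>"
  shows "continuous_on {0..} (\<lambda>\<rho>. chi_real \<rho> \<sigma>)"
proof (rule convex_on_continuous_halfline[OF chi_real_convex_on_left[OF \<sigma>]])
  fix e :: real assume e: "0 < e"
  \<comment> \<open>Chosen so that \<open>exp (- C) * q_total < e / 2\<close>; the summand 1 keeps
    the argument of the logarithm positive. The radius \<open>e / (2 * (C + 1))\<close> then makes
    \<open>C * t\<close> smaller than the other half, also when C = 0.\<close>
  define C where "C = max 0 (ln (2 * (q_total + 1) / e))"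
  have C: "0 \<le> C" by (simp add: C_def)
  have 1: "exp (- C) * q_total < e / 2"
  proof -
    have "2 * (q_total + 1) / e = exp (ln (2 * (q_total + 1) / e))" using e q_total_nonneg by simp
    also have "\<dots> \<le> exp C" by (simp add: C_def)
    finally have "2 * (q_total + 1) \<le> exp C * e" using e by (simp add: pos_divide_le_eq)
    then have "2 * q_total < exp C * e" by simp
    then show ?thesis by (simp add: exp_minus field_simps)
  qed
  have 2: "chi_real 0 \<sigma> \<le> exp (- C) * q_total + C * t + chi_real t \<sigma>" if "0 \<le> t" for t
  proof (rule chi_real_le)
    show nn: "0 \<le> exp (- C) * q_total + C * t + chi_real t \<sigma>" using that C q_total_nonneg by simp
    have "chi G v q 0 \<sigma> \<le> ennreal (exp (- C) * q_total + C * t) + ennreal (chi_real t \<sigma>)"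
      using chi_zero_left_le[OF C, of \<sigma> t] that \<sigma> by (simp add: chi_eq_real[symmetric])
    then show "chi G v q 0 \<sigma> \<le> ennreal (exp (- C) * q_total + C * t + chi_real t \<sigma>)"
      using that C q_total_nonneg by (subst ennreal_plus) auto
  qed
  have 3: "C * t < e / 2" if "t < e / (2 * (C + 1))" "0 \<le> t" for t
  proof -
    have "C * t \<le> (C + 1) * t" using that by (simp add: algebra_simps)
    also have "\<dots> < e / 2" using that C by (simp add: field_simps)
    finally show ?thesis .
  qed
  have "chi_real 0 \<sigma> - e < chi_real t \<sigma>" if "0 \<le> t" "t < e / (2 * (C + 1))" for t
    using 1 2[OF that(1)] 3[OF that(2,1)] by linarith
  then show "\<exists>d>0. \<forall>t. 0 \<le> t \<and> t < d \<longrightarrow> chi_real 0 \<sigma> - e < chi_real t \<sigma>"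
    using e C by (intro exI[of _ "e / (2 * (C + 1))"]) auto
qed

text \<open>In the second variable, lower semicontinuity at 0 is immediate from monotonicity, since
  the value at 0 is the smallest.\<close>

lemma chi_real_continuous: "continuous_on ({0..} \<times> {0..}) (\<lambda>(\<rho>, \<sigma>). chi_real \<rho> \<sigma>)"
proof (rule continuous_on_quadrant_separately_mono)
  show "continuous_on {0..} (chi_real \<rho>)" if "0 \<le> \<rho>" for \<rho>
  proof (rule convex_on_continuous_halfline[OF chi_real_convex_on_right[OF that]])
    fix e :: real assume "0 < e"
    moreover have "chi_real \<rho> 0 \<le> chi_real \<rho> t" if "0 \<le> t" for t by (rule chi_real_mono) (use that \<open>0 \<le> \<rho>\<close> in auto)
    ultimately show "\<exists>d>0. \<forall>t. 0 \<le> t \<and> t < d \<longrightarrow> chi_real \<rho> 0 - e < chi_real \<rho> t"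
      by (intro exI[of _ 1]) (auto intro: less_le_trans[of _ "chi_real \<rho> 0"])
  qed
qed (auto intro: chi_real_continuous_left chi_real_mono)

section \<open>Values, slope and bounds without macroscopic mass\<close>

lemma chi_le_seq_entropy:
  assumes "mass_profile m \<rho>"
  shows "chi G v q \<rho> 0 \<le> seq_entropy m q + ennreal (vbar v * (\<rho>\<^sup>2 + \<rho>))"
  using order_trans[OF chi_le[OF assms mean_return_pmf] varphi_le_poisson[OF assms]] by simp

lemma chi_0_0: "chi G v q 0 0 = ennreal q_total"
proof (rule antisym)
  have z: "mass_profile (\<lambda>_. 0) 0" by (simp add: mass_profile_def)
  show "chi G v q 0 0 \<le> ennreal q_total"
    using chi_le_seq_entropy[OF z] by (simp add: seq_entropy_zero)
  show "ennreal q_total \<le> chi G v q 0 0"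
  proof (rule le_chi)
    fix m \<psi> assume m: "mass_profile m 0"
    have "ennreal q_total = seq_entropy m q" using mass_profile_zero[OF m] by (simp add: seq_entropy_zero)
    also have "\<dots> \<le> seq_entropy m q + (\<integral>\<^sup>+a. ennreal (vbar v) * of_nat a ^ 2 \<partial>measure_pmf \<psi>)" by simp
    also have "\<dots> \<le> varphi G v q m \<psi>" by (rule varphi_ge_entropy[OF mass_profileD[OF m]])
    finally show "ennreal q_total \<le> varphi G v q m \<psi>" .
  qed
qed

text \<open>The Poisson process of monomers bounds the difference quotient from above by
  \<open>ln \<rho>\<close> plus a term that stays bounded as \<rho> tends to 0.\<close>

lemma chi_right_derivative_at_0:
  "filterlim (\<lambda>\<rho>. (chi_real \<rho> 0 - chi_real 0 0) / \<rho>) at_bot (at_right 0)"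
proof (rule filterlim_at_bot_mono)
  have q1: "0 < q 1" by (rule q_pos) simp
  have "((\<lambda>\<rho>. - 1 - ln (q 1) + vbar v * (\<rho> + 1)) \<longlongrightarrow> - 1 - ln (q 1) + vbar v * (0 + 1)) (at_right 0)"
    by (intro tendsto_intros)
  then show "filterlim (\<lambda>\<rho>. (- 1 - ln (q 1) + vbar v * (\<rho> + 1)) + ln \<rho>) at_bot (at_right 0)"
    by (rule filterlim_tendsto_add_at_bot_iff[THEN iffD2, OF _ ln_at_0])
  show "eventually (\<lambda>\<rho>. (chi_real \<rho> 0 - chi_real 0 0) / \<rho> \<le> (- 1 - ln (q 1) + vbar v * (\<rho> + 1)) + ln \<rho>) (at_right 0)"
    using eventually_at_right_less[of 0]
  proof eventually_elim
    case (elim \<rho>)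
    then have \<rho>: "0 \<le> \<rho>" by simp
    note s = seq_entropy_monomer[OF \<rho>]
    have b: "0 \<le> vbar v * (\<rho>\<^sup>2 + \<rho>)" using \<rho> vbar_nonneg by simp
    have "chi_real \<rho> 0 \<le> (q_total - \<rho> + \<rho> * ln (\<rho> / q 1)) + vbar v * (\<rho>\<^sup>2 + \<rho>)"
    proof (rule chi_real_le)
      show "chi G v q \<rho> 0 \<le> ennreal ((q_total - \<rho> + \<rho> * ln (\<rho> / q 1)) + vbar v * (\<rho>\<^sup>2 + \<rho>))"
        using chi_le_seq_entropy[OF mass_profile_monomer[OF \<rho>]] unfolding s(1) ennreal_plus[OF s(2) b] .
    qed (use s(2) b in simp)
    moreover have "chi_real 0 0 = q_total" by (simp add: chi_0_0 q_total_nonneg)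
    ultimately have "chi_real \<rho> 0 - chi_real 0 0 \<le> \<rho> * ((- 1 - ln (q 1) + vbar v * (\<rho> + 1)) + ln \<rho>)"
      using elim q1 by (simp add: ln_div algebra_simps power2_eq_square)
    then show ?case using elim by (simp add: pos_divide_le_eq mult.commute)
  qed
qed

text \<open>With v = 0 the same assumptions hold, so all bounds of the model also apply to the free
  functional.\<close>

lemma lattice_model_noninteracting: "lattice_model G (\<lambda>_. 0) q"
  using card_mark q_pos q_summable by unfold_locales auto

lemma cost_noninteracting: "cost G (\<lambda>_. 0) q a P = specific_entropy q P"
  by (simp add: cost_def Phi_def mark_interaction_def vbar_def case_prod_unfold)

text \<open>Mean 0 forces \<psi> to be the point mass at 0, so only \<open>P 0\<close> counts. The
  same law competes in the free problem, and its interaction energy is bounded below by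
  \<open>Phi_ge\<close>.\<close>

lemma chi_ge_noninteracting:
  assumes v0: "2 * v 0 \<ge> vbar v"
  shows "chi G (\<lambda>_. 0) q \<rho> 0 + ennreal (vbar v * \<rho>\<^sup>2) \<le> chi G v q \<rho> 0"
proof (rule le_chi)
  fix m \<psi> assume m: "mass_profile m \<rho>" and "mean_pmf \<psi> 0"
  then have \<psi>: "\<psi> = return_pmf 0" by (simp add: mean_pmf_zero)
  show "chi G (\<lambda>_. 0) q \<rho> 0 + ennreal (vbar v * \<rho>\<^sup>2) \<le> varphi G v q m \<psi>"
  proof (rule le_varphi)
    fix P :: "nat \<Rightarrow> 'd config measure" assume P: "admissible m \<psi> P"
    then have P0: "P 0 \<in> shift_invariant" "\<And>k. k \<ge> 1 \<Longrightarrow> (\<integral>\<^sup>+\<omega>. N_mark {0} k \<omega> \<partial>P 0) = ennreal (m k)"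
      by (auto simp: admissible_def \<psi>)
    have "chi G (\<lambda>_. 0) q \<rho> 0 \<le> varphi G (\<lambda>_. 0) q m \<psi>"
      unfolding \<psi> by (rule chi_le[OF m mean_return_pmf])
    also have "\<dots> \<le> (\<integral>\<^sup>+a. cost G (\<lambda>_. 0) q a (P a) \<partial>measure_pmf \<psi>)" by (rule varphi_le[OF P])
    also have "\<dots> = specific_entropy q (P 0)" by (simp add: \<psi> cost_noninteracting)
    finally have "chi G (\<lambda>_. 0) q \<rho> 0 + ennreal (vbar v * \<rho>\<^sup>2) \<le> specific_entropy q (P 0) + (\<integral>\<^sup>+\<omega>. Phi G v {0} UNIV \<omega> \<partial>P 0)"
      using m by (intro add_mono Phi_ge[OF P0(1) _ P0(2) _ v0]) (auto simp: mass_profile_def)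
    also have "\<dots> = (\<integral>\<^sup>+a. cost G v q a (P a) \<partial>measure_pmf \<psi>)" by (simp add: \<psi> cost_def)
    finally show "chi G (\<lambda>_. 0) q \<rho> 0 + ennreal (vbar v * \<rho>\<^sup>2) \<le> (\<integral>\<^sup>+a. cost G v q a (P a) \<partial>measure_pmf \<psi>)" .
  qed
qed

text \<open>For each profile m the free problem costs at least \<open>seq_entropy m q\<close>, and
  the Poisson process of intensity m realises this entropy in the interacting problem at an extra
  energy that depends on \<rho> only.\<close>

lemma chi_le_noninteracting:
  "chi G v q \<rho> 0 \<le> chi G (\<lambda>_. 0) q \<rho> 0 + ennreal (vbar v * (\<rho>\<^sup>2 + \<rho>))"
proof -
  interpret free: lattice_model G "\<lambda>_. 0" q by (rule lattice_model_noninteracting)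
  have "chi G v q \<rho> 0 \<le> ennreal (vbar v * (\<rho>\<^sup>2 + \<rho>)) + 1 * chi G (\<lambda>_. 0) q \<rho> 0"
    unfolding chi_eq[of G "\<lambda>_. 0"]
  proof (rule le_add_mult_Inf)
    fix x assume "x \<in> {varphi G (\<lambda>_. 0) q m \<psi> | m \<psi>. mass_profile m \<rho> \<and> mean_pmf \<psi> 0}"
    then obtain m \<psi> where m: "mass_profile m \<rho>" "x = varphi G (\<lambda>_. 0) q m \<psi>" by auto
    have "seq_entropy m q \<le> x"
      using order_trans[OF _ free.varphi_ge_entropy[OF mass_profileD[OF m(1)], where \<psi>=\<psi>], of "seq_entropy m q"] by (simp add: m(2))
    then show "chi G v q \<rho> 0 \<le> ennreal (vbar v * (\<rho>\<^sup>2 + \<rho>)) + 1 * x"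
      using order_trans[OF chi_le_seq_entropy[OF m(1)] add_right_mono] by (simp add: add.commute)
  qed auto
  then show ?thesis by (simp add: add.commute)
qed

end

theorem lemma2p2:
  fixes G :: "nat \<Rightarrow> (int^'d::finite) set"
    and v :: "int^'d \<Rightarrow> real"
    and q :: "nat \<Rightarrow> real"
  assumes marks: "\<And>k. k \<ge> 1 \<Longrightarrow> card (G k) = k \<and>
      (\<exists>L. lattice_box L \<subseteq> G k \<and> G k \<subseteq> lattice_box (L + 1))"
    and v_nonneg: "\<And>x. 0 \<le> v x"
    and v_sym: "\<And>x. v (- x) = v x"
    and v_supp: "finite {x. v x \<noteq> 0}"
    and q_pos: "\<And>k. k \<ge> 1 \<Longrightarrow> 0 < q k"
    and q_summable: "q summable_on {1..}"
  shows
    "(\<forall>m\<^sub>1 m\<^sub>2 \<psi>\<^sub>1 \<psi>\<^sub>2 \<psi> t. (\<forall>k\<ge>1. 0 \<le> m\<^sub>1 k \<and> 0 \<le> m\<^sub>2 k) \<longrightarrow> 0 \<le> t \<longrightarrow> t \<le> 1 \<longrightarrow>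
        (\<forall>a. pmf \<psi> a = t * pmf \<psi>\<^sub>1 a + (1 - t) * pmf \<psi>\<^sub>2 a) \<longrightarrow>
        varphi G v q (\<lambda>k. t * m\<^sub>1 k + (1 - t) * m\<^sub>2 k) \<psi>
          \<le> ennreal t * varphi G v q m\<^sub>1 \<psi>\<^sub>1 + ennreal (1 - t) * varphi G v q m\<^sub>2 \<psi>\<^sub>2)
     \<and>
     (\<forall>\<rho>mi\<ge>0. \<forall>\<rho>ma\<ge>0. chi G v q \<rho>mi \<rho>ma < \<infinity>) \<and>
     convex_on ({0..} \<times> {0..}) (\<lambda>(\<rho>mi, \<rho>ma). enn2real (chi G v q \<rho>mi \<rho>ma)) \<and>
     continuous_on ({0..} \<times> {0..}) (\<lambda>(\<rho>mi, \<rho>ma). enn2real (chi G v q \<rho>mi \<rho>ma)) \<and>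
     convex_on {0..} (\<lambda>\<rho>. enn2real (chi G v q \<rho> 0))
     \<and>
     (\<forall>m \<psi> \<psi>'. (\<forall>k\<ge>1. 0 \<le> m k) \<longrightarrow> \<psi> \<le>\<^sub>s\<^sub>t \<psi>' \<longrightarrow> varphi G v q m \<psi> \<le> varphi G v q m \<psi>')
     \<and>
     (\<forall>\<rho>mi\<ge>0. \<forall>\<rho>ma\<ge>0. \<forall>\<rho>ma'\<ge>\<rho>ma. chi G v q \<rho>mi \<rho>ma \<le> chi G v q \<rho>mi \<rho>ma')
     \<and>
     (\<forall>m. (\<forall>k\<ge>1. 0 \<le> m k) \<longrightarrow>
        (\<forall>P\<in>(shift_invariant :: 'd config measure set).
           (\<forall>k\<ge>1. (\<integral>\<^sup>+\<omega>. N_mark {0} k \<omega> \<partial>P) = ennreal (m k)) \<longrightarrow>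
           specific_entropy q P = seq_entropy m q + specific_entropy m P) \<and>
        specific_entropy q (poisson_process m :: 'd config measure) = seq_entropy m q)
     \<and>
     chi G v q 0 0 = ennreal (\<Sum>\<^sub>\<infinity>k\<in>{1..}. q k) \<and>
     chi G (\<lambda>_. 0) q 0 0 = ennreal (\<Sum>\<^sub>\<infinity>k\<in>{1..}. q k) \<and>
     filterlim (\<lambda>\<rho>. (enn2real (chi G v q \<rho> 0) - enn2real (chi G v q 0 0)) / \<rho>) at_bot (at_right 0)
     \<and>
     (\<forall>\<rho>\<ge>0.
        (2 * v 0 \<ge> vbar v \<longrightarrow>
           chi G (\<lambda>_. 0) q \<rho> 0 + ennreal (vbar v * \<rho>\<^sup>2) \<le> chi G v q \<rho> 0) \<and>
        chi G v q \<rho> 0 \<le> chi G (\<lambda>_. 0) q \<rho> 0 + ennreal (vbar v * (\<rho>\<^sup>2 + \<rho>)))"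
proof -
  interpret lattice_model G v q
    using marks v_nonneg v_sym v_supp q_pos q_summable by unfold_locales auto
  interpret free: lattice_model G "\<lambda>_. 0" q by (rule lattice_model_noninteracting)
  have convex: "\<forall>m\<^sub>1 m\<^sub>2 \<psi>\<^sub>1 \<psi>\<^sub>2 \<psi> t. (\<forall>k\<ge>1. 0 \<le> m\<^sub>1 k \<and> 0 \<le> m\<^sub>2 k) \<longrightarrow> 0 \<le> t \<longrightarrow> t \<le> 1 \<longrightarrow>
        (\<forall>a. pmf \<psi> a = t * pmf \<psi>\<^sub>1 a + (1 - t) * pmf \<psi>\<^sub>2 a) \<longrightarrow>
        varphi G v q (\<lambda>k. t * m\<^sub>1 k + (1 - t) * m\<^sub>2 k) \<psi>
          \<le> ennreal t * varphi G v q m\<^sub>1 \<psi>\<^sub>1 + ennreal (1 - t) * varphi G v q m\<^sub>2 \<psi>\<^sub>2"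
    by (intro allI impI varphi_convex) auto
  have finite: "\<forall>\<rho>mi\<ge>0. \<forall>\<rho>ma\<ge>0. chi G v q \<rho>mi \<rho>ma < \<infinity>"
    using chi_finite by simp
  have mono: "\<forall>\<rho>mi\<ge>0. \<forall>\<rho>ma\<ge>0. \<forall>\<rho>ma'\<ge>\<rho>ma. chi G v q \<rho>mi \<rho>ma \<le> chi G v q \<rho>mi \<rho>ma'"
    using chi_mono by blast
  have entropy: "\<forall>m. (\<forall>k\<ge>1. 0 \<le> m k) \<longrightarrow>
        (\<forall>P\<in>(shift_invariant :: 'd config measure set).
           (\<forall>k\<ge>1. (\<integral>\<^sup>+\<omega>. N_mark {0} k \<omega> \<partial>P) = ennreal (m k)) \<longrightarrow>
           specific_entropy q P = seq_entropy m q + specific_entropy m P) \<and>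
        specific_entropy q (poisson_process m :: 'd config measure) = seq_entropy m q"
  proof (intro allI impI conjI ballI)
    fix m :: "nat \<Rightarrow> real" assume m: "\<forall>k\<ge>1. 0 \<le> m k"
    then show "specific_entropy q (poisson_process m :: 'd config measure) = seq_entropy m q"
      by (intro specific_entropy_poisson_process q_pos) auto
    fix P :: "'d config measure"
    assume "P \<in> shift_invariant" "\<forall>k\<ge>1. (\<integral>\<^sup>+\<omega>. N_mark {0} k \<omega> \<partial>P) = ennreal (m k)"
    then show "specific_entropy q P = seq_entropy m q + specific_entropy m P"
      using m by (intro specific_entropy_change q_pos) auto
  qed
  have zero: "chi G v q 0 0 = ennreal (\<Sum>\<^sub>\<infinity>k\<in>{1..}. q k)" "chi G (\<lambda>_. 0) q 0 0 = ennreal (\<Sum>\<^sub>\<infinity>k\<in>{1..}. q k)"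
    by (simp_all only: chi_0_0 free.chi_0_0 q_total_def free.q_total_def)
  have bounds: "\<forall>\<rho>\<ge>0.
        (2 * v 0 \<ge> vbar v \<longrightarrow>
           chi G (\<lambda>_. 0) q \<rho> 0 + ennreal (vbar v * \<rho>\<^sup>2) \<le> chi G v q \<rho> 0) \<and>
        chi G v q \<rho> 0 \<le> chi G (\<lambda>_. 0) q \<rho> 0 + ennreal (vbar v * (\<rho>\<^sup>2 + \<rho>))"
    using chi_ge_noninteracting chi_le_noninteracting by blast
  show ?thesis
    using varphi_mono
    by (intro conjI convex finite chi_real_convex_on chi_real_continuous chi_real_convex_on_left mono entropy zero
        chi_right_derivative_at_0 bounds) auto
qed

end
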